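(* For every $\alpha\in(0,1/2)$ there is a deterministic continuous increasing function $b:[0,\infty)\to[0,1]$, with $b(0)=0$ and total variation $1$, such that: (i) $b$ is globally $\alpha$-Hölder continuous and its Stieltjes measure $db$ is singular with respect to Lebesgue measure; (ii) for every $\nu<1$ and $T>0$, the equation $$W_t=B_t+\nu M_t(W)+\tfrac12 L^0_t(W-b),\qquad W_t-b(t)\ge 0,$$ has no continuous adapted solution on $[0,T]$.
   Context: $(\Omega,\mathscr{F},(\mathscr{F}_t)_{t\ge0},\mathbb{P})$ is a filtered probability space satisfying the usual conditions and $B$ is a standard $(\mathscr{F}_t)$-Brownian motion started at $0$. "Increasing" means nondecreasing. For a continuous function $w$, $M_t(w):=\sup_{0\le s\le t}w_s$. For a continuous semimartingale $X$, $L^a_t(X)$ is the local time at level $a$ up to time $t$, normalized by $L^a_t(X)=\lim_{\varepsilon\downarrow0}\frac1\varepsilon\int_0^t\mathbf 1_{[a,a+\varepsilon)}(X_s)\,d\langle X\rangle_s$. A solution on $[0,T]$ is a continuous $(\mathscr{F}_t)$-adapted semimartingale $W=(W_t)_{0\le t\le T}$ satisfying the equation and the constraint almost surely for all $t\in[0,T]$. *)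

theory Defs
  imports "HOL-Probability.Probability"
begin

section \<open>Functions of one real variable\<close>

definition partition_of :: "real \<Rightarrow> real \<Rightarrow> nat \<Rightarrow> (nat \<Rightarrow> real) \<Rightarrow> bool" where
  "partition_of a b n p \<longleftrightarrow> p 0 = a \<and> p n = b \<and> (\<forall>i<n. p i \<le> p (Suc i))"

definition total_variation_on :: "(real \<Rightarrow> real) \<Rightarrow> real set \<Rightarrow> ennreal" where
  "total_variation_on f S =
     Sup {(\<Sum>i<n. ennreal \<bar>f (p (Suc i)) - f (p i)\<bar>) | n p.
            (\<forall>i\<le>n. p i \<in> S) \<and> (\<forall>i<n. p i \<le> p (Suc i))}"

definition holder_continuous_on :: "real \<Rightarrow> real set \<Rightarrow> (real \<Rightarrow> real) \<Rightarrow> bool" where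
  "holder_continuous_on \<alpha> S f \<longleftrightarrow>
     (\<exists>C. \<forall>s\<in>S. \<forall>t\<in>S. \<bar>f s - f t\<bar> \<le> C * \<bar>s - t\<bar> powr \<alpha>)"

definition running_max :: "(real \<Rightarrow> real) \<Rightarrow> real \<Rightarrow> real" where
  "running_max w t = (SUP s\<in>{0..t}. w s)"

definition mutually_singular :: "'a measure \<Rightarrow> 'a measure \<Rightarrow> bool" where
  "mutually_singular M N \<longleftrightarrow>
     (\<exists>A\<in>sets M \<inter> sets N. emeasure M A = 0 \<and> emeasure N (space N - A) = 0)"

text \<open>The Stieltjes measure of a continuous nondecreasing function given on the half-line
  \<open>t \<ge> 0\<close>: it is extended by \<open>f 0\<close> to negative times, which carry no mass.\<close>

definition stieltjes_measure :: "(real \<Rightarrow> real) \<Rightarrow> real measure" where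
  "stieltjes_measure f = interval_measure (\<lambda>t. f (max 0 t))"

section \<open>Filtered probability spaces and Brownian motion\<close>

text \<open>Time is \<open>real\<close>, but only \<open>t \<ge> 0\<close> matters: a filtration indexed by \<open>t \<ge> 0\<close> extends to the
  whole line by \<open>F 0\<close>, and no later definition depends on the extension.\<close>

locale filtered_prob_space_usual = prob_space M + complete_measure M + filtration "space M" F
  for M :: "'a measure" and F :: "real \<Rightarrow> 'a measure" +
  assumes subalgebra_F: "\<And>t. subalgebra M (F t)"
    and null_sets_F: "null_sets M \<subseteq> sets (F 0)"
    and right_continuous_F: "\<And>t. 0 \<le> t \<Longrightarrow> (\<Inter>u\<in>{t<..}. sets (F u)) = sets (F t)"

definition brownian_motion ::
    "'a measure \<Rightarrow> (real \<Rightarrow> 'a measure) \<Rightarrow> (real \<Rightarrow> 'a \<Rightarrow> real) \<Rightarrow> bool" where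
  "brownian_motion M F B \<longleftrightarrow>
     (\<forall>t\<ge>0. B t \<in> borel_measurable (F t)) \<and>
     (AE \<omega> in M. B 0 \<omega> = 0) \<and>
     (AE \<omega> in M. continuous_on {0..} (\<lambda>t. B t \<omega>)) \<and>
     (\<forall>s t. 0 \<le> s \<and> s < t \<longrightarrow>
        distributed M lborel (\<lambda>\<omega>. B t \<omega> - B s \<omega>) (normal_density 0 (sqrt (t - s))) \<and>
        prob_space.indep_set M (sets (F s))
          (sets (vimage_algebra (space M) (\<lambda>\<omega>. B t \<omega> - B s \<omega>) borel)))"

section \<open>Continuous semimartingales on a compact time interval\<close>

definition continuous_adapted ::
    "'a measure \<Rightarrow> (real \<Rightarrow> 'a measure) \<Rightarrow> real \<Rightarrow> (real \<Rightarrow> 'a \<Rightarrow> real) \<Rightarrow> bool" where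
  "continuous_adapted M F T X \<longleftrightarrow>
     (\<forall>t\<in>{0..T}. X t \<in> borel_measurable (F t)) \<and>
     (AE \<omega> in M. continuous_on {0..T} (\<lambda>t. X t \<omega>))"

definition martingale_on ::
    "'a measure \<Rightarrow> (real \<Rightarrow> 'a measure) \<Rightarrow> real \<Rightarrow> (real \<Rightarrow> 'a \<Rightarrow> real) \<Rightarrow> bool" where
  "martingale_on M F T X \<longleftrightarrow>
     (\<forall>t\<in>{0..T}. X t \<in> borel_measurable (F t) \<and> integrable M (X t)) \<and>
     (\<forall>t\<in>{0..T}. \<forall>s\<in>{0..t}. AE \<omega> in M. real_cond_exp M (F s) (X t) \<omega> = X s \<omega>)"

text \<open>On a compact interval \<open>[0, T]\<close> a localizing sequence may be taken with values in \<open>[0, T]\<close>;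
  divergence to infinity then becomes: almost surely \<open>\<tau> n = T\<close> from some \<open>n\<close> on.\<close>

definition continuous_local_martingale ::
    "'a measure \<Rightarrow> (real \<Rightarrow> 'a measure) \<Rightarrow> real \<Rightarrow> (real \<Rightarrow> 'a \<Rightarrow> real) \<Rightarrow> bool" where
  "continuous_local_martingale M F T X \<longleftrightarrow>
     continuous_adapted M F T X \<and>
     (\<exists>\<tau>::nat \<Rightarrow> 'a \<Rightarrow> real.
        (\<forall>n. stopping_time F (\<tau> n) \<and> (\<forall>\<omega>\<in>space M. \<tau> n \<omega> \<in> {0..T})) \<and>
        (AE \<omega> in M. incseq (\<lambda>n. \<tau> n \<omega>) \<and> (\<exists>n. \<tau> n \<omega> = T)) \<and>
        (\<forall>n. martingale_on M F T (\<lambda>t \<omega>. X (min t (\<tau> n \<omega>)) \<omega> - X 0 \<omega>)))"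

definition continuous_finite_variation ::
    "'a measure \<Rightarrow> (real \<Rightarrow> 'a measure) \<Rightarrow> real \<Rightarrow> (real \<Rightarrow> 'a \<Rightarrow> real) \<Rightarrow> bool" where
  "continuous_finite_variation M F T A \<longleftrightarrow>
     continuous_adapted M F T A \<and>
     (AE \<omega> in M. total_variation_on (\<lambda>t. A t \<omega>) {0..T} < \<infinity>)"

definition continuous_semimartingale ::
    "'a measure \<Rightarrow> (real \<Rightarrow> 'a measure) \<Rightarrow> real \<Rightarrow> (real \<Rightarrow> 'a \<Rightarrow> real) \<Rightarrow> bool" where
  "continuous_semimartingale M F T X \<longleftrightarrow>
     continuous_adapted M F T X \<and>
     (\<exists>N A. continuous_local_martingale M F T N \<and> continuous_finite_variation M F T A \<and>
        (AE \<omega> in M. \<forall>t\<in>{0..T}. X t \<omega> = N t \<omega> + A t \<omega>))"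

section \<open>Quadratic variation and local time\<close>

text \<open>\<open>Q\<close> is (a version of) \<open>\<langle>X\<rangle>\<close>: sums of squared increments along partitions of \<open>[0, t]\<close>
  converge to \<open>Q t\<close> in probability as the mesh tends to zero.\<close>

definition is_quadratic_variation ::
    "'a measure \<Rightarrow> (real \<Rightarrow> 'a measure) \<Rightarrow> real \<Rightarrow> (real \<Rightarrow> 'a \<Rightarrow> real) \<Rightarrow>
     (real \<Rightarrow> 'a \<Rightarrow> real) \<Rightarrow> bool" where
  "is_quadratic_variation M F T X Q \<longleftrightarrow>
     continuous_adapted M F T Q \<and>
     (AE \<omega> in M. Q 0 \<omega> = 0 \<and> mono_on {0..T} (\<lambda>t. Q t \<omega>)) \<and>
     (\<forall>t\<in>{0..T}. \<forall>\<eta>>0. \<forall>\<epsilon>>0. \<exists>\<delta>>0. \<forall>n p.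
        partition_of 0 t n p \<and> (\<forall>i<n. p (Suc i) - p i < \<delta>) \<longrightarrow>
        measure M {\<omega>\<in>space M.
          \<bar>(\<Sum>i<n. (X (p (Suc i)) \<omega> - X (p i) \<omega>)\<^sup>2) - Q t \<omega>\<bar> > \<eta>} < \<epsilon>)"

text \<open>\<open>L\<close> is (a version of) the local time \<open>L\<^sup>a(X)\<close>, with the right-sided normalization. The
  quadratic variation is stopped at \<open>T\<close> because it is only meaningful on \<open>[0, T]\<close>.\<close>

definition is_local_time ::
    "'a measure \<Rightarrow> (real \<Rightarrow> 'a measure) \<Rightarrow> real \<Rightarrow> (real \<Rightarrow> 'a \<Rightarrow> real) \<Rightarrow> real \<Rightarrow>
     (real \<Rightarrow> 'a \<Rightarrow> real) \<Rightarrow> bool" where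
  "is_local_time M F T X a L \<longleftrightarrow>
     (\<exists>Q. is_quadratic_variation M F T X Q \<and>
        (AE \<omega> in M. \<forall>t\<in>{0..T}.
           ((\<lambda>\<epsilon>. 1 / \<epsilon> * (LINT s:{0..t}|stieltjes_measure (\<lambda>s. Q (min s T) \<omega>).
                              indicator {a..<a + \<epsilon>} (X s \<omega>)))
              \<longlongrightarrow> L t \<omega>) (at_right 0)))"

section \<open>The equation\<close>

definition is_solution ::
    "'a measure \<Rightarrow> (real \<Rightarrow> 'a measure) \<Rightarrow> (real \<Rightarrow> 'a \<Rightarrow> real) \<Rightarrow> (real \<Rightarrow> real) \<Rightarrow> real \<Rightarrow>
     real \<Rightarrow> (real \<Rightarrow> 'a \<Rightarrow> real) \<Rightarrow> bool" where
  "is_solution M F B b \<nu> T W \<longleftrightarrow>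
     continuous_semimartingale M F T W \<and>
     (\<exists>L. is_local_time M F T (\<lambda>t \<omega>. W t \<omega> - b t) 0 L \<and>
        (AE \<omega> in M. \<forall>t\<in>{0..T}.
           W t \<omega> = B t \<omega> + \<nu> * running_max (\<lambda>s. W s \<omega>) t + 1 / 2 * L t \<omega> \<and>
           W t \<omega> - b t \<ge> 0))"

end

theory Submission
  imports Defs "HOL-Real_Asymp.Real_Asymp"
begin

text \<open>
  Write \<open>X = W - b\<close> and \<open>M = sup W\<close>. As \<open>X \<ge> 0\<close>, Tanaka's formula forces
  \<open>1/2 L = \<integral> 1{X = 0} d(\<nu> M + 1/2 L - b)\<close>, hence \<open>\<integral> 1{X = 0} db = \<nu> \<integral> 1{X = 0} dM\<close>. The measure \<open>dM\<close>
  lives on \<open>{W = M}\<close>, where \<open>X = M - b\<close>, and \<open>d(M - b)\<close> does not charge \<open>{M - b = 0}\<close>; so the right-hand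
  side is at most \<open>\<nu>\<^sup>+ \<integral> 1{X = 0} db\<close> and, since \<open>\<nu> < 1\<close>, the measure \<open>db\<close> does not charge \<open>{X = 0}\<close>.

  On the other hand, let \<open>b\<close> be the inverse of the pure jump function \<open>y \<mapsto> \<Sum>n. r ^ n * \<lfloor>2 ^ n * y\<rfloor>\<close>
  with \<open>r = 2 powr (- 1 / \<alpha>)\<close>. For a \<open>db\<close>-large set of times \<open>t\<close> it satisfies
  \<open>b t - b s \<ge> c * (t - s) powr (1 / p)\<close> for all \<open>s < t\<close>, with \<open>p > 2\<close>. Brownian paths are Hoelder
  continuous with an exponent larger than \<open>1 / p\<close>, so near time \<open>0\<close> the solution cannot keep up with
  the barrier at these times without being on it, and \<open>X t = 0\<close>: a contradiction.

  No stochastic integral is needed. Tanaka's formula is replaced by a Taylor expansion of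
  \<open>(\<epsilon> - x)\<^sup>2 / (2 * \<epsilon>)\<close> along dyadic grids, with mesh tending to \<open>0\<close> before \<open>\<epsilon>\<close>; the martingale part
  \<open>\<Sum> hat \<epsilon> (X) dB\<close> has second moment at most the expected time spent by \<open>X\<close> in \<open>[0, \<epsilon>)\<close>.
\<close>

section \<open>The inverse of a pure jump function\<close>

text \<open>A dyadic point of level \<open>n\<close> gives \<open>stair\<close> a jump of order
  \<open>r ^ n\<close>, so \<open>b\<close> pauses there for a time of that order. The pauses
  exhaust Lebesgue-almost all time before \<open>b\<close> reaches 1, and they are short compared
  with the spacing of the dyadic points, which makes the inverse steep. The condition \<alpha> < 1/2
  leaves room for \<open>2 < p < 1 / \<alpha>\<close>: the loss from 1 / \<alpha> down to
  \<open>p\<close> pays for discarding a small set of badly placed values, and \<open>p > 2\<close>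
  leaves a Hoelder exponent \<beta> of Brownian motion with 1 / p < \<beta> < 1 / 2. Two
  difficulties shape the probabilistic half. The horizon up to which contact is forced depends on
  the path through its Hoelder constant, whereas null sets may be discarded only countably often;
  hence horizons \<open>\<tau> m\<close> and levels \<open>eps k\<close> are fixed in advance and
  only the index is chosen along the path. Moreover nothing is known about the integrability of
  \<open>L\<close>, so the noise is controlled by Fatou's lemma in both directions, dominated by the
  deterministic bound \<tau> on occupation times.\<close>

definition stair :: "real \<Rightarrow> real \<Rightarrow> real" where
  "stair r y = (\<Sum>n. r ^ n * of_int \<lfloor>2 ^ n * y\<rfloor>)"

text \<open>Generalised inverse: a jump of \<open>stair\<close> becomes an interval of constancy.
  The cut at 1 makes it constant from time \<open>stair r 1\<close> on.\<close>

definition unstair :: "real \<Rightarrow> real \<Rightarrow> real" where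
  "unstair r t = Sup {y\<in>{0..1}. stair r y \<le> t}"

text \<open>A real \<open>y\<close> is well placed if it is not too close to the dyadic points on its left, which are the
  jumps of \<open>stair\<close>. The guard drops the levels whose only dyadic point left of \<open>y\<close> is \<open>0\<close>, where
  there is no jump; without it the exceptional set would be large near \<open>0\<close>.\<close>

definition well_placed :: "real \<Rightarrow> real \<Rightarrow> bool" where
  "well_placed l y \<longleftrightarrow> (\<forall>n. 1 \<le> 2 ^ n * y \<longrightarrow> l ^ n \<le> frac (2 ^ n * y))"

text \<open>This is the bound \<open>b t - b s \<ge> c * (t - s) powr (1 / p)\<close> raised to the
  power \<open>p\<close>. It concerns the past of \<open>t\<close> only, since it will be compared
  with the last zero of \<open>X\<close> before \<open>t\<close>.\<close>

definition steep :: "real \<Rightarrow> real \<Rightarrow> (real \<Rightarrow> real) \<Rightarrow> real \<Rightarrow> bool" where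
  "steep K p b t \<longleftrightarrow> (\<forall>s\<in>{0..t}. t - s \<le> K * (b t - b s) powr p)"

context
  fixes r :: real
  assumes r: "0 < r" "r < 1 / 4"
begin

section \<open>Summability and growth of the jump function\<close>

lemma stair_terms:
  assumes "0 \<le> y"
  shows "0 \<le> r ^ n * of_int \<lfloor>2 ^ n * y\<rfloor>" "r ^ n * of_int \<lfloor>2 ^ n * y\<rfloor> \<le> (2 * r) ^ n * y"
proof -
  show "0 \<le> r ^ n * of_int \<lfloor>2 ^ n * y\<rfloor>" using r assms by simp
  have "r ^ n * of_int \<lfloor>2 ^ n * y\<rfloor> \<le> r ^ n * (2 ^ n * y)"
    using r by (intro mult_left_mono) auto
  then show "r ^ n * of_int \<lfloor>2 ^ n * y\<rfloor> \<le> (2 * r) ^ n * y" by (simp add: power_mult_distrib mult_ac)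
qed

lemma summable_stair:
  fixes y :: real
  assumes "0 \<le> y" shows "summable (\<lambda>n. r ^ n * of_int \<lfloor>2 ^ n * y\<rfloor>)"
proof (rule summable_comparison_test')
  show "summable (\<lambda>n. (2 * r) ^ n * y)" using r by (intro summable_mult2 summable_geometric) auto
  show "norm (r ^ n * of_int \<lfloor>2 ^ n * y\<rfloor>) \<le> (2 * r) ^ n * y" for n
    using stair_terms[OF assms, of n] by simp
qed

lemma stair_nonneg: "0 \<le> y \<Longrightarrow> 0 \<le> stair r y"
  unfolding stair_def by (intro suminf_nonneg summable_stair stair_terms)

text \<open>A geometric series, whose sum is at most 2 because \<open>r < 1 / 4\<close>. It makes
  the horizons \<open>stair r (1 / 2 ^ m)\<close> tend to 0.\<close>

lemma stair_le: assumes "0 \<le> y" shows "stair r y \<le> 2 * y"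
proof -
  have "stair r y \<le> (\<Sum>n. (2 * r) ^ n * y)"
    unfolding stair_def using r assms
    by (intro suminf_le summable_stair stair_terms summable_mult2 summable_geometric) auto
  also have "\<dots> = y / (1 - 2 * r)"
    using r by (subst suminf_mult2[symmetric]) (auto simp: suminf_geometric intro!: summable_geometric)
  also have "\<dots> \<le> 2 * y" using r assms mult_right_mono[of "4 * r" 1 y] by (simp add: field_simps)
  finally show ?thesis .
qed

lemma stair_0 [simp]: "stair r 0 = 0"
  by (simp add: stair_def)

lemma stair_diff:
  assumes "0 \<le> x" "x \<le> y"
  shows "(\<lambda>n. r ^ n * of_int (\<lfloor>2 ^ n * y\<rfloor> - \<lfloor>2 ^ n * x\<rfloor>)) sums (stair r y - stair r x)"
    "0 \<le> r ^ n * of_int (\<lfloor>2 ^ n * y\<rfloor> - \<lfloor>2 ^ n * x\<rfloor>)"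
proof -
  show "(\<lambda>n. r ^ n * of_int (\<lfloor>2 ^ n * y\<rfloor> - \<lfloor>2 ^ n * x\<rfloor>)) sums (stair r y - stair r x)"
    unfolding stair_def of_int_diff right_diff_distrib using assms
    by (intro sums_diff summable_sums summable_stair) auto
  have "\<lfloor>2 ^ n * x\<rfloor> \<le> \<lfloor>2 ^ n * y\<rfloor>" using assms by (intro floor_mono) auto
  then show "0 \<le> r ^ n * of_int (\<lfloor>2 ^ n * y\<rfloor> - \<lfloor>2 ^ n * x\<rfloor>)" using r by simp
qed

lemma stair_mono: assumes "0 \<le> x" "x \<le> y" shows "stair r x \<le> stair r y"
  using sums_le[OF _ sums_zero stair_diff(1)[OF assms]] stair_diff(2)[OF assms] by fastforce

text \<open>With h = y - x, the level \<open>n\<close> with \<open>1 / h \<le> 2 ^ n < 2 / h\<close>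
  has a dyadic point in the half-open interval from \<open>x\<close> to \<open>y\<close>. This level
  alone contributes \<open>r ^ n\<close>, which is \<open>(1 / 2 ^ n) powr (1 / \<alpha>)\<close> by
  the choice of \<open>r\<close>.\<close>

lemma stair_lower:
  assumes "0 \<le> x" "x < y" "y \<le> 1" and \<alpha>: "0 < \<alpha>" "r = 2 powr (- 1 / \<alpha>)"
  shows "((y - x) / 2) powr (1 / \<alpha>) \<le> stair r y - stair r x"
proof -
  define h where "h = y - x"
  have h: "0 < h" "h \<le> 1" using assms by (auto simp: h_def)
  define n where "n = nat \<lceil>log 2 (1 / h)\<rceil>"
  have n0: "0 \<le> log 2 (1 / h)" using h by simp
  then have n1: "log 2 (1 / h) \<le> n" "n < log 2 (1 / h) + 1" unfolding n_def by linarith+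
  have "2 powr log 2 (1 / h) \<le> 2 powr n" using n1 by simp
  then have a1: "1 \<le> 2 ^ n * h" using h by (simp add: powr_realpow field_simps)
  have "2 powr n \<le> 2 powr (log 2 (1 / h) + 1)" using n1 by simp
  then have "2 ^ n \<le> 1 / h * 2" using h by (simp add: powr_realpow powr_add)
  then have a2: "h / 2 \<le> 1 / 2 ^ n" using h by (simp add: field_simps)
  have "2 ^ n * x + 1 \<le> 2 ^ n * y" using a1 by (simp add: h_def algebra_simps)
  then have "\<lfloor>2 ^ n * x\<rfloor> + 1 \<le> \<lfloor>2 ^ n * y\<rfloor>" by linarith
  then have "1 \<le> real_of_int (\<lfloor>2 ^ n * y\<rfloor> - \<lfloor>2 ^ n * x\<rfloor>)" by linarith
  then have "r ^ n * 1 \<le> r ^ n * of_int (\<lfloor>2 ^ n * y\<rfloor> - \<lfloor>2 ^ n * x\<rfloor>)"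
    using r by (intro mult_left_mono) auto
  also have "\<dots> \<le> stair r y - stair r x"
    using sum_le_suminf[OF sums_summable[OF stair_diff(1)], of x y "{n}"] stair_diff[of x y] assms
    by (auto simp: sums_iff)
  finally have b: "r ^ n \<le> stair r y - stair r x" by simp
  have "(h / 2) powr (1 / \<alpha>) \<le> (1 / 2 ^ n) powr (1 / \<alpha>)"
    using a2 h \<alpha> by (intro powr_mono2) auto
  also have "\<dots> = r ^ n"
  proof -
    have "(1 / 2 ^ n) powr (1 / \<alpha>) = (2 powr - real n) powr (1 / \<alpha>)"
      by (simp add: powr_minus powr_realpow divide_inverse)
    also have "\<dots> = (2 powr (- 1 / \<alpha>)) powr real n" by (simp add: powr_powr)
    also have "\<dots> = r ^ n" unfolding \<alpha>(2)[symmetric] using r by (simp add: powr_realpow)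
    finally show ?thesis .
  qed
  finally show ?thesis using b by (simp add: h_def)
qed

lemma stair_strict_mono: assumes "0 \<le> x" "x < y" "y \<le> 1" shows "stair r x < stair r y"
proof -
  \<comment> \<open>The exponent is recovered from \<open>r\<close> by solving
    \<open>r = 2 powr (- 1 / \<alpha>)\<close>.\<close>
  define \<alpha> where "\<alpha> = - 1 / log 2 r"
  have l: "log 2 r < 0" using r by (simp add: log_less_zero_cancel_iff)
  have "0 < \<alpha>" "r = 2 powr (- 1 / \<alpha>)" using l r by (auto simp: \<alpha>_def field_simps)
  from stair_lower[OF assms this] show ?thesis using assms
    by (smt (verit, ccfv_SIG) divide_pos_pos powr_gt_zero)
qed

section \<open>The continuous inverse\<close>

lemma unstair_set:
  shows "0 \<le> t \<Longrightarrow> {y\<in>{0..1}. stair r y \<le> t} \<noteq> {}" and "bdd_above {y\<in>{0..1}. stair r y \<le> t}"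
proof -
  show "bdd_above {y\<in>{0..1}. stair r y \<le> t}" by (auto intro!: bdd_aboveI[of _ 1])
  assume "0 \<le> t"
  then have "0 \<in> {y\<in>{0..1}. stair r y \<le> t}" by simp
  then show "{y\<in>{0..1}. stair r y \<le> t} \<noteq> {}" by blast
qed

lemma unstair_ge: "\<lbrakk>0 \<le> y; y \<le> 1; stair r y \<le> t\<rbrakk> \<Longrightarrow> y \<le> unstair r t"
  unfolding unstair_def by (rule cSup_upper) (auto intro!: bdd_aboveI[of _ 1])

lemma unstair_range: assumes "0 \<le> t" shows "0 \<le> unstair r t" "unstair r t \<le> 1"
proof -
  show "0 \<le> unstair r t" using assms by (intro unstair_ge) auto
  show "unstair r t \<le> 1" unfolding unstair_def using unstair_set(1)[OF assms]
    by (intro cSup_least) auto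
qed

lemma less_unstair: assumes "0 \<le> t" "0 \<le> x" "x < unstair r t" shows "stair r x \<le> t"
proof -
  obtain y where "y \<in> {y\<in>{0..1}. stair r y \<le> t}" "x < y"
    using less_cSupD[OF unstair_set(1)[OF assms(1)]] assms(3) unfolding unstair_def by blast
  then show ?thesis using stair_mono[of x y] assms by auto
qed

lemma unstair_less: assumes "0 \<le> x" "unstair r t < x" "x \<le> 1" shows "t < stair r x"
  using unstair_ge[of x t] assms by force

text \<open>If the inverse were larger than \<open>y\<close>, then \<open>stair\<close> would not
  grow immediately to the right of \<open>y\<close>, against strict monotonicity.\<close>

lemma unstair_stair: assumes "0 \<le> y" "y \<le> 1" shows "unstair r (stair r y) = y"
proof (rule antisym)
  show "y \<le> unstair r (stair r y)" using assms by (intro unstair_ge) auto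
  show "unstair r (stair r y) \<le> y"
  proof (rule ccontr)
    assume a: "\<not> ?thesis"
    define z where "z = (y + unstair r (stair r y)) / 2"
    have s: "0 \<le> stair r y" using assms stair_nonneg by auto
    have z: "y < z" "z < unstair r (stair r y)" using a by (auto simp: z_def)
    then have "z \<le> 1" using unstair_range[OF s] by auto
    have "stair r z \<le> stair r y" using z assms s by (intro less_unstair) auto
    with stair_strict_mono[of y z] z assms \<open>z \<le> 1\<close> show False by auto
  qed
qed

lemma unstair_0: "unstair r 0 = 0"
  using unstair_stair[of 0] by simp

lemma unstair_mono: assumes "0 \<le> s" "s \<le> t" shows "unstair r s \<le> unstair r t"
  unfolding unstair_def using assms unstair_set by (intro cSup_subset_mono) auto

lemma unstair_eq_1: "stair r 1 \<le> t \<Longrightarrow> unstair r t = 1"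
  using unstair_mono[of "stair r 1" t] unstair_stair[of 1] unstair_range[of t] stair_nonneg[of 1]
  by auto

lemma unstair_holder:
  assumes "0 \<le> s" "s \<le> t" and \<alpha>: "0 < \<alpha>" "r = 2 powr (- 1 / \<alpha>)"
  shows "unstair r t - unstair r s \<le> 2 * (t - s) powr \<alpha>"
proof (rule ccontr)
  assume a: "\<not> ?thesis"
  \<comment> \<open>A quarter of the excess. Moving both values inwards by \<open>d\<close> brings
    them into the range of \<open>less_unstair\<close> and \<open>unstair_less\<close>, and a
    surplus of \<open>2 * d\<close> still contradicts \<open>stair_lower\<close>.\<close>
  define d where "d = (unstair r t - unstair r s - 2 * (t - s) powr \<alpha>) / 4"
  define x where "x = unstair r s + d"
  define y where "y = unstair r t - d"
  have d: "0 < d" using a by (simp add: d_def)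
  have yx: "y - x = 2 * (t - s) powr \<alpha> + 2 * d" by (simp add: x_def y_def d_def field_simps)
  have xy: "0 \<le> x" "x < y" "y \<le> 1" using unstair_range[of s] unstair_range[of t] assms d yx
    by (auto simp: x_def y_def) (smt (verit) powr_ge_zero)+
  have "stair r y \<le> t" using xy assms d by (intro less_unstair) (auto simp: y_def)
  moreover have "s < stair r x" using xy assms d by (intro unstair_less) (auto simp: x_def)
  ultimately have "((y - x) / 2) powr (1 / \<alpha>) \<le> t - s" using stair_lower[OF xy \<alpha>] by simp
  then have "(((y - x) / 2) powr (1 / \<alpha>)) powr \<alpha> \<le> (t - s) powr \<alpha>"
    using \<alpha> by (intro powr_mono2) auto
  then have "(y - x) / 2 \<le> (t - s) powr \<alpha>" using \<alpha> xy by (simp add: powr_powr)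
  then show False using yx d by simp
qed

lemma holder_unstair:
  assumes "0 < \<alpha>" "r = 2 powr (- 1 / \<alpha>)"
  shows "holder_continuous_on \<alpha> {0..} (unstair r)"
  unfolding holder_continuous_on_def
proof (intro exI[of _ 2] ballI)
  fix s t :: real assume "s \<in> {0..}" "t \<in> {0..}"
  then show "\<bar>unstair r s - unstair r t\<bar> \<le> 2 * \<bar>s - t\<bar> powr \<alpha>"
    using unstair_holder[of s t \<alpha>] unstair_holder[of t s \<alpha>] unstair_mono[of s t] unstair_mono[of t s] assms
    by (cases "s \<le> t") auto
qed

lemma continuous_on_unstair: "continuous_on {0..} (unstair r)"
proof -
  define \<alpha> where "\<alpha> = - 1 / log 2 r"
  have l: "log 2 r < 0" using r by (simp add: log_less_zero_cancel_iff)
  have \<alpha>: "0 < \<alpha>" "r = 2 powr (- 1 / \<alpha>)" using l r by (auto simp: \<alpha>_def field_simps)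
  obtain C where C: "\<And>s t. s \<ge> 0 \<Longrightarrow> t \<ge> 0 \<Longrightarrow> \<bar>unstair r s - unstair r t\<bar> \<le> C * \<bar>s - t\<bar> powr \<alpha>"
    using holder_unstair[OF \<alpha>] unfolding holder_continuous_on_def by auto
  show ?thesis
    unfolding continuous_on_def
  proof
    fix x :: real assume x: "x \<in> {0..}"
    have "((\<lambda>s. C * \<bar>s - x\<bar> powr \<alpha>) \<longlongrightarrow> C * \<bar>x - x\<bar> powr \<alpha>) (at x within {0..})"
      using \<alpha>(1) by (intro tendsto_intros tendsto_powr') auto
    then have *: "((\<lambda>s. C * \<bar>s - x\<bar> powr \<alpha>) \<longlongrightarrow> 0) (at x within {0..})" by simp
    have "((\<lambda>s. unstair r s - unstair r x) \<longlongrightarrow> 0) (at x within {0..})"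
      by (rule Lim_null_comparison[OF _ *]) (use C x in \<open>auto simp: eventually_at_filter\<close>)
    then show "(unstair r \<longlongrightarrow> unstair r x) (at x within {0..})"
      by (simp add: LIM_zero_iff)
  qed
qed

lemma total_variation_unstair: "total_variation_on (unstair r) {0..} = 1"
  unfolding total_variation_on_def
proof (rule antisym)
  show "Sup {\<Sum>i<n. ennreal \<bar>unstair r (p (Suc i)) - unstair r (p i)\<bar> |n p.
      (\<forall>i\<le>n. p i \<in> {0..}) \<and> (\<forall>i<n. p i \<le> p (Suc i))} \<le> 1"
  proof (rule Sup_least, clarify)
    fix n :: nat and p :: "nat \<Rightarrow> real"
    assume p: "\<forall>i\<le>n. p i \<in> {0..}" "\<forall>i<n. p i \<le> p (Suc i)"
    have "(\<Sum>i<n. ennreal \<bar>unstair r (p (Suc i)) - unstair r (p i)\<bar>)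
        = ennreal (\<Sum>i<n. unstair r (p (Suc i)) - unstair r (p i))"
      using p unstair_mono by (subst sum_ennreal[symmetric]) (auto intro!: sum.cong)
    also have "\<dots> = ennreal (unstair r (p n) - unstair r (p 0))"
      by (subst sum_lessThan_telescope) auto
    also have "\<dots> \<le> 1" using p unstair_range[of "p n"] unstair_range[of "p 0"] by (auto simp flip: ennreal_1 intro!: ennreal_leI)
    finally show "(\<Sum>i<n. ennreal \<bar>unstair r (p (Suc i)) - unstair r (p i)\<bar>) \<le> 1" .
  qed
  show "1 \<le> Sup {\<Sum>i<n. ennreal \<bar>unstair r (p (Suc i)) - unstair r (p i)\<bar> |n p.
      (\<forall>i\<le>n. p i \<in> {0..}) \<and> (\<forall>i<n. p i \<le> p (Suc i))}"
    by (rule Sup_upper, clarify, rule exI[of _ 1], rule exI[of _ "\<lambda>i. if i = 0 then 0 else stair r 1"])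
      (auto simp: unstair_0 unstair_stair stair_nonneg)
qed

lemma stieltjes_unstair_Icc:
  assumes "c \<le> d"
  shows "emeasure (stieltjes_measure (unstair r)) {c..d} = unstair r (max 0 d) - unstair r (max 0 c)"
  unfolding stieltjes_measure_def
proof (rule emeasure_interval_measure_Icc[OF assms])
  show "continuous_on UNIV (\<lambda>t. unstair r (max 0 t))"
    by (rule continuous_on_compose2[OF continuous_on_unstair]) (auto intro!: continuous_intros)
qed (auto intro!: unstair_mono)

section \<open>Singularity of the Stieltjes measure\<close>

lemma stair_cell:
  assumes "0 \<le> y" "real j \<le> 2 ^ N * y" "2 ^ N * y < real j + 1"
  shows "stair r y \<le> stair r (j / 2 ^ N) + r ^ N"
proof -
  let ?q = "real j / 2 ^ N"
  have q: "0 \<le> ?q" "?q \<le> y" "y - ?q \<le> 1 / 2 ^ N"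
  proof -
    have "y < (real j + 1) / 2 ^ N" using assms(3) by (simp add: field_simps)
    then show "y - ?q \<le> 1 / 2 ^ N" by (simp add: add_divide_distrib)
  qed (use assms in \<open>auto simp: field_simps\<close>)
  \<comment> \<open>Levels up to \<open>N\<close> do not change inside the cell. At a finer level
    the left endpoint is sent to an integer, so the floor grows by at most \<open>2 ^ n\<close>
    times the cell length. The tail sums to \<open>(2 * r / (1 - 2 * r)) * r ^ N\<close>, and
    \<open>r < 1 / 4\<close> brings the factor below 1.\<close>
  have t: "r ^ n * of_int (\<lfloor>2 ^ n * y\<rfloor> - \<lfloor>2 ^ n * ?q\<rfloor>) \<le> (if n \<le> N then 0 else (2 * r) ^ n / 2 ^ N)" for n
  proof (cases "n \<le> N")
    case True
    define w where "w = \<lfloor>2 ^ n * y\<rfloor>"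
    have e: "2 ^ N = 2 ^ (N - n) * (2::real) ^ n" using True by (simp flip: power_add)
    have "of_int (w * 2 ^ (N - n)) \<le> 2 ^ N * y" unfolding e w_def
      using mult_right_mono[of "real_of_int \<lfloor>2 ^ n * y\<rfloor>" "2 ^ n * y" "2 ^ (N - n)"] by (simp add: mult_ac)
    then have "w * 2 ^ (N - n) < int j + 1" using assms(3) by linarith
    then have "of_int (w * 2 ^ (N - n)) \<le> real j" by linarith
    then have "of_int w \<le> 2 ^ n * ?q" unfolding e by (simp add: field_simps)
    then have "w \<le> \<lfloor>2 ^ n * ?q\<rfloor>" by linarith
    then show ?thesis using True r by (auto simp: w_def intro!: mult_nonneg_nonpos)
  next
    case False
    have "2 ^ n * ?q = of_int (2 ^ (n - N) * int j)" using False
      by (simp add: field_simps flip: power_add)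
    then have fq: "of_int \<lfloor>2 ^ n * ?q\<rfloor> = 2 ^ n * ?q" by (metis floor_of_int)
    have "of_int (\<lfloor>2 ^ n * y\<rfloor> - \<lfloor>2 ^ n * ?q\<rfloor>) \<le> 2 ^ n * (y - ?q)"
      unfolding of_int_diff fq right_diff_distrib using of_int_floor_le[of "2 ^ n * y"] by linarith
    also have "\<dots> \<le> 2 ^ n * (1 / 2 ^ N)" using q by (intro mult_left_mono) auto
    finally have "r ^ n * of_int (\<lfloor>2 ^ n * y\<rfloor> - \<lfloor>2 ^ n * ?q\<rfloor>) \<le> r ^ n * (2 ^ n * (1 / 2 ^ N))"
      using r by (intro mult_left_mono) auto
    then show ?thesis using False by (simp add: power_mult_distrib mult_ac)
  qed
  have s: "(\<lambda>n. (2 * r) ^ n) sums (1 / (1 - 2 * r))" using r by (intro geometric_sums) auto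
  have "(\<lambda>n. (2 * r) ^ (n + Suc N) / 2 ^ N) sums (1 / (1 - 2 * r) * (2 * r) ^ Suc N / 2 ^ N)"
    unfolding power_add by (intro sums_divide sums_mult2 s)
  then have "(\<lambda>n. if n \<le> N then 0 else (2 * r) ^ n / 2 ^ N) sums (1 / (1 - 2 * r) * (2 * r) ^ Suc N / 2 ^ N)"
    by (subst sums_zero_iff_shift[symmetric, of "Suc N"]) (auto simp: not_le)
  from sums_le[OF t stair_diff(1)[OF q(1,2)] this]
  have "stair r y - stair r ?q \<le> 1 / (1 - 2 * r) * (2 * r) ^ Suc N / 2 ^ N" .
  also have "\<dots> = (2 * r / (1 - 2 * r)) * r ^ N" by (simp add: power_mult_distrib)
  also have "\<dots> \<le> 1 * r ^ N" using r by (intro mult_right_mono) (auto simp: field_simps)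
  finally show ?thesis by simp
qed

text \<open>The range of \<open>stair\<close> on [0, 1] lies in \<open>2 ^ N + 1\<close> intervals
  of length \<open>r ^ N\<close>, whose total length tends to 0, while \<open>b\<close> is constant
  on each gap between them.\<close>

lemma mutually_singular_unstair: "mutually_singular lborel (stieltjes_measure (unstair r))"
proof -
  let ?S = "stieltjes_measure (unstair r)"
  define A where "A N = (\<Union>j\<le>2^N. {stair r (real j / 2 ^ N)..stair r (real j / 2 ^ N) + r ^ N})" for N :: nat
  have [measurable]: "A N \<in> sets borel" for N unfolding A_def by measurable
  have setsS: "sets ?S = sets borel" "space ?S = UNIV" by (auto simp: stieltjes_measure_def)
  have null1: "{c..d} \<in> null_sets ?S" if "unstair r (max 0 d) = unstair r (max 0 c)" for c d
    using that stieltjes_unstair_Icc[of c d] by (cases "c \<le> d") (auto simp: null_sets_def setsS)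
  \<comment> \<open>By \<open>stair_cell\<close> every value below \<open>Suc j / 2 ^ N\<close> is
    attained by \<open>b\<close> before the covering interval of \<open>j\<close> ends; from there
    \<open>b\<close> waits until the next interval begins.\<close>
  have step: "unstair r (max 0 (stair r (real (Suc j) / 2 ^ N))) = unstair r (max 0 (stair r (real j / 2 ^ N) + r ^ N))"
    if j: "j < 2 ^ N" and le: "stair r (real j / 2 ^ N) + r ^ N \<le> stair r (real (Suc j) / 2 ^ N)" for j N
  proof -
    let ?q = "stair r (real j / 2 ^ N) + r ^ N"
    have q: "0 \<le> ?q" using r stair_nonneg[of "real j / 2 ^ N"] by simp
    have j': "real j + 1 \<le> 2 ^ N" using j
      by (metis Suc_eq_plus1 Suc_leI of_nat_1 of_nat_add of_nat_le_numeral_power_cancel_iff)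
    have "real (Suc j) / 2 ^ N \<le> unstair r ?q"
    proof (rule dense_le_bounded[of "real j / 2 ^ N"])
      show "real j / 2 ^ N < real (Suc j) / 2 ^ N" by (simp add: divide_strict_right_mono)
      fix w assume w: "real j / 2 ^ N < w" "w < real (Suc j) / 2 ^ N"
      have "0 \<le> real j / 2 ^ N" by simp
      then have "0 \<le> w" using w(1) by linarith
      moreover have "real (Suc j) / 2 ^ N \<le> 1" using j' by (simp add: pos_divide_le_eq)
      then have "w \<le> 1" using w(2) by linarith
      moreover have "real j \<le> 2 ^ N * w" "2 ^ N * w < real j + 1"
        using w by (simp_all add: pos_divide_less_eq pos_less_divide_eq mult.commute)
      then have "stair r w \<le> ?q" using \<open>0 \<le> w\<close> by (intro stair_cell)
      ultimately show "w \<le> unstair r ?q" by (intro unstair_ge)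
    qed
    moreover have "unstair r ?q \<le> unstair r (stair r (real (Suc j) / 2 ^ N))" by (rule unstair_mono[OF q le])
    moreover have "unstair r (stair r (real (Suc j) / 2 ^ N)) = real (Suc j) / 2 ^ N"
      using j' by (intro unstair_stair) (auto simp: field_simps)
    ultimately show ?thesis using q le by (simp add: max_def)
  qed
  \<comment> \<open>The rays on which \<open>b\<close> is constant are split into compact intervals,
    the only ones that \<open>null1\<close> covers.\<close>
  have cover: "UNIV - A N \<subseteq> (\<Union>k. {- real k..0}) \<union> (\<Union>k. {stair r 1..real k}) \<union>
      (\<Union>j<2^N. {stair r (real j / 2 ^ N) + r ^ N..stair r (real (Suc j) / 2 ^ N)})" for N
  proof
    fix x assume x: "x \<in> UNIV - A N"
    consider "x < 0" | "stair r 1 \<le> x" | "0 \<le> x" "x < stair r 1" by linarith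
    then show "x \<in> (\<Union>k. {- real k..0}) \<union> (\<Union>k. {stair r 1..real k}) \<union>
      (\<Union>j<2^N. {stair r (real j / 2 ^ N) + r ^ N..stair r (real (Suc j) / 2 ^ N)})"
    proof cases
      case 1
      then have "x \<in> {- real (nat \<lceil>- x\<rceil>)..0}" by auto linarith
      then show ?thesis by blast
    next
      case 2
      then have "x \<in> {stair r 1..real (nat \<lceil>x\<rceil>)}" by auto linarith
      then show ?thesis by blast
    next
      case 3
      define P where "P j \<longleftrightarrow> x < stair r (real j / 2 ^ N)" for j :: nat
      have "P (2 ^ N)" "\<not> P 0" using 3 by (auto simp: P_def)
      define j where "j = (LEAST j. P j)"
      have Pj: "P j" "j \<noteq> 0" "j \<le> 2 ^ N" unfolding j_def
        using \<open>P (2 ^ N)\<close> \<open>\<not> P 0\<close> LeastI[of P] Least_le[of P] by metis+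
      then obtain i where i: "j = Suc i" by (cases j) auto
      then have "\<not> P i" using not_less_Least[of i P] by (auto simp: j_def)
      then have "stair r (real i / 2 ^ N) + r ^ N < x"
        using x i Pj by (auto simp: A_def P_def not_less)
      then have "x \<in> {stair r (real i / 2 ^ N) + r ^ N..stair r (real (Suc i) / 2 ^ N)}"
        using Pj i by (auto simp: P_def)
      then show ?thesis using Pj i by auto
    qed
  qed
  have nl: "(\<Union>k. {- real k..0}) \<in> null_sets ?S" "(\<Union>k. {stair r 1..real k}) \<in> null_sets ?S"
  proof -
    show "(\<Union>k. {- real k..0}) \<in> null_sets ?S" by (intro null_sets_UN null1) auto
    have "{stair r 1..real k} \<in> null_sets ?S" for k
    proof (cases "stair r 1 \<le> real k")
      case True then show ?thesis using stair_nonneg[of 1] by (intro null1) (auto simp: max_def unstair_eq_1)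
    qed auto
    then show "(\<Union>k. {stair r 1..real k}) \<in> null_sets ?S" by (intro null_sets_UN)
  qed
  have nm: "(\<Union>j<2^N. {stair r (real j / 2 ^ N) + r ^ N..stair r (real (Suc j) / 2 ^ N)}) \<in> null_sets ?S" for N
  proof (rule null_sets_UN')
    fix j :: nat assume "j \<in> {..<2 ^ N}"
    then show "{stair r (real j / 2 ^ N) + r ^ N..stair r (real (Suc j) / 2 ^ N)} \<in> null_sets ?S"
      using null1[OF step, of j N] by (cases "stair r (real j / 2 ^ N) + r ^ N \<le> stair r (real (Suc j) / 2 ^ N)") auto
  qed auto
  have nA: "UNIV - A N \<in> null_sets ?S" for N
    by (rule null_sets_subset[OF _ _ cover[of N]]) (use nl nm in \<open>auto simp: setsS\<close>)
  define AA where "AA = (\<Inter>N. A N)"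
  have [measurable]: "AA \<in> sets borel" unfolding AA_def by measurable
  have "(\<Union>N. UNIV - A N) \<in> null_sets ?S" by (intro null_sets_UN nA)
  moreover have "space ?S - AA = (\<Union>N. UNIV - A N)" by (auto simp: AA_def setsS)
  ultimately have "emeasure ?S (space ?S - AA) = 0" by (simp only: null_setsD1)
  moreover have "emeasure lborel AA = 0"
  proof -
    have "emeasure lborel AA \<le> ennreal ((2 ^ N + 1) * r ^ N)" for N
    proof -
      have "emeasure lborel AA \<le> emeasure lborel (A N)" by (intro emeasure_mono) (auto simp: AA_def)
      also have "\<dots> \<le> (\<Sum>j\<le>2^N. emeasure lborel {stair r (real j / 2 ^ N)..stair r (real j / 2 ^ N) + r ^ N})"
        unfolding A_def by (intro emeasure_subadditive_finite) auto
      also have "\<dots> = (\<Sum>j\<le>(2::nat)^N. ennreal (r ^ N))" using r by (intro sum.cong) auto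
      also have "\<dots> = ennreal ((2 ^ N + 1) * r ^ N)"
        using r by (subst sum_ennreal) (auto simp: add_ac)
      finally show ?thesis .
    qed
    moreover have "(\<lambda>N. ennreal ((2 ^ N + 1) * r ^ N)) \<longlonglongrightarrow> ennreal 0"
    proof (rule tendsto_ennrealI)
      have "(\<lambda>N. (2 * r) ^ N + r ^ N) \<longlonglongrightarrow> 0 + 0"
        using r by (intro tendsto_add LIMSEQ_power_zero) auto
      then show "(\<lambda>N. (2 ^ N + 1) * r ^ N) \<longlonglongrightarrow> 0" by (simp add: power_mult_distrib algebra_simps)
    qed
    ultimately have "emeasure lborel AA \<le> ennreal 0" by (intro LIMSEQ_le_const) auto
    then show ?thesis by simp
  qed
  ultimately show ?thesis unfolding mutually_singular_def
    by (intro bexI[of _ AA]) (auto simp: setsS)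
qed

section \<open>Steepness at well placed values\<close>

lemma stair_upper:
  assumes "0 \<le> x" "x \<le> y" and y: "well_placed l y" and l: "0 < l" "1 \<le> p" "r * (2 / l) powr p < 1"
  shows "stair r y - stair r x \<le> 2 / (1 - r * (2 / l) powr p) * (y - x) powr p"
proof -
  define h where "h = y - x"
  define v where "v = r * (2 / l) powr p"
  have v: "0 < v" "v < 1" using r l by (auto simp: v_def)
  \<comment> \<open>If the floor of level \<open>n\<close> increases between \<open>x\<close> and
    \<open>y\<close>, a dyadic point lies between them, so \<open>2 ^ n * h\<close> is at least the
    fractional part and hence at least \<open>l ^ n\<close>. Thus
    \<open>u = h * (2 / l) ^ n \<ge> 1\<close>, and \<open>u\<close> may be replaced by the larger
    \<open>u powr p\<close>. What remains is geometric with ratio \<open>v < 1\<close>.\<close>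
  have t: "r ^ n * of_int (\<lfloor>2 ^ n * y\<rfloor> - \<lfloor>2 ^ n * x\<rfloor>) \<le> 2 * h powr p * v ^ n" for n
  proof -
    define d where "d = \<lfloor>2 ^ n * y\<rfloor> - \<lfloor>2 ^ n * x\<rfloor>"
    define u where "u = h * (2 / l) ^ n"
    have u0: "0 \<le> u" using assms l by (simp add: u_def h_def)
    have "of_int d \<le> 2 * u powr p"
    proof (cases "d \<le> 0")
      case True
      then have "of_int d \<le> (0::real)" by simp
      also have "\<dots> \<le> 2 * u powr p" by simp
      finally show ?thesis .
    next
      case False
      have x0: "0 \<le> \<lfloor>2 ^ n * x\<rfloor>" using assms by simp
      then have "1 \<le> \<lfloor>2 ^ n * y\<rfloor>" using False unfolding d_def by linarith
      then have "1 \<le> 2 ^ n * y" by linarith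
      then have f: "l ^ n \<le> frac (2 ^ n * y)" using y by (auto simp: well_placed_def)
      have "2 ^ n * x < of_int \<lfloor>2 ^ n * y\<rfloor>" using False by (simp add: d_def) linarith
      then have f2: "l ^ n \<le> 2 ^ n * h" using f by (simp add: frac_def h_def algebra_simps)
      then have u1: "1 \<le> u" using l by (simp add: u_def power_divide field_simps)
      have "l ^ n \<le> 1" using f frac_lt_1[of "2 ^ n * y"] by linarith
      have "2 ^ n * h * l ^ n \<le> 2 ^ n * h * 1" 
        using \<open>l ^ n \<le> 1\<close> assms by (intro mult_left_mono) (auto simp: h_def)
      then have "2 ^ n * h \<le> u" using l by (simp add: u_def power_divide field_simps)
      moreover have "of_int d \<le> 2 ^ n * h + 1" unfolding d_def h_def right_diff_distrib by linarith
      ultimately have "of_int d \<le> 2 * u" using u1 by simp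
      also have "\<dots> \<le> 2 * u powr p" using powr_mono[of 1 p u] l u1 by simp
      finally show ?thesis .
    qed
    moreover have "u powr p = h powr p * ((2 / l) powr p) ^ n"
      using l assms by (simp add: u_def h_def powr_mult powr_realpow[symmetric] powr_powr mult_ac)
    ultimately have "r ^ n * of_int d \<le> r ^ n * (2 * (h powr p * ((2 / l) powr p) ^ n))"
      using r by (intro mult_left_mono) auto
    then show ?thesis unfolding d_def v_def power_mult_distrib by (simp add: mult_ac)
  qed
  have "(\<lambda>n. 2 * h powr p * v ^ n) sums (2 * h powr p * (1 / (1 - v)))"
    using v by (intro sums_mult geometric_sums) auto
  from sums_le[OF t stair_diff(1)[OF assms(1,2)] this] show ?thesis
    by (simp add: h_def v_def)
qed

text \<open>A time \<open>s\<close> need not lie in the range of \<open>stair\<close>. Values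
  \<open>x\<close> below \<open>z = unstair r s\<close> satisfy \<open>stair r x \<le> s\<close>,
  and \<open>x\<close> is sent to \<open>z\<close> from the left; for \<open>z = 0\<close>, where no
  smaller value exists, \<open>x = 0\<close> itself serves.\<close>

lemma steep_stair:
  assumes "0 \<le> y" "y \<le> 1" and y: "well_placed l y" and l: "0 < l" "1 \<le> p" "r * (2 / l) powr p < 1"
  shows "steep (2 / (1 - r * (2 / l) powr p)) p (unstair r) (stair r y)"
  unfolding steep_def
proof
  define K where "K = 2 / (1 - r * (2 / l) powr p)"
  have K: "0 < K" using l by (simp add: K_def)
  fix s assume s: "s \<in> {0..stair r y}"
  define z where "z = unstair r s"
  have z: "0 \<le> z" "z \<le> y" using s unstair_range[of s] unstair_mono[of s "stair r y"] unstair_stair[of y] assms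
    by (auto simp: z_def)
  have k: "stair r y - s \<le> K * (y - x) powr p" if "0 \<le> x" "x \<le> y" "stair r x \<le> s" for x
    using stair_upper[OF that(1,2) y l] that(3) by (simp add: K_def)
  have "stair r y - s \<le> K * (y - z) powr p"
  proof (cases "z = 0")
    case True
    then show ?thesis using k[of 0] s assms by simp
  next
    case False
    have lim: "((\<lambda>x. K * (y - x) powr p) \<longlongrightarrow> K * (y - z) powr p) (at_left z)"
      using l z by (intro tendsto_intros tendsto_powr') (auto simp: eventually_at_filter)
    have "eventually (\<lambda>x. x \<in> {0<..<z}) (at_left z)"
      using False z by (intro eventually_at_left_real) auto
    then have "eventually (\<lambda>x. stair r y - s \<le> K * (y - x) powr p) (at_left z)"
      by eventually_elim (use z s less_unstair in \<open>auto intro!: k simp: z_def\<close>)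
    from tendsto_lowerbound[OF lim this] show ?thesis by simp
  qed
  then show "stair r y - s \<le> K * (unstair r (stair r y) - unstair r s) powr p"
    using assms by (simp add: unstair_stair z_def)
qed

text \<open>The factor \<open>1 / 2 ^ m\<close> is the length of the interval, so the proportion of ill-placed points
  tends to \<open>0\<close> with \<open>m\<close> while the constants of \<open>steep_stair\<close> do not depend on \<open>m\<close>.\<close>

lemma emeasure_ill_placed:
  assumes l: "0 < l" "l < 1"
  obtains C where "C \<in> sets borel" "{y\<in>{0<..<1 / 2 ^ m}. \<not> well_placed l y} \<subseteq> C"
    "emeasure lborel C \<le> ennreal (l ^ m / (1 - l) / 2 ^ m)"
proof
  \<comment> \<open>At level \<open>n + m\<close> fewer than \<open>2 ^ n\<close> dyadic points
    other than 0 lie in the interval, each followed by an ill placed piece of length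
    \<open>(l / 2) ^ (n + m)\<close>. The index 0 is absent thanks to the guard.\<close>
  let ?C = "\<lambda>n j. {real j / 2 ^ (n + m)..(real j + l ^ (n + m)) / 2 ^ (n + m)}"
  let ?D = "\<lambda>n. \<Union>j\<in>{1..<2^n}. ?C n j"
  show "(\<Union>n. ?D n) \<in> sets borel" by measurable
  show "{y\<in>{0<..<1 / 2 ^ m}. \<not> well_placed l y} \<subseteq> (\<Union>n. ?D n)"
  proof clarify
    fix y :: real assume y: "y \<in> {0<..<1 / 2 ^ m}" and "\<not> well_placed l y"
    then obtain k where k: "1 \<le> 2 ^ k * y" "frac (2 ^ k * y) < l ^ k"
      by (auto simp: well_placed_def not_le)
    \<comment> \<open>Below level \<open>m\<close> the guard fails on the whole interval, so these
      levels impose nothing.\<close>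
    have "m \<le> k"
    proof (rule ccontr)
      assume "\<not> m \<le> k"
      then have "(2::real) ^ k \<le> 2 ^ m" by (intro power_increasing) auto
      then have "2 ^ k * y \<le> 2 ^ m * y" using y by (intro mult_right_mono) auto
      also have "\<dots> < 1" using y by (simp add: field_simps)
      finally show False using k by simp
    qed
    then obtain n where n: "k = n + m" using le_Suc_ex by (metis add.commute)
    define j where "j = nat \<lfloor>2 ^ k * y\<rfloor>"
    have j: "real j = of_int \<lfloor>2 ^ k * y\<rfloor>" using k by (simp add: j_def)
    have "2 ^ k * y < 2 ^ n"
      using y by (simp add: n power_add field_simps)
    then have "real j < 2 ^ n" using j by linarith
    then have "j < 2 ^ n" by (metis of_nat_less_numeral_power_cancel_iff)
    moreover have "1 \<le> j" using k by (simp add: j_def le_nat_iff)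
    moreover have "y \<in> ?C n j"
    proof -
      have "real j \<le> y * 2 ^ k" "y * 2 ^ k \<le> real j + l ^ k"
        using k(2) unfolding j frac_def by (auto simp: mult.commute)
      then show ?thesis by (simp add: n pos_divide_le_eq pos_le_divide_eq)
    qed
    ultimately show "y \<in> (\<Union>n. ?D n)" by (intro UN_I[of n] UN_I[of j]) auto
  qed
  have "emeasure lborel (\<Union>n. ?D n) \<le> (\<Sum>n. emeasure lborel (?D n))"
    by (intro emeasure_subadditive_countably) auto
  also have "\<dots> \<le> (\<Sum>n. ennreal (l ^ m / 2 ^ m * l ^ n))"
  proof (intro suminf_le allI)
    fix n
    have "emeasure lborel (?D n) \<le> (\<Sum>j\<in>{1..<2^n}. emeasure lborel (?C n j))"
      by (intro emeasure_subadditive_finite) auto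
    also have "\<dots> = (\<Sum>j\<in>{1..<2^n::nat}. ennreal (l ^ (n + m) / 2 ^ (n + m)))"
    proof (intro sum.cong refl)
      fix j :: nat
      have "real j / 2 ^ (n + m) \<le> (real j + l ^ (n + m)) / 2 ^ (n + m)"
        using l by (intro divide_right_mono) auto
      then show "emeasure lborel (?C n j) = ennreal (l ^ (n + m) / 2 ^ (n + m))"
        by (simp only: emeasure_lborel_Icc diff_divide_distrib[symmetric] add_diff_cancel_left')
    qed
    also have "\<dots> = ennreal ((2 ^ n - 1) * (l ^ (n + m) / 2 ^ (n + m)))"
      using l by (subst sum_ennreal) (auto simp: of_nat_diff)
    also have "\<dots> \<le> ennreal (2 ^ n * (l ^ (n + m) / 2 ^ (n + m)))"
      using l by (intro ennreal_leI mult_right_mono) auto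
    also have "2 ^ n * (l ^ (n + m) / 2 ^ (n + m)) = l ^ m / 2 ^ m * l ^ n"
      by (simp add: power_add field_simps)
    finally show "emeasure lborel (?D n) \<le> ennreal (l ^ m / 2 ^ m * l ^ n)" .
  qed auto
  also have "\<dots> = ennreal (\<Sum>n. l ^ m / 2 ^ m * l ^ n)"
    using l by (intro suminf_ennreal2 summable_mult summable_geometric) auto
  also have "(\<Sum>n. l ^ m / 2 ^ m * l ^ n) = l ^ m / (1 - l) / 2 ^ m"
    using l by (subst suminf_mult) (auto simp: suminf_geometric intro!: summable_geometric)
  finally show "emeasure lborel (\<Union>n. ?D n) \<le> ennreal (l ^ m / (1 - l) / 2 ^ m)" .
qed

text \<open>If a cell of the partition contains no steep time, every value taken by \<open>b\<close>
  strictly inside it is ill placed. By \<open>m\<close> such cells carry at most half of the total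
  increment \<open>1 / 2 ^ m\<close>, whatever the partition.\<close>

lemma sum_steep_unstair:
  assumes l: "0 < l" "l < 1" "1 \<le> p" "r * (2 / l) powr p < 1" and m: "l ^ m / (1 - l) \<le> 1 / 2"
    and t: "\<And>i. i < n \<Longrightarrow> t i \<le> t (Suc i)" "t 0 = 0" "t n = stair r (1 / 2 ^ m)"
  shows "1 / 2 ^ m / 2 \<le> (\<Sum>i | i < n \<and> (\<exists>s\<in>{t i..t (Suc i)}. steep (2 / (1 - r * (2 / l) powr p)) p (unstair r) s).
            unstair r (t (Suc i)) - unstair r (t i))"
proof -
  let ?st = "\<lambda>i. \<exists>s\<in>{t i..t (Suc i)}. steep (2 / (1 - r * (2 / l) powr p)) p (unstair r) s"
  let ?b = "\<lambda>i. unstair r (t i)"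
  let ?J = "\<lambda>i. {?b i<..<?b (Suc i)}"
  have tm: "t i \<le> t j" if "i \<le> j" "j \<le> n" for i j
    using that by (induction j rule: dec_induct) (auto, meson Suc_le_lessD order_trans t(1))
  have t0: "0 \<le> t i" if "i \<le> n" for i using tm[of 0 i] that t(2) by simp
  have bm: "?b i \<le> ?b j" if "i \<le> j" "j \<le> n" for i j using that tm t0 by (intro unstair_mono) auto
  have bn: "?b n = 1 / 2 ^ m" unfolding t(3) by (rule unstair_stair) (auto simp: field_simps)
  have b0: "?b 0 = 0" by (simp add: t unstair_0)
  obtain C where C: "C \<in> sets borel" "{y\<in>{0<..<1 / 2 ^ m}. \<not> well_placed l y} \<subseteq> C"
    "emeasure lborel C \<le> ennreal (l ^ m / (1 - l) / 2 ^ m)" using emeasure_ill_placed[OF l(1,2)] .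
  have sub: "?J i \<subseteq> C" if i: "i < n" "\<not> ?st i" for i
  proof
    fix y assume y: "y \<in> ?J i"
    have y1: "0 < y" "y < 1 / 2 ^ m" using y bm[of 0 i] bm[of "Suc i" n] i bn b0 by auto
    have y2: "y \<le> 1" using y1(2) by (rule order_trans[OF less_imp_le]) (simp add: field_simps)
    have u: "unstair r (stair r y) = y" using y1 y2 by (intro unstair_stair) auto
    have "t i \<le> stair r y"
    proof (rule ccontr)
      assume "\<not> ?thesis"
      then have "unstair r (stair r y) \<le> ?b i" using y1 stair_nonneg[of y] by (intro unstair_mono) auto
      then show False using y u by auto
    qed
    moreover have "stair r y \<le> t (Suc i)"
    proof (rule ccontr)
      assume "\<not> ?thesis"
      then have "?b (Suc i) \<le> unstair r (stair r y)" using i by (intro unstair_mono t0) auto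
      then show False using y u by auto
    qed
    ultimately have "\<not> well_placed l y"
      using i(2) steep_stair[OF _ y2 _ l(1,3,4)] y1 by auto
    then show "y \<in> C" using C(2) y1 by auto
  qed
  let ?N = "{i. i < n \<and> \<not> ?st i}"
  have "(\<Sum>i\<in>?N. emeasure lborel (?J i)) = emeasure lborel (\<Union>i\<in>?N. ?J i)"
  proof (rule sum_emeasure)
    show "disjoint_family_on ?J ?N" unfolding disjoint_family_on_def
    proof (intro ballI impI)
      fix i j assume ij: "i \<in> ?N" "j \<in> ?N" "i \<noteq> j"
      show "?J i \<inter> ?J j = {}"
        using ij bm[of "Suc i" j] bm[of "Suc j" i] by (cases "i < j") (auto simp: not_less)
    qed
  qed auto
  also have "\<dots> \<le> emeasure lborel C" using sub C(1) by (intro emeasure_mono) auto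
  also have "\<dots> \<le> ennreal (1 / 2 / 2 ^ m)"
    by (intro order_trans[OF C(3)] ennreal_leI divide_right_mono m) auto
  finally have "(\<Sum>i\<in>?N. ennreal (?b (Suc i) - ?b i)) \<le> ennreal (1 / 2 / 2 ^ m)"
    using bm by (simp add: emeasure_lborel_Ioo)
  then have N: "(\<Sum>i\<in>?N. ?b (Suc i) - ?b i) \<le> 1 / 2 / 2 ^ m"
    using bm by (subst (asm) sum_ennreal) auto
  have "(\<Sum>i<n. ?b (Suc i) - ?b i) = 1 / 2 ^ m"
    using bn b0 by (subst sum_lessThan_telescope) auto
  moreover have "(\<Sum>i<n. ?b (Suc i) - ?b i) = (\<Sum>i | i < n \<and> ?st i. ?b (Suc i) - ?b i) + (\<Sum>i\<in>?N. ?b (Suc i) - ?b i)"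
    by (subst sum.union_disjoint[symmetric]) (auto intro!: sum.cong)
  ultimately show ?thesis using N by (simp add: field_simps)
qed

end

text \<open>The last clause says in discrete form that \<open>db\<close> charges the steep times
  arbitrarily close to 0. The bound \<open>c\<close> is uniform over partitions, so it survives the
  limit of vanishing mesh.\<close>

lemma boundary_exists:
  fixes \<alpha> :: real
  assumes \<alpha>: "0 < \<alpha>" "\<alpha> < 1 / 2"
  obtains b :: "real \<Rightarrow> real" and K p where
    "continuous_on {0..} b" "mono_on {0..} b" "b ` {0..} \<subseteq> {0..1}" "b 0 = 0" "total_variation_on b {0..} = 1"
    "holder_continuous_on \<alpha> {0..} b" "mutually_singular lborel (stieltjes_measure b)"
    "2 < p" "0 < K"
    "\<And>d. 0 < d \<Longrightarrow> \<exists>\<tau> c. 0 < \<tau> \<and> \<tau> < d \<and> 0 < c \<and> (\<forall>n t. (\<forall>i<n. t i \<le> t (Suc i)) \<and> t 0 = 0 \<and> t n = \<tau> \<longrightarrow>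
       c \<le> (\<Sum>i | i < n \<and> (\<exists>s\<in>{t i..t (Suc i)}. steep K p b s). b (t (Suc i)) - b (t i)))"
proof -
  define r :: real where "r = 2 powr (- 1 / \<alpha>)"
  have "r < 2 powr (-2)" unfolding r_def using \<alpha> by (intro powr_less_mono) (auto simp: field_simps)
  then have r: "0 < r" "r < 1 / 4" by (auto simp: r_def powr_minus powr_numeral)
  \<comment> \<open>The midpoint between 2 and 1 / \<alpha>.\<close>
  define p where "p = (2 + 1 / \<alpha>) / 2"
  have p: "2 < p" "p < 1 / \<alpha>" using \<alpha> by (auto simp: p_def field_simps)
  \<comment> \<open>The critical value of \<open>l\<close>, at which
    \<open>r * (2 / l) powr p\<close> equals 1. As \<open>p < 1 / \<alpha>\<close>, it lies below 1
    and leaves room for \<open>l\<close>.\<close>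
  define q where "q = 2 powr (1 - 1 / \<alpha> / p)"
  have "q < 2 powr 0" unfolding q_def using p \<alpha> by (intro powr_less_mono) (auto simp: field_simps)
  then have q: "0 < q" "q < 1" by (auto simp: q_def)
  define l where "l = (q + 1) / 2"
  have l: "0 < l" "l < 1" "q < l" using q by (auto simp: l_def)
  have "q powr p = 2 powr ((1 - 1 / \<alpha> / p) * p)" by (simp add: q_def powr_powr)
  also have "(1 - 1 / \<alpha> / p) * p = p + - 1 / \<alpha>" using p by (simp add: field_simps)
  finally have "r * (2 / l) powr p = (q / l) powr p"
    using l q by (simp add: powr_divide r_def powr_add[symmetric])
  also have "\<dots> < 1 powr p" using q l p by (intro powr_less_mono2) auto
  finally have rl: "r * (2 / l) powr p < 1" by simp
  define K where "K = 2 / (1 - r * (2 / l) powr p)"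
  show ?thesis
  proof (rule that[of "unstair r" p K])
    show "mono_on {0..} (unstair r)" using unstair_mono[OF r] by (auto simp: mono_on_def)
    show "unstair r ` {0..} \<subseteq> {0..1}" using unstair_range[OF r] by auto
    show "0 < K" using rl by (simp add: K_def)
    fix d :: real assume d: "0 < d"
    have "(\<lambda>m. l ^ m / (1 - l)) \<longlonglongrightarrow> 0 / (1 - l)" using l by (intro tendsto_divide LIMSEQ_power_zero) auto
    then have "eventually (\<lambda>m. l ^ m / (1 - l) < 1 / 2) sequentially" by (rule order_tendstoD) auto
    moreover have "(\<lambda>m. 2 * (1 / 2) ^ m :: real) \<longlonglongrightarrow> 2 * 0" by (intro tendsto_mult LIMSEQ_power_zero) auto
    then have "eventually (\<lambda>m. 2 * (1 / 2) ^ m < d) sequentially" by (rule order_tendstoD) (auto simp: d)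
    ultimately have "eventually (\<lambda>m. l ^ m / (1 - l) < 1 / 2 \<and> 2 * (1 / 2) ^ m < d) sequentially"
      by (rule eventually_conj)
    then obtain m where m: "l ^ m / (1 - l) < 1 / 2" "2 * (1 / 2) ^ m < d"
      by (auto simp: eventually_sequentially)
    show "\<exists>\<tau> c. 0 < \<tau> \<and> \<tau> < d \<and> 0 < c \<and> (\<forall>n t. (\<forall>i<n. t i \<le> t (Suc i)) \<and> t 0 = 0 \<and> t n = \<tau> \<longrightarrow>
       c \<le> (\<Sum>i | i < n \<and> (\<exists>s\<in>{t i..t (Suc i)}. steep K p (unstair r) s). unstair r (t (Suc i)) - unstair r (t i)))"
    proof (intro exI conjI allI impI)
      show "0 < stair r (1 / 2 ^ m)" using stair_strict_mono[OF r, of 0 "1 / 2 ^ m"] stair_0[OF r] by (simp add: field_simps)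
      show "stair r (1 / 2 ^ m) < d" using stair_le[OF r, of "1 / 2 ^ m"] m(2) by (simp add: power_divide)
      show "(0::real) < 1 / 2 ^ m / 2" by simp
      fix n t assume "(\<forall>i<n. t i \<le> t (Suc i)) \<and> t 0 = 0 \<and> t n = stair r (1 / 2 ^ m)"
      then show "1 / 2 ^ m / 2 \<le> (\<Sum>i | i < n \<and> (\<exists>s\<in>{t i..t (Suc i)}. steep K p (unstair r) s). unstair r (t (Suc i)) - unstair r (t i))"
        unfolding K_def using p rl m by (intro sum_steep_unstair[OF r l(1,2)]) auto
    qed
  qed (use r \<alpha> p in \<open>auto intro!: continuous_on_unstair unstair_0 total_variation_unstair holder_unstair
      mutually_singular_unstair simp: r_def\<close>)
qed

section \<open>Paths reflected at a barrier\<close>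

definition hat :: "real \<Rightarrow> real \<Rightarrow> real" where
  "hat \<epsilon> x = max 0 (min 1 (1 - x / \<epsilon>))"

definition pot :: "real \<Rightarrow> real \<Rightarrow> real" where
  "pot \<epsilon> x = (max 0 (\<epsilon> - x))\<^sup>2 / (2 * \<epsilon>)"

lemma hat_range: "0 \<le> hat \<epsilon> x" "hat \<epsilon> x \<le> 1"
  by (auto simp: hat_def)

lemma hat_antimono: "0 < \<epsilon> \<Longrightarrow> x \<le> y \<Longrightarrow> hat \<epsilon> y \<le> hat \<epsilon> x"
proof -
  assume "0 < \<epsilon>" "x \<le> y"
  then have "x / \<epsilon> \<le> y / \<epsilon>" by (intro divide_right_mono) auto
  then show ?thesis by (auto simp: hat_def)
qed

lemma hat_lipschitz: assumes "0 < \<epsilon>" shows "hat \<epsilon> x \<le> hat \<epsilon> y + \<bar>x - y\<bar> / \<epsilon>"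
proof -
  have "y / \<epsilon> - x / \<epsilon> \<le> \<bar>x - y\<bar> / \<epsilon>"
    using assms by (simp flip: diff_divide_distrib add: divide_right_mono)
  moreover have "0 \<le> \<bar>x - y\<bar> / \<epsilon>" using assms by simp
  ultimately show ?thesis by (auto simp: hat_def)
qed

lemma hat_zero: "0 < \<epsilon> \<Longrightarrow> \<epsilon> \<le> x \<Longrightarrow> hat \<epsilon> x = 0"
  by (simp add: hat_def)

lemma hat_eq: "0 < \<epsilon> \<Longrightarrow> 0 \<le> x \<Longrightarrow> hat \<epsilon> x = max 0 (\<epsilon> - x) / \<epsilon>"
  by (auto simp: hat_def max_def min_def field_simps)

lemma pot_range:
  assumes "0 < \<epsilon>" "0 \<le> x" shows "0 \<le> pot \<epsilon> x" "pot \<epsilon> x \<le> \<epsilon> / 2"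
proof -
  have "(max 0 (\<epsilon> - x))\<^sup>2 \<le> \<epsilon>\<^sup>2" using assms by (intro power_mono) auto
  then show "pot \<epsilon> x \<le> \<epsilon> / 2" using assms by (simp add: pot_def field_simps power2_eq_square)
qed (use assms in \<open>simp add: pot_def\<close>)

text \<open>Convexity: the graph lies above its tangent at \<open>x\<close>, whose slope is
  \<open>- hat \<epsilon> x\<close>.\<close>

lemma pot_lower:
  assumes "0 < \<epsilon>" "0 \<le> x" "0 \<le> y"
  shows "pot \<epsilon> x - hat \<epsilon> x * (y - x) \<le> pot \<epsilon> y"
proof -
  define p q where "p = max 0 (\<epsilon> - x)" and "q = max 0 (\<epsilon> - y)"
  have "2 * p * (x - y) \<le> 2 * p * (q - p)"
    unfolding p_def q_def using assms by (cases "\<epsilon> \<le> x") (auto intro!: mult_left_mono)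
  also have "\<dots> \<le> q\<^sup>2 - p\<^sup>2" using sum_squares_ge_zero[of "q - p" 0] by (simp add: power2_eq_square algebra_simps)
  finally have "p\<^sup>2 - 2 * p * (y - x) \<le> q\<^sup>2" by (simp add: algebra_simps)
  then have "(p\<^sup>2 - 2 * p * (y - x)) / (2 * \<epsilon>) \<le> q\<^sup>2 / (2 * \<epsilon>)" using assms by (intro divide_right_mono) auto
  then show ?thesis using assms by (simp add: pot_def hat_eq p_def q_def diff_divide_distrib)
qed

text \<open>The second derivative is at most 1 / \<epsilon>.\<close>

lemma pot_upper:
  assumes "0 < \<epsilon>" "0 \<le> x" "0 \<le> y"
  shows "pot \<epsilon> y \<le> pot \<epsilon> x - hat \<epsilon> x * (y - x) + (y - x)\<^sup>2 / (2 * \<epsilon>)"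
proof -
  define p q where "p = max 0 (\<epsilon> - x)" and "q = max 0 (\<epsilon> - y)"
  have "q\<^sup>2 \<le> p\<^sup>2 - 2 * p * (y - x) + (y - x)\<^sup>2"
  proof (cases "\<epsilon> \<le> x")
    case True
    then have "p = 0" "\<bar>q\<bar> \<le> \<bar>y - x\<bar>" by (auto simp: p_def q_def)
    then show ?thesis using abs_le_square_iff[of q "y - x"] by simp
  next
    case False
    then have "p\<^sup>2 - 2 * p * (y - x) + (y - x)\<^sup>2 = (\<epsilon> - y)\<^sup>2" by (simp add: p_def power2_eq_square algebra_simps)
    moreover have "q\<^sup>2 \<le> (\<epsilon> - y)\<^sup>2" by (auto simp: q_def max_def)
    ultimately show ?thesis by simp
  qed
  then have "q\<^sup>2 / (2 * \<epsilon>) \<le> (p\<^sup>2 - 2 * p * (y - x) + (y - x)\<^sup>2) / (2 * \<epsilon>)" using assms by (intro divide_right_mono) auto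
  then show ?thesis using assms by (simp add: pot_def hat_eq p_def q_def diff_divide_distrib add_divide_distrib)
qed

text \<open>Below \<epsilon> the function is a quadratic polynomial. The equality is what retains
  the squared increments with their exact constant, so that they can cancel the local time.\<close>

lemma pot_quadratic:
  assumes "0 < \<epsilon>" "0 \<le> x" "x \<le> \<epsilon>" "0 \<le> y" "y \<le> \<epsilon>"
  shows "pot \<epsilon> y = pot \<epsilon> x - hat \<epsilon> x * (y - x) + (y - x)\<^sup>2 / (2 * \<epsilon>)"
  using assms by (simp add: pot_def hat_eq field_simps power2_eq_square)

section \<open>Equidistant grids\<close>

lemma equidistant_cell:
  fixes \<tau> s :: real
  assumes "0 < \<tau>" "0 \<le> s" "s < \<tau>" "0 < N"
  obtains i where "i < N" "s \<in> {\<tau> * real i / real N..<\<tau> * real (Suc i) / real N}"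
proof
  define i where "i = nat \<lfloor>s * real N / \<tau>\<rfloor>"
  have "0 \<le> s * real N / \<tau>" using assms by simp
  then have i: "real i \<le> s * real N / \<tau>" "s * real N / \<tau> < real i + 1" unfolding i_def by linarith+
  have "s * real N < \<tau> * real N" using assms by simp
  then have "s * real N / \<tau> < real N" using assms by (simp add: field_simps)
  then show "i < N" using i by linarith
  show "s \<in> {\<tau> * real i / real N..<\<tau> * real (Suc i) / real N}"
    using i assms by (auto simp: field_simps)
qed

lemma measure_equidistant_cells:
  fixes \<tau> :: real
  assumes "0 < \<tau>" "0 < N" "J \<subseteq> {..<N}"
  shows "measure lborel (\<Union>i\<in>J. {\<tau> * real i / real N..<\<tau> * real (Suc i) / real N}) = (\<Sum>i\<in>J. \<tau> / real N)"
proof -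
  have J: "finite J" using assms by (meson finite_lessThan finite_subset)
  have le: "\<tau> * real i / real N \<le> \<tau> * real j / real N" if "i \<le> j" for i j
    using that assms by (intro divide_right_mono mult_left_mono) auto
  have "measure lborel (\<Union>i\<in>J. {\<tau> * real i / real N..<\<tau> * real (Suc i) / real N})
      = (\<Sum>i\<in>J. measure lborel {\<tau> * real i / real N..<\<tau> * real (Suc i) / real N})"
  proof (rule measure_finite_Union[OF J])
    show "disjoint_family_on (\<lambda>i. {\<tau> * real i / real N..<\<tau> * real (Suc i) / real N}) J"
      unfolding disjoint_family_on_def
    proof (intro ballI impI)
      fix i j assume "i \<in> J" "j \<in> J" "i \<noteq> j"
      then show "{\<tau> * real i / real N..<\<tau> * real (Suc i) / real N} \<inter> {\<tau> * real j / real N..<\<tau> * real (Suc j) / real N} = {}"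
        using le[of "Suc i" j] le[of "Suc j" i] by (cases "i < j") (auto simp del: of_nat_Suc)
    qed
  qed (auto simp: emeasure_lborel_Ico le simp del: of_nat_Suc)
  also have "\<dots> = (\<Sum>i\<in>J. \<tau> / real N)"
  proof (intro sum.cong refl)
    fix i
    have "measure lborel {\<tau> * real i / real N..<\<tau> * real (Suc i) / real N}
        = \<tau> * real (Suc i) / real N - \<tau> * real i / real N"
      by (intro measure_lborel_Ico le) auto
    then show "measure lborel {\<tau> * real i / real N..<\<tau> * real (Suc i) / real N} = \<tau> / real N"
      by (simp add: add_divide_distrib distrib_left)
  qed
  finally show ?thesis .
qed

definition grid :: "real \<Rightarrow> nat \<Rightarrow> nat \<Rightarrow> real" where
  "grid \<tau> N i = \<tau> * real i / real N"

lemma mono_on_running_max: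
  fixes W :: "real \<Rightarrow> real"
  assumes "continuous_on {0..T} W" shows "mono_on {0..T} (running_max W)"
proof (rule mono_onI)
  fix s t assume st: "s \<in> {0..T}" "t \<in> {0..T}" "s \<le> t"
  have "compact (W ` {0..t})"
    using st assms by (intro compact_continuous_image continuous_on_subset[OF assms]) auto
  then have "bdd_above (W ` {0..t})" by (intro bounded_imp_bdd_above compact_imp_bounded)
  then show "running_max W s \<le> running_max W t"
    unfolding running_max_def using st by (intro cSUP_subset_mono) auto
qed

text \<open>A solution path, with the bracket of \<open>W - b\<close> already replaced by Lebesgue measure in
  \<open>local_time\<close>: as \<open>W - b - B\<close> has finite variation, that bracket is \<open>t\<close>.\<close>

locale reflected_path =
  fixes W B L b :: "real \<Rightarrow> real" and \<nu> T :: real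
  assumes T: "0 < T" and \<nu>: "\<nu> < 1"
    and cont_W: "continuous_on {0..T} W" and cont_B: "continuous_on {0..T} B"
    and cont_b: "continuous_on {0..T} b" and mono_b: "mono_on {0..T} b"
    and b_0: "b 0 = 0" and B_0: "B 0 = 0"
    and equation: "\<And>t. t \<in> {0..T} \<Longrightarrow> W t = B t + \<nu> * running_max W t + 1 / 2 * L t"
    and constraint: "\<And>t. t \<in> {0..T} \<Longrightarrow> b t \<le> W t"
    and local_time: "\<And>t. t \<in> {0..T} \<Longrightarrow>
      ((\<lambda>\<epsilon>. 1 / \<epsilon> * measure lborel {s\<in>{0..t}. W s - b s \<in> {0..<\<epsilon>}}) \<longlongrightarrow> L t) (at_right 0)"
begin

abbreviation "M \<equiv> running_max W"
abbreviation "X \<equiv> \<lambda>t. W t - b t"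
abbreviation "close e u v \<equiv>
  \<bar>W u - W v\<bar> \<le> e \<and> \<bar>B u - B v\<bar> \<le> e \<and> \<bar>b u - b v\<bar> \<le> e \<and> \<bar>M u - M v\<bar> \<le> e"

section \<open>Running maximum and local time of a solution path\<close>

lemma running_max_ge: assumes "0 \<le> s" "s \<le> t" "t \<le> T" shows "W s \<le> M t"
proof -
  have "compact (W ` {0..t})"
    using assms by (intro compact_continuous_image continuous_on_subset[OF cont_W]) auto
  then show ?thesis unfolding running_max_def using assms
    by (intro cSup_upper) (auto intro: bounded_imp_bdd_above compact_imp_bounded)
qed

lemma running_max_attained: assumes "0 \<le> t" "t \<le> T" obtains u where "u \<in> {0..t}" "W u = M t"
proof -
  obtain u where u: "u \<in> {0..t}" "\<And>s. s \<in> {0..t} \<Longrightarrow> W s \<le> W u"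
    using continuous_attains_sup[of "{0..t}" W] assms continuous_on_subset[OF cont_W, of "{0..t}"] by auto
  then have "M t \<le> W u" unfolding running_max_def by (intro cSup_least) auto
  then show ?thesis using that[of u] u running_max_ge[of u t] assms by auto
qed

lemma running_max_mono: assumes "0 \<le> s" "s \<le> t" "t \<le> T" shows "M s \<le> M t"
  using mono_onD[OF mono_on_running_max[OF cont_W], of s t] assms by auto

lemma running_max_0: "M 0 = W 0"
  by (simp add: running_max_def)

lemma running_max_increase:
  assumes "0 \<le> s" "s \<le> t" "t \<le> T" "M s < M t"
  obtains u where "u \<in> {s..t}" "W u = M t" "M u = M t"
proof -
  obtain u where u: "u \<in> {0..t}" "W u = M t" using running_max_attained[of t] assms by auto
  have "s \<le> u"
  proof (rule ccontr)
    assume "\<not> s \<le> u"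
    then have "W u \<le> M s" using u assms by (intro running_max_ge) auto
    then show False using u assms by simp
  qed
  moreover have "M u = M t"
    using running_max_mono[of u t] running_max_ge[of u u] u assms by auto
  ultimately show ?thesis using that[of u] u by auto
qed

lemma running_max_osc:
  assumes d: "\<And>u v. \<lbrakk>u \<in> {0..T}; v \<in> {0..T}; \<bar>u - v\<bar> \<le> d\<rbrakk> \<Longrightarrow> \<bar>W u - W v\<bar> \<le> e"
    and "0 \<le> s" "s \<le> t" "t \<le> T" "t - s \<le> d"
  shows "M t - M s \<le> e"
proof (cases "M s < M t")
  case True
  then obtain u where u: "u \<in> {s..t}" "W u = M t" using running_max_increase assms by blast
  have "W s \<le> M s" using assms by (intro running_max_ge) auto
  then have "M t - M s \<le> W u - W s" using u by simp
  also have "\<dots> \<le> e" using d[of u s] u assms by auto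
  finally show ?thesis .
next
  case False
  then show ?thesis using d[of s s] assms by auto
qed

lemma modulus:
  assumes "0 < e"
  obtains d where "0 < d"
    "\<And>u v. \<lbrakk>u \<in> {0..T}; v \<in> {0..T}; \<bar>u - v\<bar> \<le> d\<rbrakk> \<Longrightarrow> close e u v"
proof -
  have ex: "\<exists>d>0. \<forall>u\<in>{0..T}. \<forall>v\<in>{0..T}. \<bar>u - v\<bar> < d \<longrightarrow> \<bar>f u - f v\<bar> < e" if "continuous_on {0..T} f" for f :: "real \<Rightarrow> real"
    using compact_uniformly_continuous[OF that] assms unfolding uniformly_continuous_on_def dist_real_def
    by (metis abs_minus_commute compact_Icc)
  obtain d1 d2 d3 where d: "0 < d1" "0 < d2" "0 < d3"
    "\<forall>u\<in>{0..T}. \<forall>v\<in>{0..T}. \<bar>u - v\<bar> < d1 \<longrightarrow> \<bar>W u - W v\<bar> < e"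
    "\<forall>u\<in>{0..T}. \<forall>v\<in>{0..T}. \<bar>u - v\<bar> < d2 \<longrightarrow> \<bar>B u - B v\<bar> < e"
    "\<forall>u\<in>{0..T}. \<forall>v\<in>{0..T}. \<bar>u - v\<bar> < d3 \<longrightarrow> \<bar>b u - b v\<bar> < e"
    using ex[OF cont_W] ex[OF cont_B] ex[OF cont_b] by blast
  define d where "d = min d1 (min d2 d3) / 2"
  have d0: "0 < d" "d < d1" "d < d2" "d < d3" using d by (auto simp: d_def)
  have W: "\<bar>W u - W v\<bar> \<le> e" if "u \<in> {0..T}" "v \<in> {0..T}" "\<bar>u - v\<bar> \<le> d" for u v
    using d(4) that d0 by (meson less_imp_le order_le_less_trans)
  have "\<bar>M u - M v\<bar> \<le> e" if "u \<in> {0..T}" "v \<in> {0..T}" "\<bar>u - v\<bar> \<le> d" for u v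
    using running_max_osc[OF W, of d u v] running_max_osc[OF W, of d v u] running_max_mono[of u v] running_max_mono[of v u] that
    by (cases "u \<le> v") auto
  moreover have "\<bar>B u - B v\<bar> \<le> e" if "u \<in> {0..T}" "v \<in> {0..T}" "\<bar>u - v\<bar> \<le> d" for u v
    using d(5) that d0 by (meson less_imp_le order_le_less_trans)
  moreover have "\<bar>b u - b v\<bar> \<le> e" if "u \<in> {0..T}" "v \<in> {0..T}" "\<bar>u - v\<bar> \<le> d" for u v
    using d(6) that d0 by (meson less_imp_le order_le_less_trans)
  ultimately show ?thesis using that[of d] d0 W by blast
qed

lemma sublevel_sets: assumes "0 \<le> t" "t \<le> T" shows "{s\<in>{0..t}. X s \<in> {0..<\<epsilon>}} \<in> sets lborel"
proof -
  have "continuous_on {0..t} X"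
    using assms by (intro continuous_intros continuous_on_subset[OF cont_W] continuous_on_subset[OF cont_b]) auto
  then have "closed {s\<in>{0..t}. \<epsilon> \<le> X s}"
    by (intro continuous_on_closed_Collect_le) auto
  moreover have "{s\<in>{0..t}. X s \<in> {0..<\<epsilon>}} = {0..t} - {s\<in>{0..t}. \<epsilon> \<le> X s}" using constraint assms by auto
  ultimately show ?thesis by auto
qed

lemma L_0: "L 0 = 0"
proof -
  have "measure lborel {s\<in>{0..0}. X s \<in> {0..<\<epsilon>}} = 0" for \<epsilon>
  proof -
    have "{s\<in>{0..0}. X s \<in> {0..<\<epsilon>}} \<subseteq> {0}" by auto
    then have "{s\<in>{0..0}. X s \<in> {0..<\<epsilon>}} \<in> null_sets lborel"
      by (intro finite_imp_null_set_lborel) (rule finite_subset, auto)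
    then show ?thesis by (rule measure_eq_0_null_sets)
  qed
  then have "((\<lambda>\<epsilon>. 0) \<longlongrightarrow> L 0) (at_right (0::real))" using local_time[of 0] T by simp
  then show ?thesis using tendsto_unique[OF _ _ tendsto_const, of "at_right (0::real)"] by (metis trivial_limit_at_right_real)
qed

text \<open>At time 0 the equation reads \<open>W 0 = \<nu> * W 0\<close>.\<close>

lemma W_0: "W 0 = 0"
proof -
  have "(1 - \<nu>) * W 0 = 0" using equation[of 0] T by (simp add: running_max_0 B_0 L_0 algebra_simps)
  then show ?thesis using \<nu> by simp
qed

lemma L_mono: assumes "0 \<le> s" "s \<le> t" "t \<le> T" shows "L s \<le> L t"
proof (rule tendsto_le[OF _ local_time local_time])
  show "\<forall>\<^sub>F \<epsilon> in at_right 0. 1 / \<epsilon> * measure lborel {u\<in>{0..s}. X u \<in> {0..<\<epsilon>}}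
      \<le> 1 / \<epsilon> * measure lborel {u\<in>{0..t}. X u \<in> {0..<\<epsilon>}}"
  proof (rule eventually_at_rightI[of 0 1])
    fix \<epsilon> :: real assume "\<epsilon> \<in> {0<..<1}"
    moreover have "measure lborel {u\<in>{0..s}. X u \<in> {0..<\<epsilon>}} \<le> measure lborel {u\<in>{0..t}. X u \<in> {0..<\<epsilon>}}"
    proof (rule measure_mono_fmeasurable)
      have "emeasure lborel {u\<in>{0..t}. X u \<in> {0..<\<epsilon>}} \<le> emeasure lborel {0..t}"
        using assms by (intro emeasure_mono) auto
      then show "{u\<in>{0..t}. X u \<in> {0..<\<epsilon>}} \<in> fmeasurable lborel"
        using sublevel_sets[of t \<epsilon>] assms by (intro fmeasurableI) (auto simp: less_top[symmetric] top_unique)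
    qed (use assms sublevel_sets[of s \<epsilon>] in auto)
    ultimately show "1 / \<epsilon> * measure lborel {u\<in>{0..s}. X u \<in> {0..<\<epsilon>}}
      \<le> 1 / \<epsilon> * measure lborel {u\<in>{0..t}. X u \<in> {0..<\<epsilon>}}" by (intro mult_left_mono) auto
  qed simp
qed (use assms in auto)

text \<open>On the compact interval \<open>X\<close> has a positive minimum; for \<epsilon> below it
  the two occupation sets coincide.\<close>

lemma L_const_closed:
  assumes "0 \<le> s" "s \<le> t" "t \<le> T" and pos: "\<And>u. u \<in> {s..t} \<Longrightarrow> 0 < X u"
  shows "L s = L t"
proof -
  obtain m where m: "m \<in> {s..t}" "\<And>u. u \<in> {s..t} \<Longrightarrow> X m \<le> X u"
  proof -
    have "continuous_on {s..t} X"
      using assms by (intro continuous_intros continuous_on_subset[OF cont_W] continuous_on_subset[OF cont_b]) auto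
    then show ?thesis using continuous_attains_inf[of "{s..t}" X] that assms by auto
  qed
  have "L s - L t = 0"
  proof (rule tendsto_unique)
    show "((\<lambda>\<epsilon>. 1 / \<epsilon> * measure lborel {u\<in>{0..s}. X u \<in> {0..<\<epsilon>}}
      - 1 / \<epsilon> * measure lborel {u\<in>{0..t}. X u \<in> {0..<\<epsilon>}}) \<longlongrightarrow> L s - L t) (at_right 0)"
      using assms by (intro tendsto_diff local_time) auto
    have "\<forall>\<^sub>F \<epsilon> in at_right 0. 1 / \<epsilon> * measure lborel {u\<in>{0..s}. X u \<in> {0..<\<epsilon>}}
      - 1 / \<epsilon> * measure lborel {u\<in>{0..t}. X u \<in> {0..<\<epsilon>}} = 0"
    proof (rule eventually_at_rightI[of 0 "X m"])
      fix \<epsilon> assume e: "\<epsilon> \<in> {0<..<X m}"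
      have "{u\<in>{0..s}. X u \<in> {0..<\<epsilon>}} = {u\<in>{0..t}. X u \<in> {0..<\<epsilon>}}"
      proof (rule set_eqI)
        fix u
        show "u \<in> {u\<in>{0..s}. X u \<in> {0..<\<epsilon>}} \<longleftrightarrow> u \<in> {u\<in>{0..t}. X u \<in> {0..<\<epsilon>}}"
          using m(2)[of u] e assms by (cases "u \<le> s") auto
      qed
      then show "1 / \<epsilon> * measure lborel {u\<in>{0..s}. X u \<in> {0..<\<epsilon>}}
      - 1 / \<epsilon> * measure lborel {u\<in>{0..t}. X u \<in> {0..<\<epsilon>}} = 0" by simp
    qed (use pos[OF m(1)] in simp)
    then show "((\<lambda>\<epsilon>. 1 / \<epsilon> * measure lborel {u\<in>{0..s}. X u \<in> {0..<\<epsilon>}}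
      - 1 / \<epsilon> * measure lborel {u\<in>{0..t}. X u \<in> {0..<\<epsilon>}}) \<longlongrightarrow> 0) (at_right 0)"
      by (rule tendsto_eventually)
  qed simp
  then show ?thesis by simp
qed

text \<open>A pointwise limit of occupation times need not be continuous in time; the continuity of
  \<open>L\<close> is read off the equation instead.\<close>

lemma L_osc:
  assumes "\<bar>W s - W t\<bar> \<le> e" "\<bar>B s - B t\<bar> \<le> e" "\<bar>M s - M t\<bar> \<le> e" "s \<in> {0..T}" "t \<in> {0..T}"
  shows "\<bar>L s - L t\<bar> \<le> (4 + 2 * \<bar>\<nu>\<bar>) * e"
proof -
  have "L s - L t = 2 * (W s - W t) - 2 * (B s - B t) - 2 * (\<nu> * (M s - M t))"
    using equation[OF assms(4)] equation[OF assms(5)] by (simp add: algebra_simps)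
  moreover have "\<bar>\<nu> * (M s - M t)\<bar> \<le> \<bar>\<nu>\<bar> * e" unfolding abs_mult using assms by (intro mult_left_mono) auto
  ultimately show ?thesis using assms by (simp add: algebra_simps abs_le_iff)
qed

text \<open>Now the left endpoint may be a zero of \<open>X\<close>, as is the case at the last zero
  before a given time. The previous constancy holds from any later time on, and continuity closes
  the gap.\<close>

lemma L_const:
  assumes "0 \<le> s" "s \<le> t" "t \<le> T" and pos: "\<And>u. s < u \<Longrightarrow> u \<le> t \<Longrightarrow> 0 < X u"
  shows "L s = L t"
proof (rule ccontr)
  assume ne: "L s \<noteq> L t"
  then have st: "s < t" using assms by (cases "s = t") auto
  \<comment> \<open>Chosen so that \<open>L_osc\<close> permits only half of the supposed
    growth.\<close>
  define e where "e = (L t - L s) / (2 * (4 + 2 * \<bar>\<nu>\<bar>))"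
  have lt: "L s < L t" using ne L_mono[of s t] assms by auto
  then have "0 < e" by (simp add: e_def)
  then obtain d where d: "0 < d"
    "\<And>u v. \<lbrakk>u \<in> {0..T}; v \<in> {0..T}; \<bar>u - v\<bar> \<le> d\<rbrakk> \<Longrightarrow> close e u v"
    using modulus by metis
  define v where "v = min t (s + d)"
  have v: "s < v" "v \<le> t" "v - s \<le> d" using st d by (auto simp: v_def)
  have "L v = L t" using v assms by (intro L_const_closed) auto
  moreover have "\<bar>L v - L s\<bar> \<le> (4 + 2 * \<bar>\<nu>\<bar>) * e"
    using d(2)[of v s] v assms by (intro L_osc) auto
  moreover have "(4 + 2 * \<bar>\<nu>\<bar>) * e = (L t - L s) / 2" by (simp add: e_def field_simps)
  ultimately show False using lt by (auto simp: field_simps)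
qed

text \<open>After the last zero \<open>g\<close> of \<open>X\<close> before \<open>t\<close> only \<open>B\<close> and \<open>M\<close> move \<open>W\<close>, so \<open>W\<close> gains at most
  \<open>O((t - g) powr \<beta>)\<close>, whereas the barrier has gained at least a multiple of \<open>(t - g) powr (1 / p)\<close>.\<close>

lemma contact_at_steep:
  assumes H: "\<And>s u. \<lbrakk>s \<in> {0..\<tau>}; u \<in> {0..\<tau>}\<rbrakk> \<Longrightarrow> \<bar>B s - B u\<bar> \<le> C * \<bar>s - u\<bar> powr \<beta>"
    and \<tau>: "\<tau> \<le> T" and t: "t \<in> {0..\<tau>}" and steep: "steep K p b t"
    and K: "0 < K" "0 < p" "0 < C" "1 < \<beta> * p"
    and small: "K * (C / (1 - max 0 \<nu>)) powr p * \<tau> powr (\<beta> * p - 1) \<le> 1"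
  shows "X t = 0"
proof (rule ccontr)
  assume "X t \<noteq> 0"
  then have Xt: "0 < X t" using constraint[of t] t \<tau> by auto
  have \<beta>: "0 < \<beta>" using K by (metis less_trans zero_less_mult_pos2 zero_less_one)
  define Z where "Z = {s\<in>{0..t}. X s \<le> 0}"
  have "continuous_on {0..t} X"
    using t \<tau> by (intro continuous_intros continuous_on_subset[OF cont_W] continuous_on_subset[OF cont_b]) auto
  then have "closed Z" unfolding Z_def by (intro continuous_on_closed_Collect_le) auto
  moreover have "0 \<in> Z" using t by (auto simp: Z_def W_0 b_0)
  moreover have bdd: "bdd_above Z" by (auto simp: Z_def intro!: bdd_aboveI[of _ t])
  ultimately have gZ: "Sup Z \<in> Z" by (intro closed_contains_Sup) auto
  define g where "g = Sup Z"
  have g: "0 \<le> g" "g \<le> t" "X g = 0" using gZ constraint[of g] t \<tau> by (auto simp: g_def Z_def)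
  then have gt: "g < t" using Xt by (cases "g = t") auto
  have pos: "0 < X u" if "g < u" "u \<le> t" for u
    using cSup_upper[OF _ bdd, of u] that g by (force simp: g_def Z_def not_le)
  have Lc: "L v = L g" if "v \<in> {g..t}" for v
    using that g t \<tau> pos by (intro L_const[symmetric]) auto
  define u where "u = t - g"
  define S where "S = M t - M g"
  define k where "k = C * u powr \<beta>"
  have S0: "0 \<le> S" using running_max_mono[of g t] g t \<tau> by (auto simp: S_def)
  have k0: "0 < k" using K gt by (simp add: k_def u_def)
  have incr: "W v - W g \<le> k + \<nu> * (M v - M g)" if v: "v \<in> {g..t}" for v
  proof -
    have "W v - W g = B v - B g + \<nu> * (M v - M g)"
      using equation[of v] equation[of g] Lc[OF v] v g t \<tau> by (simp add: algebra_simps)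
    moreover have "B v - B g \<le> C * \<bar>v - g\<bar> powr \<beta>" using H[of v g] v g t by auto
    moreover have "C * \<bar>v - g\<bar> powr \<beta> \<le> k"
      unfolding k_def u_def using v \<beta> K by (intro mult_left_mono powr_mono2) auto
    ultimately show ?thesis by simp
  qed
  \<comment> \<open>When the new maximum is reached, \<open>W\<close> has gained at least
    \<open>S\<close> since \<open>g\<close>, yet by \<open>incr\<close> at most
    \<open>k + \<nu> * S\<close>; the last term is absorbed on the left.\<close>
  have Sle: "(1 - \<nu>) * S \<le> k"
  proof (cases "M g < M t")
    case True
    then obtain v where v: "v \<in> {g..t}" "W v = M t" "M v = M t"
      using running_max_increase[of g t] g t \<tau> by auto
    have "W g \<le> M g" using g t \<tau> by (intro running_max_ge) auto
    then have "S \<le> W v - W g" using v by (simp add: S_def)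
    also have "\<dots> \<le> k + \<nu> * S" using incr[OF v(1)] v by (simp add: S_def)
    finally show ?thesis by (simp add: algebra_simps)
  next
    case False
    then have "S = 0" using S0 by (simp add: S_def)
    then show ?thesis using k0 by simp
  qed
  have m: "0 < 1 - max 0 \<nu>" using \<nu> by auto
  have "W t - W g \<le> k + \<nu> * S" using incr[of t] gt by (simp add: S_def)
  also have "k + \<nu> * S \<le> k / (1 - max 0 \<nu>)"
  proof (cases "\<nu> \<le> 0")
    case True
    then show ?thesis using S0 by (simp add: mult_nonpos_nonneg)
  next
    case False
    then have "\<nu> * ((1 - \<nu>) * S) \<le> \<nu> * k" using Sle by (intro mult_left_mono) auto
    then have "(k + \<nu> * S) * (1 - \<nu>) \<le> k" by (simp add: algebra_simps)
    then show ?thesis using False \<nu> by (simp add: pos_le_divide_eq)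
  qed
  finally have Wd: "W t - W g \<le> C / (1 - max 0 \<nu>) * u powr \<beta>" by (simp add: k_def)
  have b0: "0 \<le> b t - b g" using mono_onD[OF mono_b, of g t] g t \<tau> by auto
  have bd: "b t - b g < C / (1 - max 0 \<nu>) * u powr \<beta>" using Wd Xt g by simp
  \<comment> \<open>Steepness turns the bound on the gain of the barrier into \<open>u < u\<close>:
    since \<open>\<beta> * p\<close> exceeds 1, a positive power of \<open>u\<close> is left over,
    and \<open>small\<close> absorbs the constants into it.\<close>
  have "u \<le> K * (b t - b g) powr p" using bspec[OF steep[unfolded steep_def], of g] g by (simp add: u_def)
  also have "\<dots> < K * (C / (1 - max 0 \<nu>) * u powr \<beta>) powr p"
    using K b0 bd by (intro mult_strict_left_mono powr_less_mono2) auto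
  also have "\<dots> = K * (C / (1 - max 0 \<nu>)) powr p * u powr (\<beta> * p - 1) * u"
  proof -
    define c where "c = C / (1 - max 0 \<nu>)"
    have "0 < c" "0 < u" using K m gt by (auto simp: c_def u_def)
    then have "(c * u powr \<beta>) powr p = c powr p * u powr (\<beta> * p)" by (simp add: powr_mult powr_powr)
    also have "\<dots> = c powr p * (u powr (\<beta> * p - 1) * u)" using \<open>0 < u\<close> by (simp add: powr_diff)
    finally show ?thesis by (simp add: c_def)
  qed
  also have "\<dots> \<le> K * (C / (1 - max 0 \<nu>)) powr p * \<tau> powr (\<beta> * p - 1) * u"
    using K m gt t g by (intro mult_left_mono mult_right_mono powr_mono2) (auto simp: u_def)
  also have "\<dots> \<le> 1 * u" using small gt by (intro mult_right_mono) (auto simp: u_def)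
  finally show False by simp
qed

section \<open>Occupation times as sums over grid points\<close>

lemma sublevel_le_cells:
  assumes \<tau>: "0 < \<tau>" "\<tau> \<le> T" and N: "0 < N"
    and osc: "\<And>s u. \<lbrakk>s \<in> {0..\<tau>}; u \<in> {0..\<tau>}; \<bar>s - u\<bar> \<le> \<tau> / real N\<rbrakk> \<Longrightarrow> \<bar>X s - X u\<bar> \<le> c - a"
  shows "measure lborel {s\<in>{0..\<tau>}. X s \<in> {0..<a}} \<le> (\<Sum>i<N. indicator {..<c} (X (grid \<tau> N i)) * (\<tau> / real N))"
proof -
  let ?J = "{i. i < N \<and> X (grid \<tau> N i) < c}"
  let ?U = "\<Union>i\<in>?J. {\<tau> * real i / real N..<\<tau> * real (Suc i) / real N}"
  have J: "finite ?J" "?J \<subseteq> {..<N}" by auto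
  have "{s\<in>{0..\<tau>}. X s \<in> {0..<a}} \<subseteq> ?U \<union> {\<tau>}"
  proof
    fix s assume s: "s \<in> {s\<in>{0..\<tau>}. X s \<in> {0..<a}}"
    show "s \<in> ?U \<union> {\<tau>}"
    proof (cases "s = \<tau>")
      case False
      then obtain i where i: "i < N" "s \<in> {\<tau> * real i / real N..<\<tau> * real (Suc i) / real N}"
        using equidistant_cell[OF \<tau>(1) _ _ N, of s] s by auto
      have "grid \<tau> N i \<in> {0..\<tau>}" "\<bar>s - grid \<tau> N i\<bar> \<le> \<tau> / real N"
        using i s \<tau> by (auto simp: grid_def distrib_left add_divide_distrib)
      then have "X (grid \<tau> N i) < c" using osc[of s "grid \<tau> N i"] s by auto
      then show ?thesis using i by auto
    qed simp
  qed
  moreover have fU: "?U \<in> fmeasurable lborel"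
  proof (rule fmeasurable.finite_UN[OF J(1)])
    fix i
    show "{\<tau> * real i / real N..<\<tau> * real (Suc i) / real N} \<in> fmeasurable lborel"
      by (cases "\<tau> * real i / real N \<le> \<tau> * real (Suc i) / real N") (auto intro!: fmeasurableI simp del: of_nat_Suc)
  qed
  ultimately have "measure lborel {s\<in>{0..\<tau>}. X s \<in> {0..<a}} \<le> measure lborel (?U \<union> {\<tau>})"
    using sublevel_sets[of \<tau> a] \<tau> by (intro measure_mono_fmeasurable fmeasurable.Un) (auto intro!: fmeasurableI)
  also have "\<dots> \<le> measure lborel ?U + measure lborel {\<tau>}"
    using fU by (intro measure_Un_le) auto
  also have "measure lborel {\<tau>} = 0" by simp
  also have "measure lborel ?U = (\<Sum>i\<in>?J. \<tau> / real N)" by (rule measure_equidistant_cells[OF \<tau>(1) N J(2)])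
  also have "\<dots> = (\<Sum>i<N. indicator {..<c} (X (grid \<tau> N i)) * (\<tau> / real N))"
    by (rule sum.mono_neutral_cong_left) (auto simp: indicator_def)
  finally show ?thesis by simp
qed

text \<open>As in the reverse comparison, the difference \<open>c - a\<close> of the two levels
  absorbs the oscillation of \<open>X\<close> within a cell.\<close>

lemma cells_le_sublevel:
  assumes \<tau>: "0 < \<tau>" "\<tau> \<le> T" and N: "0 < N"
    and osc: "\<And>s u. \<lbrakk>s \<in> {0..\<tau>}; u \<in> {0..\<tau>}; \<bar>s - u\<bar> \<le> \<tau> / real N\<rbrakk> \<Longrightarrow> \<bar>X s - X u\<bar> \<le> c - a"
  shows "(\<Sum>i<N. indicator {..<a} (X (grid \<tau> N i)) * (\<tau> / real N)) \<le> measure lborel {s\<in>{0..\<tau>}. X s \<in> {0..<c}}"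
proof -
  let ?J = "{i. i < N \<and> X (grid \<tau> N i) < a}"
  let ?U = "\<Union>i\<in>?J. {\<tau> * real i / real N..<\<tau> * real (Suc i) / real N}"
  have J: "finite ?J" "?J \<subseteq> {..<N}" by auto
  have sub: "?U \<subseteq> {s\<in>{0..\<tau>}. X s \<in> {0..<c}}"
  proof
    fix s assume "s \<in> ?U"
    then obtain i where i: "i < N" "X (grid \<tau> N i) < a" "s \<in> {\<tau> * real i / real N..<\<tau> * real (Suc i) / real N}"
      by auto
    have "\<tau> * real (Suc i) / real N \<le> \<tau>" using i(1) \<tau> by (simp add: pos_divide_le_eq del: of_nat_Suc)
    moreover have "0 \<le> grid \<tau> N i" using \<tau> by (simp add: grid_def)
    ultimately have s: "s \<in> {0..\<tau>}" "grid \<tau> N i \<in> {0..\<tau>}" using i(3) by (auto simp: grid_def)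
    have "\<bar>s - grid \<tau> N i\<bar> \<le> \<tau> / real N" using i by (auto simp: grid_def distrib_left add_divide_distrib)
    then have "X s < c" using osc[OF s] i(2) by auto
    then show "s \<in> {s\<in>{0..\<tau>}. X s \<in> {0..<c}}" using s constraint[of s] \<tau> by auto
  qed
  have "(\<Sum>i<N. indicator {..<a} (X (grid \<tau> N i)) * (\<tau> / real N)) = (\<Sum>i\<in>?J. \<tau> / real N)"
    by (rule sum.mono_neutral_cong_right) (auto simp: indicator_def)
  also have "\<dots> = measure lborel ?U" by (rule measure_equidistant_cells[OF \<tau>(1) N J(2), symmetric])
  also have "\<dots> \<le> measure lborel {s\<in>{0..\<tau>}. X s \<in> {0..<c}}"
  proof (rule measure_mono_fmeasurable[OF sub])
    have "emeasure lborel {s\<in>{0..\<tau>}. X s \<in> {0..<c}} \<le> emeasure lborel {0..\<tau>}"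
      by (intro emeasure_mono) auto
    then show "{s\<in>{0..\<tau>}. X s \<in> {0..<c}} \<in> fmeasurable lborel"
      using sublevel_sets[of \<tau> c] \<tau> by (intro fmeasurableI) (auto simp: less_top[symmetric] top_unique)
  qed auto
  finally show ?thesis .
qed

text \<open>Taylor expansion of \<open>pot \<epsilon>\<close>, whose derivative is \<open>- hat \<epsilon>\<close> and whose second derivative is \<open>1 / \<epsilon>\<close> on
  \<open>[0, \<epsilon>)\<close>, along \<open>X\<close>: the second-order term approximates half the local time and so cancels
  the contribution of \<open>L / 2\<close> to the drift.\<close>

lemma discrete_bound:
  assumes \<tau>: "0 < \<tau>" "\<tau> \<le> T" and N: "0 < N" and \<epsilon>: "0 < \<epsilon>" and e: "0 \<le> e" "4 * e \<le> \<epsilon>\<^sup>2"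
    and osc: "\<And>u v. \<lbrakk>u \<in> {0..T}; v \<in> {0..T}; \<bar>u - v\<bar> \<le> \<tau> / real N\<rbrakk> \<Longrightarrow>
      close e u v"
  shows "(1 - max 0 \<nu>) * (\<Sum>i<N. hat \<epsilon> (X (grid \<tau> N i)) * (b (grid \<tau> N (Suc i)) - b (grid \<tau> N i)))
    \<le> (\<Sum>i<N. hat \<epsilon> (X (grid \<tau> N i)) * (B (grid \<tau> N (Suc i)) - B (grid \<tau> N i)))
      + L \<tau> / 2 + (1 + max 0 \<nu>) * (\<epsilon> / 2)
      + e / \<epsilon> * (max 0 \<nu> * (5 * M \<tau> + b \<tau>) + 2 * (\<bar>\<nu>\<bar> * M \<tau> + L \<tau> + b \<tau>))
      - (measure lborel {s\<in>{0..\<tau>}. X s \<in> {0..<\<epsilon> - \<epsilon>\<^sup>2}}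
         + (\<Sum>i<N. indicator {..<\<epsilon> - \<epsilon>\<^sup>2 / 2} (X (grid \<tau> N i)) *
             ((B (grid \<tau> N (Suc i)) - B (grid \<tau> N i))\<^sup>2 - \<tau> / real N))) / (2 * \<epsilon>)"
proof -
  define g where "g = grid \<tau> N"
  define x where "x i = X (g i)" for i
  define h where "h i = hat \<epsilon> (x i)" for i
  \<comment> \<open>The margin \<open>\<epsilon>\<^sup>2 / 2\<close> leaves room for an increment of
    size \<open>2 * e\<close>, so that the next grid point is still at most \<epsilon>. Being of
    smaller order than \<epsilon>, it does not affect the local time in the limit.\<close>
  define I where "I i = (indicator {..<\<epsilon> - \<epsilon>\<^sup>2 / 2} (x i) :: real)" for i
  define D where "D i = M (g i) - b (g i)" for i
  define dB dM dL db dX dD where "dB i = B (g (Suc i)) - B (g i)" and "dM i = M (g (Suc i)) - M (g i)"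
    and "dL i = L (g (Suc i)) - L (g i)" and "db i = b (g (Suc i)) - b (g i)"
    and "dX i = x (Suc i) - x i" and "dD i = D (Suc i) - D i" for i
  define w where "w = max 0 \<nu>"
  have w: "0 \<le> w" "\<nu> \<le> w" by (auto simp: w_def)
  have g0: "g 0 = 0" and gN: "g N = \<tau>" using N by (auto simp: g_def grid_def)
  have g: "g i \<in> {0..T}" "g i \<in> {0..\<tau>}" if "i \<le> N" for i
  proof -
    have "g i \<le> \<tau>" using that \<tau> N by (simp add: g_def grid_def pos_divide_le_eq)
    then show "g i \<in> {0..T}" "g i \<in> {0..\<tau>}" using \<tau> by (auto simp: g_def grid_def)
  qed
  have gs: "g i \<le> g (Suc i)" "\<bar>g (Suc i) - g i\<bar> \<le> \<tau> / real N" for i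
    using \<tau> N by (auto simp: g_def grid_def distrib_left add_divide_distrib)
  have x0: "0 \<le> x i" if "i \<le> N" for i using constraint[OF g(1)[OF that]] by (simp add: x_def)
  have D0: "0 \<le> D i" "x i \<le> D i" if "i \<le> N" for i
    using running_max_ge[of "g i" "g i"] x0[OF that] g[OF that] by (auto simp: x_def D_def)
  have dM: "0 \<le> dM i" and dL: "0 \<le> dL i" and db: "0 \<le> db i" if "i < N" for i
    using running_max_mono[OF _ gs(1)[of i]] L_mono[OF _ gs(1)[of i]] mono_onD[OF mono_b _ _ gs(1)[of i]]
      g[of i] g[of "Suc i"] that by (auto simp: dM_def dL_def db_def)
  have dX: "dX i = dB i + \<nu> * dM i + dL i / 2 - db i" if "i < N" for i
    using equation[OF g(1), of i] equation[OF g(1), of "Suc i"] that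
    by (simp add: dX_def x_def dB_def dM_def dL_def db_def right_diff_distrib diff_divide_distrib)
  have small: "\<bar>dB i\<bar> \<le> e" "\<bar>dM i\<bar> \<le> e" "\<bar>db i\<bar> \<le> e" "\<bar>dX i\<bar> \<le> 2 * e" if "i < N" for i
  proof -
    have o: "close e (g (Suc i)) (g i)"
      using osc[of "g (Suc i)" "g i"] g(1)[of i] g(1)[of "Suc i"] gs(2)[of i] that by auto
    then show "\<bar>dB i\<bar> \<le> e" "\<bar>dM i\<bar> \<le> e" "\<bar>db i\<bar> \<le> e" "\<bar>dX i\<bar> \<le> 2 * e"
      by (auto simp: dB_def dM_def db_def dX_def x_def)
  qed
  have h: "0 \<le> h i" "h i \<le> 1" for i by (auto simp: h_def hat_range)
  have tele: "(\<Sum>i<N. dM i) = M \<tau>" "(\<Sum>i<N. dL i) = L \<tau>" "(\<Sum>i<N. db i) = b \<tau>"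
    using sum_lessThan_telescope[of "\<lambda>i. M (g i)" N] sum_lessThan_telescope[of "\<lambda>i. L (g i)" N]
      sum_lessThan_telescope[of "\<lambda>i. b (g i)" N]
    unfolding dM_def dL_def db_def by (simp_all add: g0 gN running_max_0 W_0 L_0 b_0)
  \<comment> \<open>Below the cut both ends of the step are in [0, \<epsilon>] and the expansion is
    exact; at all other points convexity suffices. The term \<epsilon> / 2 bounds the telescoped
    values of \<open>pot\<close>.\<close>
  have s1: "(\<Sum>i<N. I i * (dX i)\<^sup>2) / (2 * \<epsilon>) \<le> \<epsilon> / 2 + (\<Sum>i<N. h i * dX i)"
  proof -
    have "I i * (dX i)\<^sup>2 / (2 * \<epsilon>) \<le> h i * dX i + (pot \<epsilon> (x (Suc i)) - pot \<epsilon> (x i))" if i: "i < N" for i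
    proof (cases "x i < \<epsilon> - \<epsilon>\<^sup>2 / 2")
      case True
      then have "x (Suc i) \<le> \<epsilon>" using small(4)[OF i] e by (simp add: dX_def)
      moreover have "x i \<le> \<epsilon>" using True zero_le_power2[of \<epsilon>] by linarith
      ultimately show ?thesis
        using True pot_quadratic[of \<epsilon> "x i" "x (Suc i)"] \<epsilon> x0[of i] x0[of "Suc i"] i
        by (simp add: I_def h_def dX_def)
    next
      case False
      then show ?thesis using pot_lower[of \<epsilon> "x i" "x (Suc i)"] \<epsilon> x0[of i] x0[of "Suc i"] i
        by (simp add: I_def h_def dX_def)
    qed
    then have "(\<Sum>i<N. I i * (dX i)\<^sup>2 / (2 * \<epsilon>)) \<le> (\<Sum>i<N. h i * dX i + (pot \<epsilon> (x (Suc i)) - pot \<epsilon> (x i)))"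
      by (intro sum_mono) auto
    also have "\<dots> = (\<Sum>i<N. h i * dX i) + (pot \<epsilon> (x N) - pot \<epsilon> (x 0))"
      by (simp add: sum.distrib sum_lessThan_telescope[of "\<lambda>i. pot \<epsilon> (x i)"])
    also have "\<dots> \<le> \<epsilon> / 2 + (\<Sum>i<N. h i * dX i)"
      using pot_range[OF \<epsilon> x0, of N] pot_range[OF \<epsilon> x0, of 0] by simp
    finally show ?thesis by (simp add: sum_divide_distrib)
  qed
  \<comment> \<open>The difference of the squares factors: \<open>dX + dB\<close> is at most
    \<open>3 * e\<close>, and \<open>dX - dB\<close> sums to at most the variation of the
    drift.\<close>
  have s2: "(\<Sum>i<N. I i * (dB i)\<^sup>2) - 3 * e * (\<bar>\<nu>\<bar> * M \<tau> + L \<tau> / 2 + b \<tau>) \<le> (\<Sum>i<N. I i * (dX i)\<^sup>2)"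
  proof -
    have "I i * (dB i)\<^sup>2 - 3 * e * (\<bar>\<nu>\<bar> * dM i + dL i / 2 + db i) \<le> I i * (dX i)\<^sup>2" if i: "i < N" for i
    proof -
      have "\<bar>dX i - dB i\<bar> \<le> \<bar>\<nu> * dM i\<bar> + dL i / 2 + db i" using dX[OF i] dL[OF i] db[OF i] by simp
      then have a: "\<bar>dX i - dB i\<bar> \<le> \<bar>\<nu>\<bar> * dM i + dL i / 2 + db i" using dM[OF i] by (simp add: abs_mult)
      have "\<bar>dX i + dB i\<bar> \<le> 3 * e" using small[OF i] by simp
      with a have "\<bar>dX i + dB i\<bar> * \<bar>dX i - dB i\<bar> \<le> 3 * e * (\<bar>\<nu>\<bar> * dM i + dL i / 2 + db i)"
        using e by (intro mult_mono) auto
      then have "\<bar>(dX i)\<^sup>2 - (dB i)\<^sup>2\<bar> \<le> 3 * e * (\<bar>\<nu>\<bar> * dM i + dL i / 2 + db i)"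
        by (simp add: abs_mult[symmetric] power2_eq_square algebra_simps)
      moreover have "I i = 0 \<or> I i = 1" by (auto simp: I_def indicator_def)
      moreover have "0 \<le> 3 * e * (\<bar>\<nu>\<bar> * dM i + dL i / 2 + db i)" using e dM[OF i] dL[OF i] db[OF i] by simp
      ultimately show ?thesis by auto
    qed
    then have "(\<Sum>i<N. I i * (dB i)\<^sup>2 - 3 * e * (\<bar>\<nu>\<bar> * dM i + dL i / 2 + db i)) \<le> (\<Sum>i<N. I i * (dX i)\<^sup>2)"
      by (intro sum_mono) auto
    then show ?thesis
      by (simp add: sum_subtractf sum.distrib sum_distrib_left[symmetric] sum_divide_distrib[symmetric] tele)
  qed
  have s3: "(\<Sum>i<N. h i * dL i) \<le> L \<tau>"
    unfolding tele(2)[symmetric] using h dL by (intro sum_mono mult_left_le_one_le) auto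
  \<comment> \<open>\<open>M\<close> increases only when \<open>W = M\<close>, that is \<open>X = D\<close>, and \<open>\<Sum> hat (D) dD\<close> telescopes up to \<open>O(\<epsilon>)\<close>.\<close>
  have s4: "(\<Sum>i<N. h i * dM i) \<le> (\<Sum>i<N. h i * db i) + \<epsilon> / 2 + e / \<epsilon> * (5 * M \<tau> + b \<tau>)"
  proof -
    have "h i * dM i \<le> h i * db i + (pot \<epsilon> (D i) - pot \<epsilon> (D (Suc i))) + e / \<epsilon> * (5 * dM i + db i)" if i: "i < N" for i
    proof -
      have dD: "dD i = dM i - db i" by (simp add: dD_def D_def dM_def db_def)
      have 1: "h i * dM i \<le> (hat \<epsilon> (D i) + 4 * e / \<epsilon>) * dM i"
      proof (cases "M (g i) < M (g (Suc i))")
        case True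
        then obtain u where u: "u \<in> {g i..g (Suc i)}" "W u = M (g (Suc i))" "M u = M (g (Suc i))"
          using running_max_increase[of "g i" "g (Suc i)"] gs(1)[of i] g(1)[of i] g(1)[of "Suc i"] i by auto
        have uT: "u \<in> {0..T}" using u g(1)[of i] g(1)[of "Suc i"] i by auto
        have "\<bar>u - g i\<bar> \<le> \<tau> / real N" using u gs[of i] by auto
        then have o: "close e u (g i)"
          using osc[OF uT g(1)] i by auto
        have "\<bar>x i - D i\<bar> \<le> 4 * e" using o u by (simp add: x_def D_def abs_le_iff)
        then have "\<bar>x i - D i\<bar> / \<epsilon> \<le> 4 * e / \<epsilon>" using \<epsilon> by (intro divide_right_mono) auto
        then have "h i \<le> hat \<epsilon> (D i) + 4 * e / \<epsilon>"
          using hat_lipschitz[OF \<epsilon>, of "x i" "D i"] by (simp add: h_def)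
        then show ?thesis using dM[OF i] by (intro mult_right_mono)
      next
        case False
        then have "dM i = 0" using dM[OF i] by (simp add: dM_def)
        then show ?thesis by simp
      qed
      have 2: "hat \<epsilon> (D i) * dD i \<le> pot \<epsilon> (D i) - pot \<epsilon> (D (Suc i)) + (dD i)\<^sup>2 / (2 * \<epsilon>)"
        using pot_upper[OF \<epsilon> D0(1)[of i] D0(1)[of "Suc i"]] i by (simp add: dD_def)
      have "(dD i)\<^sup>2 = \<bar>dD i\<bar> * \<bar>dD i\<bar>" by (simp add: power2_eq_square)
      also have "\<dots> \<le> (2 * e) * (dM i + db i)"
        using small[OF i] dM[OF i] db[OF i] e unfolding dD by (intro mult_mono) auto
      finally have "(dD i)\<^sup>2 / (2 * \<epsilon>) \<le> (2 * e) * (dM i + db i) / (2 * \<epsilon>)" using \<epsilon> by (intro divide_right_mono) auto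
      then have 3: "(dD i)\<^sup>2 / (2 * \<epsilon>) \<le> e / \<epsilon> * (dM i + db i)" by simp
      \<comment> \<open>The inequality between \<open>X\<close> and \<open>D\<close> enters here
        with the right sign, since \<open>hat\<close> is decreasing.\<close>
      have "hat \<epsilon> (D i) \<le> h i" unfolding h_def using D0(2)[of i] i \<epsilon> by (intro hat_antimono) auto
      then have 4: "hat \<epsilon> (D i) * db i \<le> h i * db i" using db[OF i] by (intro mult_right_mono)
      have "h i * dM i \<le> hat \<epsilon> (D i) * dM i + 4 * e / \<epsilon> * dM i" using 1 by (simp add: distrib_right)
      also have "hat \<epsilon> (D i) * dM i = hat \<epsilon> (D i) * dD i + hat \<epsilon> (D i) * db i" by (simp add: dD algebra_simps)
      finally have "h i * dM i \<le> h i * db i + (pot \<epsilon> (D i) - pot \<epsilon> (D (Suc i))) + (e / \<epsilon> * (dM i + db i) + 4 * e / \<epsilon> * dM i)"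
        using 2 3 4 by linarith
      also have "e / \<epsilon> * (dM i + db i) + 4 * e / \<epsilon> * dM i = e / \<epsilon> * (5 * dM i + db i)"
        by (simp add: add_divide_distrib[symmetric] algebra_simps)
      finally show ?thesis .
    qed
    then have "(\<Sum>i<N. h i * dM i) \<le> (\<Sum>i<N. h i * db i + (pot \<epsilon> (D i) - pot \<epsilon> (D (Suc i))) + e / \<epsilon> * (5 * dM i + db i))"
      by (intro sum_mono) auto
    also have "\<dots> = (\<Sum>i<N. h i * db i) + (pot \<epsilon> (D 0) - pot \<epsilon> (D N)) + e / \<epsilon> * (5 * M \<tau> + b \<tau>)"
      by (simp add: sum.distrib sum_lessThan_telescope'[of "\<lambda>i. pot \<epsilon> (D i)"]
          sum_distrib_left[symmetric] sum_divide_distrib[symmetric] tele)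
    finally show ?thesis using pot_range[OF \<epsilon> D0(1), of 0] pot_range[OF \<epsilon> D0(1), of N] by simp
  qed
  have s5: "measure lborel {s\<in>{0..\<tau>}. X s \<in> {0..<\<epsilon> - \<epsilon>\<^sup>2}} \<le> (\<Sum>i<N. I i * (\<tau> / real N))"
    unfolding I_def x_def g_def
  proof (rule sublevel_le_cells[OF \<tau> N])
    fix s u assume "s \<in> {0..\<tau>}" "u \<in> {0..\<tau>}" "\<bar>s - u\<bar> \<le> \<tau> / real N"
    then have "\<bar>W s - W u\<bar> \<le> e \<and> \<bar>b s - b u\<bar> \<le> e" using osc[of s u] \<tau> by auto
    then have "\<bar>X s - X u\<bar> \<le> 2 * e" by linarith
    then show "\<bar>X s - X u\<bar> \<le> \<epsilon> - \<epsilon>\<^sup>2 / 2 - (\<epsilon> - \<epsilon>\<^sup>2)" using e by linarith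
  qed
  define m where "m = measure lborel {s\<in>{0..\<tau>}. X s \<in> {0..<\<epsilon> - \<epsilon>\<^sup>2}}"
  define Q where "Q = (\<Sum>i<N. I i * ((dB i)\<^sup>2 - \<tau> / real N))"
  define V where "V = \<bar>\<nu>\<bar> * M \<tau> + L \<tau> / 2 + b \<tau>"
  have "(\<Sum>i<N. I i * (dB i)\<^sup>2) = Q + (\<Sum>i<N. I i * (\<tau> / real N))"
    unfolding Q_def by (simp add: sum.distrib[symmetric] algebra_simps)
  then have "m + Q - 3 * e * V \<le> (\<Sum>i<N. I i * (dX i)\<^sup>2)" using s2 s5 by (simp add: m_def V_def)
  then have "(m + Q - 3 * e * V) / (2 * \<epsilon>) \<le> (\<Sum>i<N. I i * (dX i)\<^sup>2) / (2 * \<epsilon>)"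
    using \<epsilon> by (intro divide_right_mono) auto
  then have a1: "(m + Q) / (2 * \<epsilon>) \<le> e / \<epsilon> * (3 / 2 * V) + \<epsilon> / 2 + (\<Sum>i<N. h i * dX i)"
    using s1 by (simp add: diff_divide_distrib)
  have a2: "(\<Sum>i<N. h i * dX i) = (\<Sum>i<N. h i * dB i) + \<nu> * (\<Sum>i<N. h i * dM i) + (\<Sum>i<N. h i * dL i) / 2 - (\<Sum>i<N. h i * db i)"
  proof -
    have "(\<Sum>i<N. h i * dX i) = (\<Sum>i<N. h i * dB i + \<nu> * (h i * dM i) + h i * dL i / 2 - h i * db i)"
      by (intro sum.cong refl) (simp add: dX algebra_simps)
    then show ?thesis by (simp add: sum.distrib sum_subtractf sum_distrib_left[symmetric] sum_divide_distrib[symmetric])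
  qed
  have "0 \<le> (\<Sum>i<N. h i * dM i)" using h dM by (intro sum_nonneg mult_nonneg_nonneg) auto
  then have "\<nu> * (\<Sum>i<N. h i * dM i) \<le> w * (\<Sum>i<N. h i * dM i)" using w by (intro mult_right_mono) auto
  also have "\<dots> \<le> w * ((\<Sum>i<N. h i * db i) + \<epsilon> / 2 + e / \<epsilon> * (5 * M \<tau> + b \<tau>))"
    using s4 w by (intro mult_left_mono) auto
  finally have a3: "\<nu> * (\<Sum>i<N. h i * dM i) \<le> w * (\<Sum>i<N. h i * db i) + w * (\<epsilon> / 2) + e / \<epsilon> * (w * (5 * M \<tau> + b \<tau>))"
    by (simp add: distrib_left mult_ac)
  have V: "3 / 2 * V \<le> 2 * (\<bar>\<nu>\<bar> * M \<tau> + L \<tau> + b \<tau>)"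
  proof -
    have "0 \<le> M \<tau>" "0 \<le> L \<tau>" "0 \<le> b \<tau>"
      unfolding tele[symmetric] using dM dL db by (auto intro!: sum_nonneg)
    then show ?thesis by (simp add: V_def)
  qed
  have a4: "e / \<epsilon> * (3 / 2 * V) \<le> e / \<epsilon> * (2 * (\<bar>\<nu>\<bar> * M \<tau> + L \<tau> + b \<tau>))"
    using V e \<epsilon> by (intro mult_left_mono) auto
  have "(1 - w) * (\<Sum>i<N. h i * db i) \<le> (\<Sum>i<N. h i * dB i) + L \<tau> / 2 + (1 + w) * (\<epsilon> / 2)
      + e / \<epsilon> * (w * (5 * M \<tau> + b \<tau>) + 2 * (\<bar>\<nu>\<bar> * M \<tau> + L \<tau> + b \<tau>)) - (m + Q) / (2 * \<epsilon>)"
  proof -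
    have "(1 - w) * (\<Sum>i<N. h i * db i) = (\<Sum>i<N. h i * db i) - w * (\<Sum>i<N. h i * db i)"
      "(1 + w) * (\<epsilon> / 2) = \<epsilon> / 2 + w * (\<epsilon> / 2)"
      by (simp_all add: algebra_simps)
    then show ?thesis unfolding distrib_left[of "e / \<epsilon>"] using a1 a2 a3 a4 s3 by linarith
  qed
  then show ?thesis by (simp only: w_def h_def x_def g_def db_def dB_def m_def Q_def I_def)
qed

section \<open>Vanishing mesh, then vanishing level\<close>

lemma eventually_grid_modulus:
  assumes "0 < \<tau>" "0 < e"
  shows "\<forall>\<^sub>F n in sequentially. \<forall>u\<in>{0..T}. \<forall>v\<in>{0..T}. \<bar>u - v\<bar> \<le> \<tau> / real (2 ^ n) \<longrightarrow>
    close e u v"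
proof -
  obtain d where d: "0 < d"
    "\<And>u v. \<lbrakk>u \<in> {0..T}; v \<in> {0..T}; \<bar>u - v\<bar> \<le> d\<rbrakk> \<Longrightarrow> close e u v"
    using modulus[OF assms(2)] by metis
  have "(\<lambda>n. \<tau> * (1 / 2) ^ n) \<longlonglongrightarrow> \<tau> * 0" by (intro tendsto_intros LIMSEQ_power_zero) auto
  then have "\<forall>\<^sub>F n in sequentially. \<tau> * (1 / 2) ^ n < d" using d(1) by (intro order_tendstoD) auto
  then show ?thesis
  proof eventually_elim
    case (elim n)
    then have "\<tau> / real (2 ^ n) \<le> d" by (simp add: power_divide)
    then show ?case using d(2) by (meson order_trans)
  qed
qed

text \<open>As \<open>\<epsilon> - \<epsilon>\<^sup>2 = \<epsilon> * (1 - \<epsilon>)\<close>,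
  lowering the level changes the normalization only by the factor 1 - \<epsilon>.\<close>

lemma local_time_residual:
  assumes "0 < \<tau>" "\<tau> \<le> T"
  shows "((\<lambda>\<epsilon>. L \<tau> / 2 - measure lborel {s\<in>{0..\<tau>}. X s \<in> {0..<\<epsilon> - \<epsilon>\<^sup>2}} / (2 * \<epsilon>)) \<longlongrightarrow> 0) (at_right 0)"
proof -
  let ?m = "\<lambda>a. measure lborel {s\<in>{0..\<tau>}. X s \<in> {0..<a}}"
  have fl: "filterlim (\<lambda>\<epsilon>. \<epsilon> - \<epsilon>\<^sup>2) (at_right 0) (at_right (0::real))" by real_asymp
  have "((\<lambda>a. 1 / a * ?m a) \<longlongrightarrow> L \<tau>) (at_right 0)" using assms by (intro local_time) auto
  from filterlim_compose[OF this fl]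
  have "((\<lambda>\<epsilon>. 1 / (\<epsilon> - \<epsilon>\<^sup>2) * ?m (\<epsilon> - \<epsilon>\<^sup>2)) \<longlongrightarrow> L \<tau>) (at_right 0)" .
  then have "((\<lambda>\<epsilon>. L \<tau> / 2 - (1 / (\<epsilon> - \<epsilon>\<^sup>2) * ?m (\<epsilon> - \<epsilon>\<^sup>2)) * ((1 - \<epsilon>) / 2)) \<longlongrightarrow> L \<tau> / 2 - L \<tau> * ((1 - 0) / 2)) (at_right 0)"
    by (intro tendsto_intros) auto
  then have *: "((\<lambda>\<epsilon>. L \<tau> / 2 - (1 / (\<epsilon> - \<epsilon>\<^sup>2) * ?m (\<epsilon> - \<epsilon>\<^sup>2)) * ((1 - \<epsilon>) / 2)) \<longlongrightarrow> 0) (at_right 0)" by simp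
  have "\<forall>\<^sub>F \<epsilon> in at_right 0. L \<tau> / 2 - (1 / (\<epsilon> - \<epsilon>\<^sup>2) * ?m (\<epsilon> - \<epsilon>\<^sup>2)) * ((1 - \<epsilon>) / 2) = L \<tau> / 2 - ?m (\<epsilon> - \<epsilon>\<^sup>2) / (2 * \<epsilon>)"
  proof (rule eventually_at_rightI[of 0 1])
    fix \<epsilon> :: real assume e: "\<epsilon> \<in> {0<..<1}"
    have "(1 / (\<epsilon> - \<epsilon>\<^sup>2) * m) * ((1 - \<epsilon>) / 2) = m / (2 * \<epsilon>)" for m
    proof -
      have "\<epsilon> - \<epsilon>\<^sup>2 = \<epsilon> * (1 - \<epsilon>)" by (simp add: power2_eq_square algebra_simps)
      then show ?thesis using e by simp
    qed
    then show "L \<tau> / 2 - (1 / (\<epsilon> - \<epsilon>\<^sup>2) * ?m (\<epsilon> - \<epsilon>\<^sup>2)) * ((1 - \<epsilon>) / 2) = L \<tau> / 2 - ?m (\<epsilon> - \<epsilon>\<^sup>2) / (2 * \<epsilon>)" by simp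
  qed simp
  from Lim_transform_eventually[OF * this] show ?thesis .
qed

definition barrier_sum :: "real \<Rightarrow> real \<Rightarrow> nat \<Rightarrow> real" where
  "barrier_sum \<tau> \<epsilon> n = (\<Sum>i<2^n. hat \<epsilon> (X (grid \<tau> (2^n) i)) * (b (grid \<tau> (2^n) (Suc i)) - b (grid \<tau> (2^n) i)))"

definition noise_sum :: "real \<Rightarrow> real \<Rightarrow> nat \<Rightarrow> real" where
  "noise_sum \<tau> \<epsilon> n = (\<Sum>i<2^n. hat \<epsilon> (X (grid \<tau> (2^n) i)) * (B (grid \<tau> (2^n) (Suc i)) - B (grid \<tau> (2^n) i)))"

definition bracket_error :: "real \<Rightarrow> real \<Rightarrow> nat \<Rightarrow> real" where
  "bracket_error \<tau> \<epsilon> n = (\<Sum>i<2^n. indicator {..<\<epsilon> - \<epsilon>\<^sup>2 / 2} (X (grid \<tau> (2^n) i)) *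
     ((B (grid \<tau> (2^n) (Suc i)) - B (grid \<tau> (2^n) i))\<^sup>2 - \<tau> / real (2^n)))"

text \<open>Two errors of \<open>discrete_bound\<close> are divided by \<epsilon> but vanish with
  the mesh, so \<epsilon> is fixed first. The four errors receive a quarter of \<eta> each.\<close>

lemma barrier_sum_upper:
  assumes \<tau>: "0 < \<tau>" "\<tau> \<le> T" and \<eta>: "0 < \<eta>"
  shows "\<forall>\<^sub>F \<epsilon> in at_right 0. bracket_error \<tau> \<epsilon> \<longlonglongrightarrow> 0 \<longrightarrow>
    (\<forall>\<^sub>F n in sequentially. (1 - max 0 \<nu>) * barrier_sum \<tau> \<epsilon> n \<le> noise_sum \<tau> \<epsilon> n + \<eta>)"
proof -
  define C where "C = max 0 \<nu> * (5 * M \<tau> + b \<tau>) + 2 * (\<bar>\<nu>\<bar> * M \<tau> + L \<tau> + b \<tau>)"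
  let ?res = "\<lambda>\<epsilon>. L \<tau> / 2 - measure lborel {s\<in>{0..\<tau>}. X s \<in> {0..<\<epsilon> - \<epsilon>\<^sup>2}} / (2 * \<epsilon>)"
  have "\<forall>\<^sub>F \<epsilon> in at_right 0. ?res \<epsilon> < \<eta> / 4"
    using \<eta> by (intro order_tendstoD(2)[OF local_time_residual[OF \<tau>]]) auto
  moreover have "((\<lambda>\<epsilon>. (1 + max 0 \<nu>) * (\<epsilon> / 2)) \<longlongrightarrow> (1 + max 0 \<nu>) * (0 / 2)) (at_right 0)"
    by (intro tendsto_intros) auto
  then have "\<forall>\<^sub>F \<epsilon> in at_right 0. (1 + max 0 \<nu>) * (\<epsilon> / 2) < \<eta> / 4"
    using \<eta> by (intro order_tendstoD) auto
  moreover have "\<forall>\<^sub>F \<epsilon> in at_right (0::real). 0 < \<epsilon>" by (simp add: eventually_at_right_less)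
  ultimately show ?thesis
  proof (eventually_elim, intro impI)
    fix \<epsilon> :: real
    assume a: "?res \<epsilon> < \<eta> / 4" "(1 + max 0 \<nu>) * (\<epsilon> / 2) < \<eta> / 4" "0 < \<epsilon>" and q: "bracket_error \<tau> \<epsilon> \<longlonglongrightarrow> 0"
    \<comment> \<open>The first entry supplies the margin required by \<open>discrete_bound\<close>,
      the second makes \<open>e / \<epsilon> * C\<close> at most \<eta> / 4.\<close>
    define e where "e = min (\<epsilon>\<^sup>2 / 4) (\<epsilon> * (\<eta> / 4) / (\<bar>C\<bar> + 1))"
    have e: "0 < e" "4 * e \<le> \<epsilon>\<^sup>2" using a(3) \<eta> by (auto simp: e_def)
    have "e / \<epsilon> * C \<le> e / \<epsilon> * (\<bar>C\<bar> + 1)" using e a(3) by (intro mult_left_mono) auto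
    also have "\<dots> \<le> (\<epsilon> * (\<eta> / 4) / (\<bar>C\<bar> + 1)) / \<epsilon> * (\<bar>C\<bar> + 1)"
      using a(3) by (intro mult_right_mono divide_right_mono) (auto simp: e_def)
    also have "\<dots> = \<eta> / 4"
    proof -
      have "\<epsilon> * (\<eta> / 4) / k / \<epsilon> * k = \<eta> / 4" if "0 < k" for k using that a(3) by simp
      then show ?thesis by (smt (verit))
    qed
    finally have eC: "e / \<epsilon> * C \<le> \<eta> / 4" .
    have "(\<lambda>n. - bracket_error \<tau> \<epsilon> n / (2 * \<epsilon>)) \<longlonglongrightarrow> - 0 / (2 * \<epsilon>)" using a(3) by (intro tendsto_intros q) auto
    then have "\<forall>\<^sub>F n in sequentially. - bracket_error \<tau> \<epsilon> n / (2 * \<epsilon>) < \<eta> / 4"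
      using \<eta> by (intro order_tendstoD) auto
    with eventually_grid_modulus[OF \<tau>(1) e(1)]
    show "\<forall>\<^sub>F n in sequentially. (1 - max 0 \<nu>) * barrier_sum \<tau> \<epsilon> n \<le> noise_sum \<tau> \<epsilon> n + \<eta>"
    proof eventually_elim
      case (elim n)
      have "(1 - max 0 \<nu>) * barrier_sum \<tau> \<epsilon> n \<le> noise_sum \<tau> \<epsilon> n + L \<tau> / 2 + (1 + max 0 \<nu>) * (\<epsilon> / 2)
          + e / \<epsilon> * C - (measure lborel {s\<in>{0..\<tau>}. X s \<in> {0..<\<epsilon> - \<epsilon>\<^sup>2}} + bracket_error \<tau> \<epsilon> n) / (2 * \<epsilon>)"
        unfolding barrier_sum_def noise_sum_def bracket_error_def C_def
        by (rule discrete_bound[OF \<tau> _ a(3) less_imp_le[OF e(1)] e(2)]) (use elim in auto)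
      then show ?case using a(1,2) eC elim(2)
        unfolding add_divide_distrib minus_divide_left[symmetric] by linarith
    qed
  qed
qed

text \<open>If a cell contains a zero of \<open>X\<close> and the mesh is fine, then
  \<open>X \<le> \<epsilon> / 2\<close> at its left endpoint, where \<open>hat\<close> is at least
  1/2.\<close>

lemma barrier_sum_lower:
  assumes \<tau>: "0 < \<tau>" "\<tau> \<le> T" and \<epsilon>: "0 < \<epsilon>"
    and contact: "\<And>t. t \<in> {0..\<tau>} \<Longrightarrow> P t \<Longrightarrow> X t = 0"
    and c: "\<And>n. c \<le> (\<Sum>i | i < 2^n \<and> (\<exists>s\<in>{grid \<tau> (2^n) i..grid \<tau> (2^n) (Suc i)}. P s).
      b (grid \<tau> (2^n) (Suc i)) - b (grid \<tau> (2^n) i))"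
  shows "\<forall>\<^sub>F n in sequentially. c / 2 \<le> barrier_sum \<tau> \<epsilon> n"
proof -
  have "0 < \<epsilon> / 4" using \<epsilon> by simp
  from eventually_grid_modulus[OF \<tau>(1) this] show ?thesis
  proof eventually_elim
    case (elim n)
    let ?g = "grid \<tau> (2 ^ n)"
    let ?J = "{i. i < 2^n \<and> (\<exists>s\<in>{?g i..?g (Suc i)}. P s)}"
    have g: "?g i \<in> {0..\<tau>}" if "i \<le> 2 ^ n" for i
    proof -
      have "real i \<le> 2 ^ n" using that by (metis of_nat_le_iff of_nat_numeral of_nat_power)
      then have "?g i \<le> \<tau>" using \<tau> by (simp add: grid_def pos_divide_le_eq)
      then show ?thesis using \<tau> by (simp add: grid_def)
    qed
    have gs: "?g i \<le> ?g (Suc i)" "?g (Suc i) - ?g i = \<tau> / real (2 ^ n)" for i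
      using \<tau> by (auto simp: grid_def distrib_left add_divide_distrib)
    have db: "0 \<le> b (?g (Suc i)) - b (?g i)" if "i < 2 ^ n" for i
      using mono_onD[OF mono_b _ _ gs(1)[of i]] g[of i] g[of "Suc i"] that \<tau> by auto
    have h: "1 / 2 \<le> hat \<epsilon> (X (?g i))" if i: "i \<in> ?J" for i
    proof -
      obtain s where s: "s \<in> {?g i..?g (Suc i)}" "P s" "i < 2 ^ n" using i by auto
      have s': "s \<in> {0..\<tau>}" using s g[of i] g[of "Suc i"] by auto
      have "X s = 0" using contact[OF s'] s by auto
      have "\<bar>?g i - s\<bar> \<le> \<tau> / real (2 ^ n)" using s(1) gs[of i] by auto
      then have "\<bar>W (?g i) - W s\<bar> \<le> \<epsilon> / 4 \<and> \<bar>b (?g i) - b s\<bar> \<le> \<epsilon> / 4"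
        using elim[rule_format, of "?g i" s] g[of i] s s' \<tau> by auto
      then have "X (?g i) \<le> \<epsilon> / 2" using \<open>X s = 0\<close> by linarith
      then have "hat \<epsilon> (\<epsilon> / 2) \<le> hat \<epsilon> (X (?g i))" using \<epsilon> by (intro hat_antimono)
      then show ?thesis using \<epsilon> by (simp add: hat_def)
    qed
    have "c / 2 \<le> (\<Sum>i\<in>?J. b (?g (Suc i)) - b (?g i)) / 2" using c[of n] by simp
    also have "\<dots> = (\<Sum>i\<in>?J. 1 / 2 * (b (?g (Suc i)) - b (?g i)))"
      by (simp add: sum_divide_distrib)
    also have "\<dots> \<le> (\<Sum>i\<in>?J. hat \<epsilon> (X (?g i)) * (b (?g (Suc i)) - b (?g i)))"
      using h db by (intro sum_mono mult_right_mono) auto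
    also have "\<dots> \<le> barrier_sum \<tau> \<epsilon> n"
      unfolding barrier_sum_def using db hat_range by (intro sum_mono2) auto
    finally show ?case .
  qed
qed

text \<open>The two bounds on the barrier sum leave a positive margin for the noise that does not
  depend on the level. The number \<eta> is half of the lower bound
  \<open>(1 - max 0 \<nu>) * (c / 2)\<close>.\<close>

lemma noise_sum_lower:
  assumes \<tau>: "0 < \<tau>" "\<tau> \<le> T" and c: "0 < c"
    and contact: "\<And>t. t \<in> {0..\<tau>} \<Longrightarrow> P t \<Longrightarrow> X t = 0"
    and sums: "\<And>n. c \<le> (\<Sum>i | i < 2^n \<and> (\<exists>s\<in>{grid \<tau> (2^n) i..grid \<tau> (2^n) (Suc i)}. P s).
      b (grid \<tau> (2^n) (Suc i)) - b (grid \<tau> (2^n) i))"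
    and eps: "filterlim eps (at_right 0) sequentially"
    and bracket: "\<And>k. bracket_error \<tau> (eps k) \<longlonglongrightarrow> 0"
  shows "\<forall>\<^sub>F k in sequentially. \<forall>\<^sub>F n in sequentially. (1 - max 0 \<nu>) * c / 4 \<le> noise_sum \<tau> (eps k) n"
proof -
  define \<eta> where "\<eta> = (1 - max 0 \<nu>) * c / 4"
  have \<eta>: "0 < \<eta>" using c \<nu> by (simp add: \<eta>_def)
  have ev: "\<forall>\<^sub>F \<epsilon> in at_right 0. 0 < \<epsilon> \<and> (bracket_error \<tau> \<epsilon> \<longlonglongrightarrow> 0 \<longrightarrow>
    (\<forall>\<^sub>F n in sequentially. (1 - max 0 \<nu>) * barrier_sum \<tau> \<epsilon> n \<le> noise_sum \<tau> \<epsilon> n + \<eta>))"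
    by (intro eventually_conj eventually_at_right_less barrier_sum_upper[OF \<tau> \<eta>])
  from eventually_compose_filterlim[OF this eps]
  show ?thesis
  proof eventually_elim
    case (elim k)
    have "\<forall>\<^sub>F n in sequentially. c / 2 \<le> barrier_sum \<tau> (eps k) n"
      using elim by (intro barrier_sum_lower[OF \<tau> _ contact sums]) auto
    moreover have "\<forall>\<^sub>F n in sequentially. (1 - max 0 \<nu>) * barrier_sum \<tau> (eps k) n \<le> noise_sum \<tau> (eps k) n + \<eta>"
      using elim bracket by auto
    ultimately show ?case
    proof eventually_elim
      case (elim n)
      have "(1 - max 0 \<nu>) * (c / 2) \<le> (1 - max 0 \<nu>) * barrier_sum \<tau> (eps k) n"
        using elim(1) \<nu> by (intro mult_left_mono) auto
      moreover have "(1 - max 0 \<nu>) * (c / 2) = 2 * \<eta>" by (simp add: \<eta>_def)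
      ultimately have "\<eta> \<le> noise_sum \<tau> (eps k) n" using elim(2) by linarith
      then show ?case by (simp add: \<eta>_def)
    qed
  qed
qed

text \<open>The time spent in [0, 2 \<epsilon>) is about \<open>2 * \<epsilon> * L \<tau>\<close>;
  doubling the level absorbs the oscillation within a cell. The sum on the left is the one that
  governs the second moment of the noise.\<close>

lemma occupation_upper:
  assumes \<tau>: "0 < \<tau>" "\<tau> \<le> T"
  shows "\<forall>\<^sub>F \<epsilon> in at_right 0. \<forall>\<^sub>F n in sequentially.
    (\<Sum>i<2^n. (hat \<epsilon> (X (grid \<tau> (2^n) i)))\<^sup>2 * (\<tau> / real (2^n))) \<le> 2 * \<epsilon> * (L \<tau> + 1)"
proof -
  let ?m = "\<lambda>a. measure lborel {s\<in>{0..\<tau>}. X s \<in> {0..<a}}"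
  have fl: "filterlim (\<lambda>\<epsilon>. 2 * \<epsilon>) (at_right 0) (at_right (0::real))" by real_asymp
  have "((\<lambda>a. 1 / a * ?m a) \<longlongrightarrow> L \<tau>) (at_right 0)" using \<tau> by (intro local_time) auto
  from filterlim_compose[OF this fl]
  have "\<forall>\<^sub>F \<epsilon> in at_right 0. 1 / (2 * \<epsilon>) * ?m (2 * \<epsilon>) < L \<tau> + 1" by (rule order_tendstoD) auto
  moreover have "\<forall>\<^sub>F \<epsilon> in at_right (0::real). 0 < \<epsilon>" by (simp add: eventually_at_right_less)
  ultimately show ?thesis
  proof eventually_elim
    case (elim \<epsilon>)
    then have m: "?m (2 * \<epsilon>) \<le> 2 * \<epsilon> * (L \<tau> + 1)" by (simp add: field_simps)
    have "0 < \<epsilon> / 2" using elim by simp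
    from eventually_grid_modulus[OF \<tau>(1) this] show ?case
    proof eventually_elim
      case (elim n)
      have "(\<Sum>i<2^n. (hat \<epsilon> (X (grid \<tau> (2^n) i)))\<^sup>2 * (\<tau> / real (2^n)))
        \<le> (\<Sum>i<2^n. indicator {..<\<epsilon>} (X (grid \<tau> (2^n) i)) * (\<tau> / real (2^n)))"
      proof (intro sum_mono mult_right_mono)
        fix i
        show "(hat \<epsilon> (X (grid \<tau> (2^n) i)))\<^sup>2 \<le> indicator {..<\<epsilon>} (X (grid \<tau> (2^n) i))"
          using hat_range[of \<epsilon> "X (grid \<tau> (2^n) i)"] hat_zero[OF \<open>0 < \<epsilon>\<close>, of "X (grid \<tau> (2^n) i)"]
          by (auto simp: indicator_def power_le_one not_less)
      qed (use \<tau> in auto)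
      also have "\<dots> \<le> ?m (2 * \<epsilon>)"
      proof (rule cells_le_sublevel[OF \<tau>])
        fix s u assume "s \<in> {0..\<tau>}" "u \<in> {0..\<tau>}" "\<bar>s - u\<bar> \<le> \<tau> / real (2 ^ n)"
        then have "\<bar>W s - W u\<bar> \<le> \<epsilon> / 2 \<and> \<bar>b s - b u\<bar> \<le> \<epsilon> / 2" using elim \<tau> by auto
        then show "\<bar>X s - X u\<bar> \<le> 2 * \<epsilon> - \<epsilon>" by linarith
      qed simp
      finally show ?case using m by simp
    qed
  qed
qed

end

section \<open>Sums of Brownian increments along dyadic grids\<close>

text \<open>The series of the \<open>u n\<close> has finite expectation, hence is finite almost
  surely.\<close>

lemma AE_tendsto_0_of_summable:
  fixes u :: "nat \<Rightarrow> 'a \<Rightarrow> real"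
  assumes [measurable]: "\<And>n. u n \<in> borel_measurable M"
    and nonneg: "\<And>n x. 0 \<le> u n x"
    and le: "\<And>n. (\<integral>\<^sup>+x. ennreal (u n x) \<partial>M) \<le> ennreal (c n)" and c: "summable c" "\<And>n. 0 \<le> c n"
  shows "AE x in M. (\<lambda>n. u n x) \<longlonglongrightarrow> 0"
proof -
  have "(\<integral>\<^sup>+x. (\<Sum>n. ennreal (u n x)) \<partial>M) = (\<Sum>n. \<integral>\<^sup>+x. ennreal (u n x) \<partial>M)"
    by (intro nn_integral_suminf) auto
  also have "\<dots> \<le> (\<Sum>n. ennreal (c n))" by (intro suminf_le le) auto
  also have "\<dots> < \<infinity>" using c by (simp add: suminf_ennreal2)
  finally have "AE x in M. (\<Sum>n. ennreal (u n x)) \<noteq> \<infinity>" by (intro nn_integral_PInf_AE) auto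
  then show ?thesis
  proof eventually_elim
    case (elim x)
    then have "summable (\<lambda>n. u n x)" using nonneg by (intro summable_suminf_not_top) auto
    then show ?case by (rule summable_LIMSEQ_zero)
  qed
qed

context prob_space
begin

text \<open>The cross term has mean 0: \<open>S * Y\<close> is measurable for \<open>G\<close>,
  hence independent of the centred \<open>Z\<close>, and it is integrable since \<open>Y\<close> is
  bounded.\<close>

lemma square_integrable_add_indep:
  fixes S Y Z :: "'a \<Rightarrow> real"
  assumes G: "subalgebra M G" and [measurable]: "S \<in> borel_measurable G" "Y \<in> borel_measurable G"
    and Y: "\<And>x. \<bar>Y x\<bar> \<le> 1" and S: "integrable M (\<lambda>x. (S x)\<^sup>2)"
    and indep: "\<And>U. U \<in> borel_measurable G \<Longrightarrow> indep_var borel U borel Z"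
    and Z: "integrable M (\<lambda>x. (Z x)\<^sup>2)" "expectation Z = 0"
  shows "integrable M (\<lambda>x. (S x + Y x * Z x)\<^sup>2)"
    "expectation (\<lambda>x. (S x + Y x * Z x)\<^sup>2) = expectation (\<lambda>x. (S x)\<^sup>2) + expectation (\<lambda>x. (Y x)\<^sup>2) * expectation (\<lambda>x. (Z x)\<^sup>2)"
proof -
  have [measurable]: "Z \<in> borel_measurable M" using indep[of S] by (auto simp: indep_var_rv2)
  have [measurable]: "S \<in> borel_measurable M" "Y \<in> borel_measurable M"
    by (rule measurable_from_subalg[OF G], rule assms)+
  have Zi: "integrable M Z" using Z(1) by (rule square_integrable_imp_integrable[rotated]) measurable
  have Si: "integrable M S" using S by (rule square_integrable_imp_integrable[rotated]) measurable
  have SYi: "integrable M (\<lambda>x. S x * Y x)"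
    by (rule Bochner_Integration.integrable_bound[OF Si]) (auto simp: abs_mult Y intro!: mult_left_le)
  have YY: "integrable M (\<lambda>x. (Y x)\<^sup>2)"
    by (rule integrable_const_bound[where B=1]) (auto simp: Y abs_square_le_1)
  have iv1: "indep_var borel (\<lambda>x. S x * Y x) borel Z" by (intro indep) measurable
  have "indep_var borel (\<lambda>x. (Y x)\<^sup>2) borel Z" by (intro indep) measurable
  from indep_var_compose[OF this, of "\<lambda>x. x" borel "\<lambda>x. x\<^sup>2" borel]
  have iv2: "indep_var borel (\<lambda>x. (Y x)\<^sup>2) borel (\<lambda>x. (Z x)\<^sup>2)" by (simp add: comp_def)
  note i1 = indep_var_integrable[OF iv1 SYi Zi] and e1 = indep_var_lebesgue_integral[OF iv1 SYi Zi]
  note i2 = indep_var_integrable[OF iv2 YY Z(1)] and e2 = indep_var_lebesgue_integral[OF iv2 YY Z(1)]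
  have eq: "(\<lambda>x. (S x + Y x * Z x)\<^sup>2) = (\<lambda>x. (S x)\<^sup>2 + 2 * (S x * Y x * Z x) + (Y x)\<^sup>2 * (Z x)\<^sup>2)"
    by (auto simp: power2_eq_square algebra_simps)
  show "integrable M (\<lambda>x. (S x + Y x * Z x)\<^sup>2)"
    unfolding eq by (intro Bochner_Integration.integrable_add S i2 integrable_mult_right i1)
  show "expectation (\<lambda>x. (S x + Y x * Z x)\<^sup>2) = expectation (\<lambda>x. (S x)\<^sup>2) + expectation (\<lambda>x. (Y x)\<^sup>2) * expectation (\<lambda>x. (Z x)\<^sup>2)"
    unfolding eq using S i1 i2 e1 e2 Z(2) by simp
qed

text \<open>A discrete Ito isometry. The induction carries the measurability of the partial sum
  along, as each new increment must be independent of it.\<close>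

lemma orthogonal_increments:
  fixes Y Z :: "nat \<Rightarrow> 'a \<Rightarrow> real"
  assumes G: "\<And>i. i \<le> n \<Longrightarrow> subalgebra M (G i)" "\<And>i. i < n \<Longrightarrow> subalgebra (G (Suc i)) (G i)"
    and Y: "\<And>i. i < n \<Longrightarrow> Y i \<in> borel_measurable (G i)" "\<And>i x. \<bar>Y i x\<bar> \<le> 1"
    and Z: "\<And>i. i < n \<Longrightarrow> Z i \<in> borel_measurable (G (Suc i))"
      "\<And>i U. i < n \<Longrightarrow> U \<in> borel_measurable (G i) \<Longrightarrow> indep_var borel U borel (Z i)"
      "\<And>i. i < n \<Longrightarrow> integrable M (\<lambda>x. (Z i x)\<^sup>2)" "\<And>i. i < n \<Longrightarrow> expectation (Z i) = 0"
  shows "integrable M (\<lambda>x. (\<Sum>i<n. Y i x * Z i x)\<^sup>2) \<and>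
    expectation (\<lambda>x. (\<Sum>i<n. Y i x * Z i x)\<^sup>2) = (\<Sum>i<n. expectation (\<lambda>x. (Y i x)\<^sup>2) * expectation (\<lambda>x. (Z i x)\<^sup>2))"
proof -
  have "(\<lambda>x. \<Sum>i<k. Y i x * Z i x) \<in> borel_measurable (G k) \<and> integrable M (\<lambda>x. (\<Sum>i<k. Y i x * Z i x)\<^sup>2) \<and>
    expectation (\<lambda>x. (\<Sum>i<k. Y i x * Z i x)\<^sup>2) = (\<Sum>i<k. expectation (\<lambda>x. (Y i x)\<^sup>2) * expectation (\<lambda>x. (Z i x)\<^sup>2))"
    if "k \<le> n" for k
    using that
  proof (induction k)
    case 0
    then show ?case by simp
  next
    case (Suc k)
    then have k: "k < n" by simp
    note IH = Suc.IH[OF less_imp_le[OF k]]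
    note * = square_integrable_add_indep[OF G(1)[OF less_imp_le[OF k]], of "\<lambda>x. \<Sum>i<k. Y i x * Z i x" "Y k" "Z k"]
    have [measurable]: "(\<lambda>x. \<Sum>i<k. Y i x * Z i x) \<in> borel_measurable (G (Suc k))" "Y k \<in> borel_measurable (G (Suc k))"
      using measurable_from_subalg[OF G(2)[OF k]] IH Y(1)[OF k] by auto
    have [measurable]: "Z k \<in> borel_measurable (G (Suc k))" by (rule Z[OF k])
    have "(\<lambda>x. \<Sum>i<Suc k. Y i x * Z i x) \<in> borel_measurable (G (Suc k))" by simp
    then show ?case using * IH Y Z k by simp
  qed
  from this[of n] show ?thesis by auto
qed

text \<open>For each threshold and each \<open>N\<close>, the event that \<open>S n\<close> stays
  away from \<open>q\<close> from \<open>N\<close> on lies in events of arbitrarily small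
  probability. So \<open>q\<close> is almost surely a cluster point of a sequence that converges to
  \<open>t\<close>.\<close>

lemma AE_eq_of_limit_in_measure:
  fixes S :: "nat \<Rightarrow> 'a \<Rightarrow> real" and q :: "'a \<Rightarrow> real"
  assumes [measurable]: "\<And>n. S n \<in> borel_measurable M" "q \<in> borel_measurable M"
    and lim: "AE x in M. (\<lambda>n. S n x) \<longlonglongrightarrow> t"
    and prob: "\<And>\<eta> \<epsilon>. 0 < \<eta> \<Longrightarrow> 0 < \<epsilon> \<Longrightarrow> \<exists>N. \<forall>n\<ge>N. prob {x\<in>space M. \<eta> < \<bar>S n x - q x\<bar>} < \<epsilon>"
  shows "AE x in M. q x = t"
proof -
  have "AE x in M. \<not> (\<forall>n\<ge>N. 1 / real (Suc j) < \<bar>S n x - q x\<bar>)" for j N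
  proof -
    let ?A = "{x\<in>space M. \<forall>n\<ge>N. 1 / real (Suc j) < \<bar>S n x - q x\<bar>}"
    have "prob ?A \<le> 0"
    proof (rule field_le_epsilon)
      fix e :: real assume "0 < e"
      then obtain N' where N': "\<And>n. n \<ge> N' \<Longrightarrow> prob {x\<in>space M. 1 / real (Suc j) < \<bar>S n x - q x\<bar>} < e"
        using prob[of "1 / real (Suc j)" e] by auto
      have "prob ?A \<le> prob {x\<in>space M. 1 / real (Suc j) < \<bar>S (max N N') x - q x\<bar>}"
        by (intro finite_measure_mono) auto
      also have "\<dots> < e" by (intro N') simp
      finally show "prob ?A \<le> 0 + e" by simp
    qed
    then have "prob ?A = 0" using measure_nonneg[of M ?A] by linarith
    then have "emeasure M ?A = 0" by (simp add: emeasure_eq_measure)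
    then show ?thesis by (subst AE_iff_measurable[OF _ refl]) auto
  qed
  then have "AE x in M. \<forall>j N. \<not> (\<forall>n\<ge>N. 1 / real (Suc j) < \<bar>S n x - q x\<bar>)"
    by (auto simp: AE_all_countable)
  with lim show ?thesis
  proof eventually_elim
    case (elim x)
    show ?case
    proof (rule ccontr)
      assume "q x \<noteq> t"
      then obtain j where j: "1 / real (Suc j) < \<bar>t - q x\<bar>"
        using reals_Archimedean[of "\<bar>t - q x\<bar>"] by (auto simp: inverse_eq_divide)
      have "(\<lambda>n. \<bar>S n x - q x\<bar>) \<longlonglongrightarrow> \<bar>t - q x\<bar>" by (intro tendsto_intros elim)
      then have "\<forall>\<^sub>F n in sequentially. 1 / real (Suc j) < \<bar>S n x - q x\<bar>" using j by (rule order_tendstoD)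
      then show False using elim(2) by (auto simp: eventually_sequentially)
    qed
  qed
qed

end

section \<open>Moments of Brownian increments on grids\<close>

lemma grid_0: "grid \<tau> N 0 = 0"
  by (simp add: grid_def)

lemma grid_N: "0 < N \<Longrightarrow> grid \<tau> N N = \<tau>"
  by (simp add: grid_def)

lemma grid_mono: "0 \<le> \<tau> \<Longrightarrow> i \<le> j \<Longrightarrow> grid \<tau> N i \<le> grid \<tau> N j"
  by (auto simp: grid_def intro!: divide_right_mono mult_left_mono)

lemma grid_Suc: "grid \<tau> N (Suc i) - grid \<tau> N i = \<tau> / real N"
  by (simp add: grid_def distrib_left add_divide_distrib)

lemma grid_range: "0 \<le> \<tau> \<Longrightarrow> 0 < N \<Longrightarrow> i \<le> N \<Longrightarrow> grid \<tau> N i \<in> {0..\<tau>}"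
  using grid_mono[of \<tau> 0 i N] grid_mono[of \<tau> i N N] grid_N[of N \<tau>] grid_0[of \<tau> N] by simp

lemma grid_strict: "0 < \<tau> \<Longrightarrow> 0 < N \<Longrightarrow> grid \<tau> N i < grid \<tau> N (Suc i)"
  using grid_Suc[of \<tau> N i] by (smt (verit) divide_pos_pos of_nat_0_less_iff)

locale brownian_space = filtered_prob_space_usual M F
  for M :: "'a measure" and F :: "real \<Rightarrow> 'a measure" +
  fixes B :: "real \<Rightarrow> 'a \<Rightarrow> real"
  assumes brownian: "brownian_motion M F B"
begin

lemma B_adapted: "0 \<le> t \<Longrightarrow> B t \<in> borel_measurable (F t)"
  using brownian by (auto simp: brownian_motion_def)

lemma subalgebra_mono: "s \<le> t \<Longrightarrow> subalgebra (F t) (F s)"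
  using sets_F_mono[of s t] by (simp add: subalgebra_def space_F)

lemma B_measurable: "0 \<le> t \<Longrightarrow> B t \<in> borel_measurable M"
  using measurable_from_subalg[OF subalgebra_F B_adapted] .

text \<open>The function \<open>g\<close> covers both the increments and their centred
  squares.\<close>

lemma indep_increment:
  fixes U :: "'a \<Rightarrow> real" and g :: "real \<Rightarrow> real"
  assumes "0 \<le> s" "s < t" and U: "U \<in> borel_measurable (F s)" and [measurable]: "g \<in> borel_measurable borel"
  shows "indep_var borel U borel (\<lambda>\<omega>. g (B t \<omega> - B s \<omega>))"
proof -
  let ?D = "\<lambda>\<omega>. B t \<omega> - B s \<omega>"
  have [measurable]: "?D \<in> borel_measurable M"
    using B_measurable[of t] B_measurable[of s] assms by simp
  have i: "indep_set (sets (F s)) (sets (vimage_algebra (space M) ?D borel))"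
    using brownian assms by (auto simp: brownian_motion_def)
  have "indep_var borel U borel ?D"
    unfolding indep_var_eq
  proof (intro conjI)
    show "random_variable borel U" using measurable_from_subalg[OF subalgebra_F U] .
    show "indep_set (sigma_sets (space M) {U -` A \<inter> space M |A. A \<in> sets borel}) (sigma_sets (space M) {?D -` A \<inter> space M |A. A \<in> sets borel})"
      unfolding indep_set_def
    proof (rule indep_sets_mono_sets[OF i[unfolded indep_set_def]])
      fix x :: bool
      have "sigma_sets (space M) {U -` A \<inter> space M |A. A \<in> sets borel} \<subseteq> sets (F s)"
      proof -
        have "{U -` A \<inter> space M |A. A \<in> sets borel} \<subseteq> sets (F s)"
          using measurable_sets[OF U] by (auto simp: space_F)
        from sets.sigma_sets_subset[OF this] show ?thesis by (simp add: space_F)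
      qed
      moreover have "sigma_sets (space M) {?D -` A \<inter> space M |A. A \<in> sets borel} = sets (vimage_algebra (space M) ?D borel)"
        by (simp add: sets_vimage_algebra)
      ultimately show "case_bool (sigma_sets (space M) {U -` A \<inter> space M |A. A \<in> sets borel}) (sigma_sets (space M) {?D -` A \<inter> space M |A. A \<in> sets borel}) x
        \<subseteq> case_bool (sets (F s)) (sets (vimage_algebra (space M) ?D borel)) x"
        by (cases x) auto
    qed
  qed measurable
  from indep_var_compose[OF this, of "\<lambda>x. x" borel g borel] show ?thesis by (simp add: comp_def)
qed

lemma increment_moments:
  assumes "0 \<le> s" "s < t"
  shows "integrable M (\<lambda>\<omega>. (B t \<omega> - B s \<omega>) ^ k)"
    "expectation (\<lambda>\<omega>. (B t \<omega> - B s \<omega>) ^ (2 * k)) = fact (2 * k) / (2 ^ k * fact k) * (t - s) ^ k"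
    "expectation (\<lambda>\<omega>. B t \<omega> - B s \<omega>) = 0"
proof -
  let ?D = "\<lambda>\<omega>. B t \<omega> - B s \<omega>"
  have \<sigma>: "0 < sqrt (t - s)" using assms by simp
  have d: "distributed M lborel ?D (normal_density 0 (sqrt (t - s)))"
    using brownian assms by (auto simp: brownian_motion_def)
  show "integrable M (\<lambda>\<omega>. ?D \<omega> ^ k)"
    using distributed_integrable[OF d, of "\<lambda>x. x ^ k"] integrable_normal_moment[OF \<sigma>, of 0 k] by simp
  show "expectation (\<lambda>\<omega>. ?D \<omega> ^ (2 * k)) = fact (2 * k) / (2 ^ k * fact k) * (t - s) ^ k"
    using distributed_integral[OF d, of "\<lambda>x. x ^ (2 * k)"] integral_normal_moment_even[OF \<sigma>, of 0 k] assms
    by (simp add: power_divide)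
  show "expectation ?D = 0" using normal_distributed_expectation[OF \<sigma> d] .
qed

lemma centred_square_moments:
  assumes "0 \<le> s" "s < t"
  shows "integrable M (\<lambda>\<omega>. ((B t \<omega> - B s \<omega>)\<^sup>2 - (t - s))\<^sup>2)"
    "expectation (\<lambda>\<omega>. (B t \<omega> - B s \<omega>)\<^sup>2 - (t - s)) = 0"
    "expectation (\<lambda>\<omega>. ((B t \<omega> - B s \<omega>)\<^sup>2 - (t - s))\<^sup>2) = 2 * (t - s)\<^sup>2"
proof -
  let ?D = "\<lambda>\<omega>. B t \<omega> - B s \<omega>"
  note m = increment_moments[OF assms]
  have e2: "expectation (\<lambda>\<omega>. (?D \<omega>)\<^sup>2) = t - s" using m(2)[of 1] by (simp add: eval_nat_numeral)
  have e4: "expectation (\<lambda>\<omega>. ?D \<omega> ^ 4) = 3 * (t - s)\<^sup>2" using m(2)[of 2] by (simp add: eval_nat_numeral fact_numeral)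
  have eq: "(\<lambda>\<omega>. ((?D \<omega>)\<^sup>2 - (t - s))\<^sup>2) = (\<lambda>\<omega>. ?D \<omega> ^ 4 - 2 * (t - s) * (?D \<omega>)\<^sup>2 + (t - s)\<^sup>2)"
  proof
    have "(x\<^sup>2 - c)\<^sup>2 = x ^ 4 - 2 * c * x\<^sup>2 + c\<^sup>2" for x c :: real
      by (simp add: power2_eq_square power4_eq_xxxx algebra_simps)
    then show "((?D \<omega>)\<^sup>2 - (t - s))\<^sup>2 = ?D \<omega> ^ 4 - 2 * (t - s) * (?D \<omega>)\<^sup>2 + (t - s)\<^sup>2" for \<omega> .
  qed
  show "integrable M (\<lambda>\<omega>. ((?D \<omega>)\<^sup>2 - (t - s))\<^sup>2)" unfolding eq using m(1)[of 4] m(1)[of 2] by simp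
  show "expectation (\<lambda>\<omega>. (?D \<omega>)\<^sup>2 - (t - s)) = 0" using m(1)[of 2] e2 by (simp add: prob_space)
  show "expectation (\<lambda>\<omega>. ((?D \<omega>)\<^sup>2 - (t - s))\<^sup>2) = 2 * (t - s)\<^sup>2"
    unfolding eq using m(1)[of 4] m(1)[of 2] e2 e4 by (simp add: prob_space power2_eq_square)
qed

text \<open>The isometry, with the variances moved back under the integral: both sides become
  integrals of nonnegative functions, ready for Fatou's lemma.\<close>

lemma expectation_noise_square:
  assumes \<tau>: "0 < \<tau>" and N: "0 < N"
    and Y: "\<And>i. i < N \<Longrightarrow> Y i \<in> borel_measurable (F (grid \<tau> N i))" "\<And>i \<omega>. \<bar>Y i \<omega>\<bar> \<le> 1"
  shows "(\<integral>\<^sup>+\<omega>. ennreal ((\<Sum>i<N. Y i \<omega> * (B (grid \<tau> N (Suc i)) \<omega> - B (grid \<tau> N i) \<omega>))\<^sup>2) \<partial>M)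
    = (\<integral>\<^sup>+\<omega>. ennreal (\<Sum>i<N. (Y i \<omega>)\<^sup>2 * (\<tau> / real N)) \<partial>M)"
proof -
  let ?g = "grid \<tau> N"
  let ?D = "\<lambda>i \<omega>. B (?g (Suc i)) \<omega> - B (?g i) \<omega>"
  have g: "0 \<le> ?g i" "?g i < ?g (Suc i)" for i
    using grid_mono[of \<tau> 0 i N] grid_strict[OF \<tau> N] \<tau> by (auto simp: grid_0)
  have Dm: "?D i \<in> borel_measurable (F (?g (Suc i)))" for i
  proof -
    have "B (?g i) \<in> borel_measurable (F (?g (Suc i)))"
      using measurable_from_subalg[OF subalgebra_mono B_adapted] g[of i] by auto
    moreover have "B (?g (Suc i)) \<in> borel_measurable (F (?g (Suc i)))" using g(1)[of "Suc i"] by (rule B_adapted)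
    ultimately show ?thesis by simp
  qed
  have e2: "expectation (\<lambda>\<omega>. (?D i \<omega>)\<^sup>2) = \<tau> / real N" for i
    using increment_moments(2)[OF g, of i 1] by (simp add: grid_Suc eval_nat_numeral)
  have o1: "integrable M (\<lambda>x. (\<Sum>i<N. Y i x * ?D i x)\<^sup>2)"
    and o2: "expectation (\<lambda>x. (\<Sum>i<N. Y i x * ?D i x)\<^sup>2) = (\<Sum>i<N. expectation (\<lambda>x. (Y i x)\<^sup>2) * (\<tau> / real N))"
  proof -
    have "integrable M (\<lambda>x. (\<Sum>i<N. Y i x * ?D i x)\<^sup>2) \<and>
      expectation (\<lambda>x. (\<Sum>i<N. Y i x * ?D i x)\<^sup>2) = (\<Sum>i<N. expectation (\<lambda>x. (Y i x)\<^sup>2) * expectation (\<lambda>x. (?D i x)\<^sup>2))"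
    proof (rule orthogonal_increments[where G = "\<lambda>i. F (?g i)"])
      show "subalgebra M (F (?g i))" for i by (rule subalgebra_F)
      show "subalgebra (F (?g (Suc i))) (F (?g i))" for i by (intro subalgebra_mono less_imp_le g)
      show "indep_var borel U borel (?D i)" if "U \<in> borel_measurable (F (?g i))" for i U
        using indep_increment[OF g that, of "\<lambda>x. x"] by simp
      show "integrable M (\<lambda>x. (?D i x)\<^sup>2)" "expectation (?D i) = 0" for i
        by (rule increment_moments[OF g])+
    qed (rule Y Dm | assumption)+
    then show "integrable M (\<lambda>x. (\<Sum>i<N. Y i x * ?D i x)\<^sup>2)"
      "expectation (\<lambda>x. (\<Sum>i<N. Y i x * ?D i x)\<^sup>2) = (\<Sum>i<N. expectation (\<lambda>x. (Y i x)\<^sup>2) * (\<tau> / real N))"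
      unfolding e2 by blast+
  qed
  have Yi: "integrable M (\<lambda>x. (Y i x)\<^sup>2)" if "i < N" for i
    using measurable_from_subalg[OF subalgebra_F Y(1)[OF that]]
    by (intro integrable_const_bound[where B=1]) (auto simp: Y abs_square_le_1)
  have "(\<integral>\<^sup>+\<omega>. ennreal ((\<Sum>i<N. Y i \<omega> * ?D i \<omega>)\<^sup>2) \<partial>M) = ennreal (\<Sum>i<N. expectation (\<lambda>x. (Y i x)\<^sup>2) * (\<tau> / real N))"
    using o1 by (subst nn_integral_eq_integral) (auto simp: o2)
  also have "\<dots> = ennreal (expectation (\<lambda>\<omega>. \<Sum>i<N. (Y i \<omega>)\<^sup>2 * (\<tau> / real N)))"
    using Yi by (subst Bochner_Integration.integral_sum) auto
  also have "\<dots> = (\<integral>\<^sup>+\<omega>. ennreal (\<Sum>i<N. (Y i \<omega>)\<^sup>2 * (\<tau> / real N)) \<partial>M)"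
    using Yi \<tau> by (intro nn_integral_eq_integral[symmetric]) (auto intro!: sum_nonneg)
  finally show ?thesis .
qed

text \<open>By the Gaussian fourth moment the second moment is at most
  \<open>2 * \<tau>\<^sup>2 / 2 ^ n\<close>, summable along dyadic meshes. The weights
  \<open>Y\<close> allow a restriction to grid points at which \<open>X\<close> is small.\<close>

lemma AE_bracket_error:
  assumes \<tau>: "0 < \<tau>"
    and Y: "\<And>n i. i < 2 ^ n \<Longrightarrow> Y n i \<in> borel_measurable (F (grid \<tau> (2 ^ n) i))" "\<And>n i \<omega>. \<bar>Y n i \<omega>\<bar> \<le> 1"
  shows "AE \<omega> in M. (\<lambda>n. \<Sum>i<2^n. Y n i \<omega> * ((B (grid \<tau> (2^n) (Suc i)) \<omega> - B (grid \<tau> (2^n) i) \<omega>)\<^sup>2 - \<tau> / real (2^n))) \<longlonglongrightarrow> 0"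
proof -
  let ?g = "\<lambda>n. grid \<tau> (2 ^ n)"
  let ?D = "\<lambda>n i \<omega>. (B (?g n (Suc i)) \<omega> - B (?g n i) \<omega>)\<^sup>2 - \<tau> / real (2 ^ n)"
  let ?S = "\<lambda>n \<omega>. \<Sum>i<2^n. Y n i \<omega> * ?D n i \<omega>"
  have g: "0 \<le> ?g n i" "?g n i < ?g n (Suc i)" for n i
    using grid_mono[of \<tau> 0 i "2 ^ n"] grid_strict[OF \<tau>] \<tau> by (auto simp: grid_0)
  have Dm: "?D n i \<in> borel_measurable (F (?g n (Suc i)))" for n i
  proof -
    have "B (?g n i) \<in> borel_measurable (F (?g n (Suc i)))"
      using measurable_from_subalg[OF subalgebra_mono B_adapted] g[of n i] by auto
    moreover have "B (?g n (Suc i)) \<in> borel_measurable (F (?g n (Suc i)))" using g(1)[of n "Suc i"] by (rule B_adapted)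
    ultimately show ?thesis by simp
  qed
  have o: "integrable M (\<lambda>x. (?S n x)\<^sup>2) \<and>
    expectation (\<lambda>x. (?S n x)\<^sup>2) = (\<Sum>i<2^n. expectation (\<lambda>x. (Y n i x)\<^sup>2) * (2 * (\<tau> / real (2 ^ n))\<^sup>2))" for n
  proof -
    have "integrable M (\<lambda>x. (?S n x)\<^sup>2) \<and>
      expectation (\<lambda>x. (?S n x)\<^sup>2) = (\<Sum>i<2^n. expectation (\<lambda>x. (Y n i x)\<^sup>2) * expectation (\<lambda>x. (?D n i x)\<^sup>2))"
    proof (rule orthogonal_increments[where G = "\<lambda>i. F (?g n i)"])
      show "subalgebra M (F (?g n i))" for i by (rule subalgebra_F)
      show "subalgebra (F (?g n (Suc i))) (F (?g n i))" for i by (intro subalgebra_mono less_imp_le g)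
      show "indep_var borel U borel (?D n i)" if "U \<in> borel_measurable (F (?g n i))" for i U
        using indep_increment[OF g that, of "\<lambda>x. x\<^sup>2 - \<tau> / real (2 ^ n)"] by simp
      show "integrable M (\<lambda>x. (?D n i x)\<^sup>2)" "expectation (?D n i) = 0" for i
        by (rule centred_square_moments(1,2)[OF g[of n], unfolded grid_Suc])+
    qed (rule Y Dm | assumption)+
    then show ?thesis by (simp only: centred_square_moments(3)[OF g[of n], unfolded grid_Suc])
  qed
  have Ym: "i < 2 ^ n \<Longrightarrow> Y n i \<in> borel_measurable M" for n i
    using measurable_from_subalg[OF subalgebra_F Y(1)] by auto
  have Y2: "expectation (\<lambda>x. (Y n i x)\<^sup>2) \<le> 1" if "i < 2 ^ n" for n i
  proof -
    have "expectation (\<lambda>x. (Y n i x)\<^sup>2) \<le> expectation (\<lambda>x. 1)"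
      using Ym[OF that] by (intro integral_mono integrable_const_bound[where B=1]) (auto simp: Y abs_square_le_1)
    then show ?thesis by (simp add: prob_space)
  qed
  have "AE \<omega> in M. (\<lambda>n. (?S n \<omega>)\<^sup>2) \<longlonglongrightarrow> 0"
  proof (rule AE_tendsto_0_of_summable)
    show "(\<lambda>\<omega>. (?S n \<omega>)\<^sup>2) \<in> borel_measurable M" for n
      using Ym measurable_from_subalg[OF subalgebra_F Dm] by (intro borel_measurable_power borel_measurable_sum borel_measurable_times) auto
    show "(\<integral>\<^sup>+x. ennreal ((?S n x)\<^sup>2) \<partial>M) \<le> ennreal (2 * \<tau>\<^sup>2 * (1 / 2) ^ n)" for n
    proof -
      have "(\<integral>\<^sup>+x. ennreal ((?S n x)\<^sup>2) \<partial>M) = ennreal (\<Sum>i<2^n. expectation (\<lambda>x. (Y n i x)\<^sup>2) * (2 * (\<tau> / real (2 ^ n))\<^sup>2))"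
        using o[of n] by (subst nn_integral_eq_integral) auto
      also have "\<dots> \<le> ennreal (\<Sum>i<(2::nat)^n. 1 * (2 * (\<tau> / real (2 ^ n))\<^sup>2))"
        using Y2 by (intro ennreal_leI sum_mono mult_right_mono) auto
      also have "(\<Sum>i<(2::nat)^n. 1 * (2 * (\<tau> / real (2 ^ n))\<^sup>2)) = 2 * \<tau>\<^sup>2 * (1 / 2) ^ n"
        by (simp add: power_divide power2_eq_square)
      finally show ?thesis .
    qed
    show "summable (\<lambda>n. 2 * \<tau>\<^sup>2 * (1 / 2) ^ n)" by (intro summable_mult summable_geometric) auto
  qed auto
  then show ?thesis
    by eventually_elim simp
qed

text \<open>The noise is bounded through Fatou: the iterated lower limit of its squares has
  expectation at most the iterated upper limit of
  \<open>\<integral>\<^sup>+\<omega>. D k n \<omega> \<partial>M\<close>. As \<open>D\<close> is at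
  most \<tau>, the reverse Fatou lemma passes to the pointwise upper limit, which is 0 by
  \<open>small\<close>. A limit of the noise itself need not exist.\<close>

lemma AE_noise_not_bounded_below:
  assumes \<tau>: "0 < \<tau>"
    and Y: "\<And>k n i. i < 2 ^ n \<Longrightarrow> Y k n i \<in> borel_measurable (F (grid \<tau> (2 ^ n) i))" "\<And>k n i \<omega>. \<bar>Y k n i \<omega>\<bar> \<le> 1"
    and small: "AE \<omega> in M. \<forall>\<delta>>0. \<forall>\<^sub>F k in sequentially. \<forall>\<^sub>F n in sequentially. (\<Sum>i<2^n. (Y k n i \<omega>)\<^sup>2 * (\<tau> / real (2^n))) \<le> \<delta>"
  shows "AE \<omega> in M. \<forall>\<eta>>0. \<not> (\<forall>\<^sub>F k in sequentially. \<forall>\<^sub>F n in sequentially.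
    \<eta> \<le> (\<Sum>i<2^n. Y k n i \<omega> * (B (grid \<tau> (2^n) (Suc i)) \<omega> - B (grid \<tau> (2^n) i) \<omega>)))"
proof -
  let ?g = "\<lambda>n. grid \<tau> (2 ^ n)"
  define S where "S k n \<omega> = (\<Sum>i<2^n. Y k n i \<omega> * (B (?g n (Suc i)) \<omega> - B (?g n i) \<omega>))" for k n \<omega>
  define U where "U k n \<omega> = ennreal ((S k n \<omega>)\<^sup>2)" for k n \<omega>
  define D where "D k n \<omega> = ennreal (\<Sum>i<2^n. (Y k n i \<omega>)\<^sup>2 * (\<tau> / real (2^n)))" for k n \<omega>
  have g: "0 \<le> ?g n i" for n i using grid_mono[of \<tau> 0 i "2 ^ n"] \<tau> by (simp add: grid_0)
  have Ym: "Y k n i \<in> borel_measurable M" if "i < 2 ^ n" for k n i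
    using measurable_from_subalg[OF subalgebra_F Y(1)[OF that]] .
  have [measurable]: "S k n \<in> borel_measurable M" for k n
    unfolding S_def using Ym B_measurable[OF g] by (intro borel_measurable_sum borel_measurable_times borel_measurable_diff) auto
  have [measurable]: "U k n \<in> borel_measurable M" for k n unfolding U_def by measurable
  have [measurable]: "D k n \<in> borel_measurable M" for k n
    unfolding D_def using Ym by (intro measurable_compose[OF _ measurable_ennreal] borel_measurable_sum borel_measurable_times borel_measurable_power) auto
  have D_le: "D k n \<omega> \<le> ennreal \<tau>" for k n \<omega>
  proof -
    have "(\<Sum>i<2^n. (Y k n i \<omega>)\<^sup>2 * (\<tau> / real (2^n))) \<le> (\<Sum>i<(2::nat)^n. 1 * (\<tau> / real (2^n)))"
      using Y(2) \<tau> by (intro sum_mono mult_right_mono) (auto simp: abs_square_le_1)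
    then show ?thesis unfolding D_def by (intro ennreal_leI) simp
  qed
  have UD: "(\<integral>\<^sup>+\<omega>. U k n \<omega> \<partial>M) = (\<integral>\<^sup>+\<omega>. D k n \<omega> \<partial>M)" for k n
    unfolding U_def D_def S_def by (rule expectation_noise_square[OF \<tau> _ Y]) auto
  have fin: "(\<integral>\<^sup>+\<omega>. ennreal \<tau> \<partial>M) < \<infinity>" by (simp add: emeasure_space_1)
  have "AE \<omega> in M. limsup (\<lambda>k. limsup (\<lambda>n. D k n \<omega>)) = 0"
    using small
  proof eventually_elim
    case (elim \<omega>)
    have "limsup (\<lambda>k. limsup (\<lambda>n. D k n \<omega>)) \<le> 0"
    proof (rule ennreal_le_epsilon)
      fix \<delta> :: real assume "0 < \<delta>"
      then have "\<forall>\<^sub>F k in sequentially. \<forall>\<^sub>F n in sequentially. D k n \<omega> \<le> ennreal \<delta>"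
        using elim unfolding D_def by (auto elim!: eventually_mono intro: ennreal_leI)
      then have "\<forall>\<^sub>F k in sequentially. limsup (\<lambda>n. D k n \<omega>) \<le> ennreal \<delta>"
        by (rule eventually_mono) (rule Limsup_bounded)
      then show "limsup (\<lambda>k. limsup (\<lambda>n. D k n \<omega>)) \<le> 0 + ennreal \<delta>" by (simp add: Limsup_bounded)
    qed
    then show ?case by simp
  qed
  then have "(\<integral>\<^sup>+\<omega>. limsup (\<lambda>k. limsup (\<lambda>n. D k n \<omega>)) \<partial>M) = 0" by (subst nn_integral_0_iff_AE) auto
  moreover have "limsup (\<lambda>k. \<integral>\<^sup>+\<omega>. limsup (\<lambda>n. D k n \<omega>) \<partial>M) \<le> (\<integral>\<^sup>+\<omega>. limsup (\<lambda>k. limsup (\<lambda>n. D k n \<omega>)) \<partial>M)"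
    using D_le by (intro nn_integral_limsup[OF _ _ _ fin]) (auto intro!: AE_I2 Limsup_bounded)
  moreover have "limsup (\<lambda>n. \<integral>\<^sup>+\<omega>. D k n \<omega> \<partial>M) \<le> (\<integral>\<^sup>+\<omega>. limsup (\<lambda>n. D k n \<omega>) \<partial>M)" for k
    using D_le by (intro nn_integral_limsup[OF _ _ _ fin]) auto
  then have "limsup (\<lambda>k. limsup (\<lambda>n. \<integral>\<^sup>+\<omega>. D k n \<omega> \<partial>M)) \<le> limsup (\<lambda>k. \<integral>\<^sup>+\<omega>. limsup (\<lambda>n. D k n \<omega>) \<partial>M)"
    by (intro Limsup_mono) auto
  ultimately have lim0: "limsup (\<lambda>k. limsup (\<lambda>n. \<integral>\<^sup>+\<omega>. D k n \<omega> \<partial>M)) \<le> 0" by auto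
  have "(\<integral>\<^sup>+\<omega>. liminf (\<lambda>k. liminf (\<lambda>n. U k n \<omega>)) \<partial>M) \<le> liminf (\<lambda>k. \<integral>\<^sup>+\<omega>. liminf (\<lambda>n. U k n \<omega>) \<partial>M)"
    by (intro nn_integral_liminf) measurable
  also have "\<dots> \<le> liminf (\<lambda>k. liminf (\<lambda>n. \<integral>\<^sup>+\<omega>. U k n \<omega> \<partial>M))"
    by (intro Liminf_mono always_eventually allI nn_integral_liminf) measurable
  also have "\<dots> \<le> limsup (\<lambda>k. liminf (\<lambda>n. \<integral>\<^sup>+\<omega>. U k n \<omega> \<partial>M))"
    by (rule Liminf_le_Limsup) simp
  also have "\<dots> \<le> limsup (\<lambda>k. limsup (\<lambda>n. \<integral>\<^sup>+\<omega>. U k n \<omega> \<partial>M))"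
    by (intro Limsup_mono always_eventually allI Liminf_le_Limsup) simp
  finally have "(\<integral>\<^sup>+\<omega>. liminf (\<lambda>k. liminf (\<lambda>n. U k n \<omega>)) \<partial>M) = 0" using lim0 by (simp add: UD)
  then have "AE \<omega> in M. liminf (\<lambda>k. liminf (\<lambda>n. U k n \<omega>)) = 0" by (subst (asm) nn_integral_0_iff_AE) auto
  then show ?thesis
  proof eventually_elim
    case (elim \<omega>)
    show ?case
    proof (intro allI impI notI)
      fix \<eta> :: real assume \<eta>: "0 < \<eta>"
      assume "\<forall>\<^sub>F k in sequentially. \<forall>\<^sub>F n in sequentially.
        \<eta> \<le> (\<Sum>i<2^n. Y k n i \<omega> * (B (?g n (Suc i)) \<omega> - B (?g n i) \<omega>))"
      then have "\<forall>\<^sub>F k in sequentially. \<forall>\<^sub>F n in sequentially. ennreal (\<eta>\<^sup>2) \<le> U k n \<omega>"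
        unfolding U_def S_def using \<eta> by (auto elim!: eventually_mono intro!: ennreal_leI power_mono)
      then have "\<forall>\<^sub>F k in sequentially. ennreal (\<eta>\<^sup>2) \<le> liminf (\<lambda>n. U k n \<omega>)"
        by (rule eventually_mono) (rule Liminf_bounded)
      then have "ennreal (\<eta>\<^sup>2) \<le> liminf (\<lambda>k. liminf (\<lambda>n. U k n \<omega>))" by (rule Liminf_bounded)
      then show False using elim \<eta> by simp
    qed
  qed
qed

section \<open>Hoelder continuity of Brownian paths\<close>

lemma AE_dyadic_increments:
  assumes \<beta>: "0 < \<beta>" "\<beta> < 1 / 2"
  shows "AE \<omega> in M. \<exists>N. \<forall>n\<ge>N. \<forall>i<2^n. \<bar>B (grid 1 (2^n) (Suc i)) \<omega> - B (grid 1 (2^n) i) \<omega>\<bar> \<le> (2 powr - \<beta>) ^ n"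
proof -
  \<comment> \<open>There are \<open>2 ^ n\<close> increments, each with moment of order
    \<open>2 * k\<close> proportional to \<open>2 powr (- n * k)\<close>, and they are compared with
    \<open>2 powr (- 2 * k * \<beta> * n)\<close>. The quotient is summable in \<open>n\<close> once
    \<open>k * (1 - 2 * \<beta>) > 1\<close>.\<close>
  obtain k :: nat where k: "1 < real k * (1 - 2 * \<beta>)" using ex_less_of_nat_mult[of "1 - 2 * \<beta>" 1] \<beta> by auto
  have k0: "0 < k" using k by (cases k) auto
  let ?g = "\<lambda>n. grid 1 (2 ^ n)"
  let ?D = "\<lambda>n i \<omega>. B (?g n (Suc i)) \<omega> - B (?g n i) \<omega>"
  define q where "q = 2 powr - \<beta>"
  have q: "0 < q" by (simp add: q_def)
  define c where "c = (fact (2 * k) / (2 ^ k * fact k) :: real)"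
  define \<rho> where "\<rho> = 2 powr (1 - real k * (1 - 2 * \<beta>))"
  have "\<rho> < 2 powr 0" unfolding \<rho>_def using k by (intro powr_less_mono) auto
  then have \<rho>: "0 \<le> \<rho>" "\<rho> < 1" by (auto simp: \<rho>_def)
  have \<rho>q: "2 * (1 / 2) ^ k / q ^ (2 * k) = \<rho>"
  proof -
    have "q ^ (2 * k) = q powr real (2 * k)" using q by (simp only: powr_realpow)
    also have "\<dots> = 2 powr (- (2 * real k * \<beta>))" unfolding q_def powr_powr by (simp add: mult_ac)
    finally have "q ^ (2 * k) = 2 powr (- (2 * real k * \<beta>))" .
    moreover have "(1 / 2) ^ k = 2 powr (- real k)" by (simp add: powr_minus powr_realpow power_divide inverse_eq_divide)
    ultimately have "2 * (1 / 2) ^ k / q ^ (2 * k) = 2 powr 1 * 2 powr (- real k) / 2 powr (- (2 * real k * \<beta>))" by simp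
    also have "\<dots> = 2 powr (1 + - real k - - (2 * real k * \<beta>))" by (simp only: powr_add powr_diff)
    also have "1 + - real k - - (2 * real k * \<beta>) = 1 - real k * (1 - 2 * \<beta>)" by (simp add: algebra_simps)
    finally show ?thesis by (simp add: \<rho>_def)
  qed
  have g: "0 \<le> ?g n i" "?g n i < ?g n (Suc i)" for n i
    using grid_mono[of 1 0 i "2 ^ n"] grid_strict[of 1 "2 ^ n" i] by (auto simp: grid_0)
  have Dm: "?D n i \<in> borel_measurable M" for n i
    by (intro borel_measurable_diff B_measurable g)
  define u where "u n \<omega> = (\<Sum>i<2^n. ?D n i \<omega> ^ (2 * k)) / (q ^ (2 * k)) ^ n" for n \<omega>
  have ev: "0 \<le> ?D n i \<omega> ^ (2 * k)" for n i \<omega> by (simp add: power_mult)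
  have "AE \<omega> in M. (\<lambda>n. u n \<omega>) \<longlonglongrightarrow> 0"
  proof (rule AE_tendsto_0_of_summable)
    show "u n \<in> borel_measurable M" for n
      unfolding u_def using Dm by (intro borel_measurable_divide borel_measurable_sum borel_measurable_power) auto
    show "0 \<le> u n \<omega>" for n \<omega> using ev q by (auto simp: u_def intro!: divide_nonneg_nonneg sum_nonneg)
    show "(\<integral>\<^sup>+\<omega>. ennreal (u n \<omega>) \<partial>M) \<le> ennreal (c * \<rho> ^ n)" for n
    proof -
      have i: "integrable M (\<lambda>\<omega>. ?D n i \<omega> ^ (2 * k))" for i by (rule increment_moments(1)[OF g])
      have "(\<integral>\<^sup>+\<omega>. ennreal (u n \<omega>) \<partial>M) = ennreal (expectation (u n))"
        unfolding u_def using i ev q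
        by (intro nn_integral_eq_integral AE_I2 divide_nonneg_nonneg sum_nonneg) auto
      also have "expectation (u n) = (\<Sum>i<2^n. expectation (\<lambda>\<omega>. ?D n i \<omega> ^ (2 * k))) / (q ^ (2 * k)) ^ n"
        unfolding u_def using i by (simp add: Bochner_Integration.integral_sum)
      also have "(\<Sum>i<2^n. expectation (\<lambda>\<omega>. ?D n i \<omega> ^ (2 * k))) = (\<Sum>i<(2::nat)^n. c * (1 / real (2 ^ n)) ^ k)"
        using increment_moments(2)[OF g, of n _ k] unfolding grid_Suc c_def by (intro sum.cong) auto
      also have "\<dots> / (q ^ (2 * k)) ^ n = c * (2 ^ n * (1 / 2 ^ n) ^ k / (q ^ (2 * k)) ^ n)" by simp
      also have "2 ^ n * (1 / 2 ^ n) ^ k / (q ^ (2 * k)) ^ n = \<rho> ^ n"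
        unfolding \<rho>q[symmetric] by (simp add: power_mult_distrib power_divide power_mult[symmetric] mult.commute)
      finally show ?thesis by simp
    qed
    show "summable (\<lambda>n. c * \<rho> ^ n)" using \<rho> by (intro summable_mult summable_geometric) auto
    show "0 \<le> c * \<rho> ^ n" for n using \<rho> by (simp add: c_def)
  qed
  then show ?thesis
  proof eventually_elim
    case (elim \<omega>)
    then have "\<forall>\<^sub>F n in sequentially. u n \<omega> < 1" by (rule order_tendstoD) simp
    then obtain N where N: "\<And>n. N \<le> n \<Longrightarrow> u n \<omega> < 1" by (auto simp: eventually_sequentially)
    show ?case
    proof (intro exI[of _ N] allI impI)
      fix n i :: nat assume n: "N \<le> n" and i: "i < 2 ^ n"
      have "\<bar>?D n i \<omega>\<bar> ^ (2 * k) = ?D n i \<omega> ^ (2 * k)" by (simp add: power_mult)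
      also have "\<dots> \<le> (\<Sum>i<2^n. ?D n i \<omega> ^ (2 * k))"
        using i ev by (intro member_le_sum) auto
      also have "\<dots> \<le> (q ^ (2 * k)) ^ n"
        using N[OF n] q by (simp add: u_def pos_divide_less_eq)
      also have "\<dots> = (q ^ n) ^ (2 * k)" by (simp add: power_mult[symmetric] mult.commute)
      finally have "\<bar>?D n i \<omega>\<bar> \<le> q ^ n" using q k0 by (subst (asm) power_mono_iff) auto
      then show "\<bar>?D n i \<omega>\<bar> \<le> (2 powr - \<beta>) ^ n" by (simp add: q_def)
    qed
  qed
qed

end

text \<open>Chaining through the dyadic approximations \<open>a n x\<close> from below. Increments
  are controlled from level \<open>N\<close> on only, so two points must be within
  \<open>1 / 2 ^ N\<close>; the short interval ensures this and keeps them below 1.\<close>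

lemma holder_of_dyadic_increments:
  fixes f :: "real \<Rightarrow> real"
  assumes cont: "continuous_on {0..1} f" and \<beta>: "0 < \<beta>"
    and inc: "\<And>n i. N \<le> n \<Longrightarrow> i < 2 ^ n \<Longrightarrow> \<bar>f (grid 1 (2^n) (Suc i)) - f (grid 1 (2^n) i)\<bar> \<le> (2 powr - \<beta>) ^ n"
  obtains C where "0 < C" "\<And>s u. s \<in> {0..1 / 2 ^ Suc N} \<Longrightarrow> u \<in> {0..1 / 2 ^ Suc N} \<Longrightarrow> \<bar>f s - f u\<bar> \<le> C * \<bar>s - u\<bar> powr \<beta>"
proof -
  define q where "q = 2 powr - \<beta>"
  have "q < 2 powr 0" unfolding q_def using \<beta> by (intro powr_less_mono) auto
  then have q: "0 < q" "q < 1" by (auto simp: q_def)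
  define k where "k n x = nat \<lfloor>2 ^ n * x\<rfloor>" for n and x :: real
  define a where "a n x = grid 1 (2 ^ n) (k n x)" for n x
  have k: "real (k n x) \<le> 2 ^ n * x" "2 ^ n * x < real (k n x) + 1" if "0 \<le> x" for n x
  proof -
    have "0 \<le> 2 ^ n * x" using that by simp
    then show "real (k n x) \<le> 2 ^ n * x" "2 ^ n * x < real (k n x) + 1" unfolding k_def by linarith+
  qed
  have kl: "k n x < 2 ^ n" if "0 \<le> x" "x < 1" for n x
  proof -
    have "2 ^ n * x < 2 ^ n" using that by simp
    then have "real (k n x) < 2 ^ n" using k[OF that(1), of n] by linarith
    then show ?thesis by (metis of_nat_less_numeral_power_cancel_iff)
  qed
  have step: "\<bar>f (a (Suc n) x) - f (a n x)\<bar> \<le> q ^ Suc n" if x: "0 \<le> x" "x < 1" and n: "N \<le> n" for n x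
  proof -
    have e: "2 ^ Suc n * x = 2 * (2 ^ n * x)" by simp
    have "real (k (Suc n) x) < 2 * real (k n x) + 2" "2 * real (k n x) < real (k (Suc n) x) + 1"
      using k[OF x(1), of n] k[OF x(1), of "Suc n"] unfolding e by linarith+
    then have "k (Suc n) x = 2 * k n x \<or> k (Suc n) x = Suc (2 * k n x)" by linarith
    moreover have an: "a n x = grid 1 (2 ^ Suc n) (2 * k n x)" by (simp add: a_def grid_def)
    moreover have "\<bar>f (grid 1 (2 ^ Suc n) (Suc (2 * k n x))) - f (grid 1 (2 ^ Suc n) (2 * k n x))\<bar> \<le> q ^ Suc n"
      unfolding q_def using kl[OF x, of n] n by (intro inc) auto
    ultimately show ?thesis using q by (auto simp: a_def)
  qed
  \<comment> \<open>The bound is the exact partial geometric sum, so that the induction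
    closes.\<close>
  have fin: "\<bar>f (a (n + m) x) - f (a n x)\<bar> \<le> (q ^ Suc n - q ^ Suc (n + m)) / (1 - q)"
    if x: "0 \<le> x" "x < 1" and n: "N \<le> n" for n m x
  proof (induction m)
    case (Suc m)
    have "\<bar>f (a (Suc (n + m)) x) - f (a (n + m) x)\<bar> \<le> q ^ Suc (n + m)" using n by (intro step[OF x]) auto
    moreover have "q ^ Suc (n + m) = (q ^ Suc (n + m) - q ^ Suc (Suc (n + m))) / (1 - q)"
      using q by (simp add: field_simps)
    ultimately show ?case using Suc by (simp add: diff_divide_distrib)
  qed simp
  have tail: "\<bar>f x - f (a n x)\<bar> \<le> q ^ n / (1 - q)" if x: "0 \<le> x" "x < 1" and n: "N \<le> n" for n x
  proof -
    have b: "x - (1 / 2) ^ m \<le> a m x" "a m x \<le> x" for m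
    proof -
      have "x \<le> (real (k m x) + 1) / 2 ^ m" "real (k m x) / 2 ^ m \<le> x"
        using k[OF x(1), of m] by (auto simp: pos_le_divide_eq pos_divide_le_eq mult.commute)
      then show "x - (1 / 2) ^ m \<le> a m x" "a m x \<le> x"
        by (auto simp: a_def grid_def add_divide_distrib power_divide)
    qed
    have "(\<lambda>m. x - (1 / 2) ^ m) \<longlonglongrightarrow> x - 0" by (intro tendsto_intros LIMSEQ_power_zero) auto
    then have "(\<lambda>m. x - (1 / 2) ^ m) \<longlonglongrightarrow> x" by simp
    then have "(\<lambda>m. a m x) \<longlonglongrightarrow> x"
      by (rule tendsto_sandwich[OF _ _ _ tendsto_const, rotated 2]) (simp_all add: b)
    moreover have "a m x \<in> {0..1}" for m
    proof -
      have "0 \<le> a m x" by (simp add: a_def grid_def)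
      then show ?thesis using b(2)[of m] x by auto
    qed
    ultimately have "(\<lambda>m. f (a m x)) \<longlonglongrightarrow> f x"
      using x by (intro continuous_on_tendsto_compose[OF cont]) auto
    then have "(\<lambda>m. f (a (n + m) x)) \<longlonglongrightarrow> f x" by (subst add.commute) (rule LIMSEQ_ignore_initial_segment)
    then have lim: "(\<lambda>m. \<bar>f (a (n + m) x) - f (a n x)\<bar>) \<longlonglongrightarrow> \<bar>f x - f (a n x)\<bar>" by (intro tendsto_intros)
    show ?thesis
    proof (rule LIMSEQ_le_const2[OF lim], intro exI allI impI)
      fix m
      have "\<bar>f (a (n + m) x) - f (a n x)\<bar> \<le> (q ^ Suc n - q ^ Suc (n + m)) / (1 - q)" by (rule fin[OF x n])
      also have "\<dots> \<le> q ^ n / (1 - q)"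
      proof (intro divide_right_mono)
        have "q ^ Suc n \<le> q ^ n" using q by (intro power_decreasing) auto
        moreover have "0 \<le> q ^ Suc (n + m)" using q by simp
        ultimately show "q ^ Suc n - q ^ Suc (n + m) \<le> q ^ n" by linarith
      qed (use q in simp)
      finally show "\<bar>f (a (n + m) x) - f (a n x)\<bar> \<le> q ^ n / (1 - q)" .
    qed
  qed
  define C where "C = (1 + 2 / (1 - q)) * 2 powr \<beta>"
  have C: "0 < C" using q by (auto simp: C_def intro!: mult_pos_pos add_pos_pos)
  have main: "\<bar>f s - f u\<bar> \<le> C * (u - s) powr \<beta>" if s: "0 \<le> s" "s < u" "u < 1" "u - s \<le> 1 / 2 ^ N" for s u
  proof -
    define d where "d = u - s"
    have d: "0 < d" "d \<le> 1 / 2 ^ N" using s by (auto simp: d_def)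
    \<comment> \<open>The level whose mesh is comparable to the distance:
      \<open>d \<le> 1 / 2 ^ n < 2 * d\<close>. At this level the approximations of \<open>s\<close>
      and \<open>u\<close> are equal or adjacent.\<close>
    define n where "n = nat \<lfloor>log 2 (1 / d)\<rfloor>"
    have "2 powr real N \<le> 1 / d" using d by (simp add: powr_realpow field_simps)
    then have "real N \<le> log 2 (1 / d)" using d by (simp add: le_log_iff)
    then have n: "N \<le> n" "real n \<le> log 2 (1 / d)" "log 2 (1 / d) < real n + 1"
      unfolding n_def by linarith+
    have "2 powr real n \<le> 1 / d" using n(2) d by (simp add: le_log_iff)
    then have dn: "2 ^ n * d \<le> 1" using d by (simp add: powr_realpow field_simps)
    have "1 / d < 2 powr (real n + 1)" using n(3) d by (simp add: log_less_iff)
    then have "1 / 2 ^ n < 2 * d" using d by (simp add: powr_realpow powr_add field_simps)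
    then have "(1 / 2 ^ n) powr \<beta> \<le> (2 * d) powr \<beta>" using \<beta> by (intro powr_mono2) auto
    moreover have "q ^ n = (1 / 2 ^ n) powr \<beta>"
    proof -
      have "q ^ n = q powr real n" using q by (simp only: powr_realpow)
      also have "\<dots> = (2 powr - real n) powr \<beta>" unfolding q_def powr_powr by (simp add: mult.commute)
      also have "2 powr - real n = 1 / 2 ^ n" by (simp add: powr_minus powr_realpow divide_inverse)
      finally show ?thesis .
    qed
    ultimately have qn: "q ^ n \<le> 2 powr \<beta> * d powr \<beta>" using d by (simp add: powr_mult)
    have "2 ^ n * u \<le> 2 ^ n * s + 1" using dn by (simp add: d_def algebra_simps)
    then have "\<lfloor>2 ^ n * u\<rfloor> \<le> \<lfloor>2 ^ n * s\<rfloor> + 1" by linarith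
    moreover have "\<lfloor>2 ^ n * s\<rfloor> \<le> \<lfloor>2 ^ n * u\<rfloor>" "0 \<le> \<lfloor>2 ^ n * s\<rfloor>" using s by (auto intro!: floor_mono)
    ultimately have ku: "k n u = k n s \<or> k n u = Suc (k n s)" unfolding k_def by linarith
    have "\<bar>f (a n s) - f (a n u)\<bar> \<le> q ^ n"
      using ku
    proof
      assume "k n u = Suc (k n s)"
      then show ?thesis unfolding a_def q_def using inc[OF n(1) kl[of s n]] s by (simp add: abs_minus_commute)
    qed (use q in \<open>simp add: a_def\<close>)
    moreover have "\<bar>f s - f (a n s)\<bar> \<le> q ^ n / (1 - q)" "\<bar>f u - f (a n u)\<bar> \<le> q ^ n / (1 - q)"
      using s n by (auto intro!: tail)
    ultimately have "\<bar>f s - f u\<bar> \<le> q ^ n + 2 * (q ^ n / (1 - q))" by linarith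
    also have "\<dots> = (1 + 2 / (1 - q)) * q ^ n" using q by (simp add: field_simps)
    also have "\<dots> \<le> (1 + 2 / (1 - q)) * (2 powr \<beta> * d powr \<beta>)"
      using qn q by (intro mult_left_mono) (auto intro!: add_nonneg_nonneg)
    finally show ?thesis by (simp add: C_def d_def mult_ac)
  qed
  show ?thesis
  proof (rule that[OF C])
    fix s u :: real assume su: "s \<in> {0..1 / 2 ^ Suc N}" "u \<in> {0..1 / 2 ^ Suc N}"
    have l: "1 / 2 ^ Suc N \<le> (1::real) / 2 ^ N" "1 / 2 ^ Suc N < (1::real)"
    proof -
      show "1 / 2 ^ Suc N \<le> (1::real) / 2 ^ N" by (simp add: field_simps)
      have "(1::real) < 2 ^ Suc N" by (rule one_less_power) auto
      then show "1 / 2 ^ Suc N < (1::real)" by (simp add: field_simps)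
    qed
    consider "s = u" | "s < u" | "u < s" by linarith
    then show "\<bar>f s - f u\<bar> \<le> C * \<bar>s - u\<bar> powr \<beta>"
    proof cases
      case 2
      then have "0 \<le> s" "u < 1" "u - s \<le> 1 / 2 ^ N"
        using su l unfolding atLeastAtMost_iff by linarith+
      then show ?thesis using main[of s u] 2 by auto
    next
      case 3
      then have "0 \<le> u" "s < 1" "s - u \<le> 1 / 2 ^ N"
        using su l unfolding atLeastAtMost_iff by linarith+
      then show ?thesis using main[of u s] 3 by (auto simp: abs_minus_commute)
    qed simp
  qed
qed

section \<open>Brackets and occupation times\<close>

text \<open>The difference of squares factors into a small sum of increments and an increment of
  \<open>A - D\<close>, whose total variation is at most \<open>V\<close>.\<close>

lemma sum_squares_diff_tendsto:
  fixes X B A D :: "real \<Rightarrow> real"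
  assumes \<tau>: "0 < \<tau>" and cont: "continuous_on {0..\<tau>} X" "continuous_on {0..\<tau>} B"
    and mono: "mono_on {0..\<tau>} A" "mono_on {0..\<tau>} D"
    and eq: "\<And>t. t \<in> {0..\<tau>} \<Longrightarrow> X t = B t + A t - D t"
  shows "(\<lambda>n. (\<Sum>i<2^n. (X (grid \<tau> (2^n) (Suc i)) - X (grid \<tau> (2^n) i))\<^sup>2)
    - (\<Sum>i<2^n. (B (grid \<tau> (2^n) (Suc i)) - B (grid \<tau> (2^n) i))\<^sup>2)) \<longlonglongrightarrow> 0"
proof (rule LIMSEQ_I)
  fix r :: real assume r: "0 < r"
  define V where "V = (A \<tau> - A 0) + (D \<tau> - D 0)"
  have V: "0 \<le> V" using mono_onD[OF mono(1), of 0 \<tau>] mono_onD[OF mono(2), of 0 \<tau>] \<tau> by (simp add: V_def)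
  define e where "e = r / (2 * (V + 1))"
  have e: "0 < e" using V r by (simp add: e_def)
  have ex: "\<exists>d>0. \<forall>u\<in>{0..\<tau>}. \<forall>v\<in>{0..\<tau>}. \<bar>u - v\<bar> < d \<longrightarrow> \<bar>f u - f v\<bar> < e" if "continuous_on {0..\<tau>} f" for f :: "real \<Rightarrow> real"
    using compact_uniformly_continuous[OF that] e unfolding uniformly_continuous_on_def dist_real_def
    by (metis abs_minus_commute compact_Icc)
  obtain d1 d2 where d: "0 < d1" "0 < d2"
    "\<forall>u\<in>{0..\<tau>}. \<forall>v\<in>{0..\<tau>}. \<bar>u - v\<bar> < d1 \<longrightarrow> \<bar>X u - X v\<bar> < e"
    "\<forall>u\<in>{0..\<tau>}. \<forall>v\<in>{0..\<tau>}. \<bar>u - v\<bar> < d2 \<longrightarrow> \<bar>B u - B v\<bar> < e"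
    using ex[OF cont(1)] ex[OF cont(2)] by blast
  have "(\<lambda>n. \<tau> * (1 / 2) ^ n) \<longlonglongrightarrow> \<tau> * 0" by (intro tendsto_intros LIMSEQ_power_zero) auto
  then have "\<forall>\<^sub>F n in sequentially. \<tau> * (1 / 2) ^ n < min d1 d2" using d(1,2) by (intro order_tendstoD) auto
  then obtain n0 where n0: "\<And>n. n0 \<le> n \<Longrightarrow> \<tau> * (1 / 2) ^ n < min d1 d2" by (auto simp: eventually_sequentially)
  have "\<bar>(\<Sum>i<2^n. (X (grid \<tau> (2^n) (Suc i)) - X (grid \<tau> (2^n) i))\<^sup>2)
    - (\<Sum>i<2^n. (B (grid \<tau> (2^n) (Suc i)) - B (grid \<tau> (2^n) i))\<^sup>2)\<bar> < r" if n: "n0 \<le> n" for n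
  proof -
    let ?g = "grid \<tau> (2 ^ n)"
    define dX dB dA dD where "dX i = X (?g (Suc i)) - X (?g i)" and "dB i = B (?g (Suc i)) - B (?g i)"
      and "dA i = A (?g (Suc i)) - A (?g i)" and "dD i = D (?g (Suc i)) - D (?g i)" for i
    have g: "?g i \<in> {0..\<tau>}" if "i \<le> 2 ^ n" for i using grid_range[of \<tau> "2 ^ n" i] that \<tau> by simp
    have gs: "?g i \<le> ?g (Suc i)" "\<bar>?g (Suc i) - ?g i\<bar> < d1" "\<bar>?g (Suc i) - ?g i\<bar> < d2" for i
      using grid_mono[of \<tau> i "Suc i" "2 ^ n"] n0[OF n] \<tau> by (auto simp: grid_Suc power_divide)
    have t: "\<bar>(dX i)\<^sup>2 - (dB i)\<^sup>2\<bar> \<le> 2 * e * (dA i + dD i)" if i: "i < 2 ^ n" for i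
    proof -
      have gi: "?g i \<in> {0..\<tau>}" "?g (Suc i) \<in> {0..\<tau>}" using g[of i] g[of "Suc i"] i by auto
      have "0 \<le> dA i" "0 \<le> dD i"
        using mono_onD[OF mono(1) gi gs(1)] mono_onD[OF mono(2) gi gs(1)] by (auto simp: dA_def dD_def)
      moreover have "dX i - dB i = dA i - dD i"
        using eq[OF gi(1)] eq[OF gi(2)] by (simp add: dX_def dB_def dA_def dD_def)
      moreover have "\<bar>dX i + dB i\<bar> \<le> 2 * e"
        using d(3)[rule_format, OF gi(2) gi(1) gs(2)] d(4)[rule_format, OF gi(2) gi(1) gs(3)]
        unfolding dX_def dB_def by linarith
      ultimately have "\<bar>dX i + dB i\<bar> * \<bar>dX i - dB i\<bar> \<le> 2 * e * (dA i + dD i)"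
        using e by (intro mult_mono) auto
      then show ?thesis by (simp add: abs_mult[symmetric] power2_eq_square algebra_simps)
    qed
    have "\<bar>(\<Sum>i<2^n. (dX i)\<^sup>2) - (\<Sum>i<2^n. (dB i)\<^sup>2)\<bar> \<le> (\<Sum>i<2^n. \<bar>(dX i)\<^sup>2 - (dB i)\<^sup>2\<bar>)"
      by (simp add: sum_subtractf[symmetric] sum_abs)
    also have "\<dots> \<le> (\<Sum>i<2^n. 2 * e * (dA i + dD i))" using t by (intro sum_mono) auto
    also have "\<dots> = 2 * e * ((\<Sum>i<2^n. dA i) + (\<Sum>i<2^n. dD i))"
      by (simp only: sum.distrib[symmetric] sum_distrib_left[symmetric])
    also have "(\<Sum>i<2^n. dA i) + (\<Sum>i<2^n. dD i) = V"
      using sum_lessThan_telescope[of "\<lambda>i. A (?g i)" "2 ^ n"] sum_lessThan_telescope[of "\<lambda>i. D (?g i)" "2 ^ n"]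
      unfolding dA_def dD_def V_def by (simp add: grid_0 grid_N)
    also have "2 * e * V < r"
    proof -
      have "2 * e * V < 2 * e * (V + 1)" using e by simp
      also have "\<dots> = r"
      proof -
        have "2 * (r / (2 * w)) * w = r" if "0 < w" for w using that by simp
        then show ?thesis using V unfolding e_def by (smt (verit))
      qed
      finally show ?thesis .
    qed
    finally show ?thesis by (simp add: dX_def dB_def)
  qed
  then show "\<exists>n0. \<forall>n\<ge>n0. norm ((\<Sum>i<2^n. (X (grid \<tau> (2^n) (Suc i)) - X (grid \<tau> (2^n) i))\<^sup>2)
    - (\<Sum>i<2^n. (B (grid \<tau> (2^n) (Suc i)) - B (grid \<tau> (2^n) i))\<^sup>2) - 0) < r" by auto
qed

lemma occupation_integral:
  "(LINT s:{0..t}|\<mu>. indicator I (f s)) = measure \<mu> ({s\<in>{0..t}. f s \<in> I} \<inter> space \<mu>)"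
proof -
  have "(\<lambda>s. indicator {0..t} s *\<^sub>R (indicator I (f s) :: real)) = indicator {s\<in>{0..t}. f s \<in> I}"
    by (auto simp: fun_eq_iff indicator_def)
  then show ?thesis unfolding set_lebesgue_integral_def by simp
qed

lemma borel_occupation_set:
  fixes f :: "real \<Rightarrow> real"
  assumes "continuous_on {0..t} f" shows "{s\<in>{0..t}. f s \<in> {a..<c}} \<in> sets borel"
proof -
  have "closed {s\<in>{0..t}. a \<le> f s}" "closed {s\<in>{0..t}. c \<le> f s}"
    by (intro continuous_on_closed_Collect_le assms continuous_on_const closed_atLeastAtMost)+
  moreover have "{s\<in>{0..t}. f s \<in> {a..<c}} = {s\<in>{0..t}. a \<le> f s} - {s\<in>{0..t}. c \<le> f s}" by auto
  ultimately show ?thesis by auto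
qed

text \<open>Monotonicity of the local time has to be obtained for an unknown bracket
  \<open>Q\<close>: it is needed to see that the drift has finite variation, and only then can
  \<open>Q\<close> be identified.\<close>

lemma local_time_limit_mono:
  fixes f Q L :: "real \<Rightarrow> real"
  assumes T: "0 < T" and cont: "continuous_on {0..T} f" "continuous_on {0..T} Q" "mono_on {0..T} Q"
    and lim: "\<And>t. t \<in> {0..T} \<Longrightarrow>
      ((\<lambda>\<epsilon>. 1 / \<epsilon> * (LINT s:{0..t}|stieltjes_measure (\<lambda>s. Q (min s T)). indicator {a..<a + \<epsilon>} (f s))) \<longlongrightarrow> L t) (at_right 0)"
  shows "mono_on {0..T} L"
proof (rule mono_onI)
  let ?\<mu> = "stieltjes_measure (\<lambda>s. Q (min s T))"
  fix s t assume st: "s \<in> {0..T}" "t \<in> {0..T}" "s \<le> t"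
  have sets: "sets ?\<mu> = sets borel" "space ?\<mu> = UNIV" by (auto simp: stieltjes_measure_def)
  have "emeasure ?\<mu> {0..T} = Q (min (max 0 T) T) - Q (min (max 0 0) T)"
    unfolding stieltjes_measure_def
  proof (rule emeasure_interval_measure_Icc)
    show "continuous_on UNIV (\<lambda>t. Q (min (max 0 t) T))"
      by (rule continuous_on_compose2[OF cont(2)]) (use T in \<open>auto intro!: continuous_intros\<close>)
    show "Q (min (max 0 x) T) \<le> Q (min (max 0 y) T)" if "x \<le> y" for x y
      using that T by (intro mono_onD[OF cont(3)]) auto
  qed (use T in auto)
  then have fin: "emeasure ?\<mu> {0..T} < \<infinity>" by simp
  show "L s \<le> L t"
  proof (rule tendsto_le[OF _ lim[OF st(2)] lim[OF st(1)]])
    show "\<forall>\<^sub>F \<epsilon> in at_right 0. 1 / \<epsilon> * (LINT u:{0..s}|?\<mu>. indicator {a..<a + \<epsilon>} (f u))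
      \<le> 1 / \<epsilon> * (LINT u:{0..t}|?\<mu>. indicator {a..<a + \<epsilon>} (f u))"
      unfolding occupation_integral
    proof (rule eventually_at_rightI[of 0 1])
      fix \<epsilon> :: real assume "\<epsilon> \<in> {0<..<1}"
      let ?S = "\<lambda>t. {u\<in>{0..t}. f u \<in> {a..<a + \<epsilon>}} \<inter> space ?\<mu>"
      have m: "?S u \<in> sets ?\<mu>" if "u \<in> {0..T}" for u
      proof -
        have "{0..u} \<subseteq> {0..T}" using that by auto
        from borel_occupation_set[OF continuous_on_subset[OF cont(1) this], of a "a + \<epsilon>"]
        show ?thesis by (simp add: sets)
      qed
      have "measure ?\<mu> (?S s) \<le> measure ?\<mu> (?S t)"
      proof (rule measure_mono_fmeasurable)
        have "emeasure ?\<mu> (?S t) \<le> emeasure ?\<mu> {0..T}" using st by (intro emeasure_mono) (auto simp: sets)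
        then show "?S t \<in> fmeasurable ?\<mu>" using m[OF st(2)] fin by (intro fmeasurableI) auto
      qed (use st m in auto)
      then show "1 / \<epsilon> * measure ?\<mu> (?S s) \<le> 1 / \<epsilon> * measure ?\<mu> (?S t)"
        using \<open>\<epsilon> \<in> {0<..<1}\<close> by (intro mult_left_mono) auto
    qed simp
  qed simp
qed

lemma clamp_interval_measure:
  assumes T: "0 < T"
  shows "interval_measure (\<lambda>t. min (max 0 t) T) = density lborel (indicator {0..T})" (is "?I = ?D")
proof (rule measure_eqI_generator_eq[where \<Omega>=UNIV and E="range (\<lambda>(a, b). {a<..b::real})" and A="\<lambda>i. {- real i<..real i}"])
  let ?G = "\<lambda>t. min (max 0 t) T"
  have I: "emeasure ?I {a<..b} = ?G b - ?G a" if "a \<le> b" for a b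
  proof (rule emeasure_interval_measure_Ioc[OF that])
    have "continuous_on UNIV ?G" by (intro continuous_intros)
    then show "continuous (at_right a) ?G" for a by (auto simp: continuous_on_eq_continuous_within intro: continuous_within_subset)
  qed auto
  show "Int_stable (range (\<lambda>(a, b). {a<..b::real}))" by (auto simp: Int_stable_def)
  show "emeasure ?I X = emeasure ?D X" if "X \<in> range (\<lambda>(a, b). {a<..b})" for X
  proof -
    obtain p where p: "X = (\<lambda>(a, b). {a<..b}) p" using \<open>X \<in> _\<close> by (rule rangeE)
    obtain a b where "p = (a, b)" by (cases p)
    then have X: "X = {a<..b}" using p by simp
    have D: "emeasure ?D X = emeasure lborel ({0..T} \<inter> X)"
      using X by (subst emeasure_density) (auto simp: nn_integral_indicator[symmetric] indicator_inter_arith intro!: nn_integral_cong)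
    show ?thesis
    proof (cases "a \<le> b")
      case True
      have "{0..T} \<inter> X = (if a < 0 then {0..min b T} else {a<..min b T})" using X by auto
      then show ?thesis unfolding D using I[OF True] T True X by (auto simp: min_def max_def)
    qed (use X in simp)
  qed
  show "sets ?I = sigma_sets UNIV (range (\<lambda>(a, b). {a<..b}))" "sets ?D = sigma_sets UNIV (range (\<lambda>(a, b). {a<..b}))"
    by (simp_all add: borel_sigma_sets_Ioc)
  show "range (\<lambda>i. {- real i<..real i}) \<subseteq> range (\<lambda>(a, b). {a<..b})" by auto
  show "(\<Union>i. {- real i<..real i}) = UNIV"
  proof (intro equalityI subsetI UN_I)
    fix x :: real
    show "x \<in> {- real (nat (\<lfloor>\<bar>x\<bar>\<rfloor> + 1))<..real (nat (\<lfloor>\<bar>x\<bar>\<rfloor> + 1))}" by (auto; linarith)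
  qed auto
  show "emeasure ?I {- real i<..real i} \<noteq> \<infinity>" for i by (subst I) auto
qed auto

lemma occupation_integral_clock:
  fixes f Q :: "real \<Rightarrow> real"
  assumes T: "0 < T" and Q: "\<And>s. s \<in> {0..T} \<Longrightarrow> Q s = s" and t: "t \<in> {0..T}" and cont: "continuous_on {0..T} f"
  shows "(LINT s:{0..t}|stieltjes_measure (\<lambda>s. Q (min s T)). indicator {a..<c} (f s))
    = measure lborel {s\<in>{0..t}. f s \<in> {a..<c}}"
proof -
  have "(\<lambda>t. Q (min (max 0 t) T)) = (\<lambda>t. min (max 0 t) T)" using T by (intro ext Q) auto
  then have \<mu>: "stieltjes_measure (\<lambda>s. Q (min s T)) = density lborel (indicator {0..T})"
    by (simp add: stieltjes_measure_def clamp_interval_measure[OF T])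
  let ?S = "{s\<in>{0..t}. f s \<in> {a..<c}}"
  have S: "?S \<in> sets borel" using t by (intro borel_occupation_set continuous_on_subset[OF cont]) auto
  have "emeasure (density lborel (indicator {0..T})) ?S = emeasure lborel ({0..T} \<inter> ?S)"
    using S by (subst emeasure_density) (auto simp: nn_integral_indicator[symmetric] indicator_inter_arith intro!: nn_integral_cong)
  also have "{0..T} \<inter> ?S = ?S" using t by auto
  finally show ?thesis unfolding occupation_integral \<mu> by (simp add: measure_def)
qed

context brownian_space
begin

lemma AE_quadratic_variation_eq:
  assumes T: "0 < T" and Q: "is_quadratic_variation M F T X Q"
    and X: "\<And>t. t \<in> {0..T} \<Longrightarrow> X t \<in> borel_measurable (F t)"
    and path: "AE \<omega> in M. continuous_on {0..T} (\<lambda>t. X t \<omega>) \<and> continuous_on {0..T} (\<lambda>t. B t \<omega>) \<and>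
      (\<exists>A D. mono_on {0..T} A \<and> mono_on {0..T} D \<and> (\<forall>t\<in>{0..T}. X t \<omega> = B t \<omega> + A t - D t))"
  shows "AE \<omega> in M. \<forall>t\<in>{0..T}. Q t \<omega> = t"
proof -
  have Qm: "Q t \<in> borel_measurable M" and Xm: "X t \<in> borel_measurable M" if "t \<in> {0..T}" for t
  proof -
    have "Q t \<in> borel_measurable (F t)"
      using Q that by (auto simp only: is_quadratic_variation_def continuous_adapted_def)
    then show "Q t \<in> borel_measurable M" by (rule measurable_from_subalg[OF subalgebra_F])
    show "X t \<in> borel_measurable M" by (rule measurable_from_subalg[OF subalgebra_F X[OF that]])
  qed
  have fixed: "AE \<omega> in M. Q t \<omega> = t" if t: "t \<in> {0<..T}" for t
  proof (rule AE_eq_of_limit_in_measure)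
    let ?g = "\<lambda>n. grid t (2 ^ n)"
    let ?S = "\<lambda>Z n \<omega>. \<Sum>i<2^n. (Z (?g n (Suc i)) \<omega> - Z (?g n i) \<omega>)\<^sup>2"
    have g: "?g n i \<in> {0..t}" if "i \<le> 2 ^ n" for n i using grid_range[of t "2 ^ n" i] that t by simp
    show "?S X n \<in> borel_measurable M" for n
    proof (intro borel_measurable_sum borel_measurable_power borel_measurable_diff Xm)
      fix i :: nat assume "i \<in> {..<2 ^ n}"
      then show "?g n (Suc i) \<in> {0..T}" "?g n i \<in> {0..T}" using g[of "Suc i" n] g[of i n] t by auto
    qed
    show "Q t \<in> borel_measurable M" using t by (intro Qm) auto
    have t0: "0 < t" using t by simp
    have "AE \<omega> in M. (\<lambda>n. \<Sum>i<2^n. 1 * ((B (?g n (Suc i)) \<omega> - B (?g n i) \<omega>)\<^sup>2 - t / real (2^n))) \<longlonglongrightarrow> 0"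
      by (rule AE_bracket_error[OF t0]) auto
    with path show "AE \<omega> in M. (\<lambda>n. ?S X n \<omega>) \<longlonglongrightarrow> t"
    proof eventually_elim
      case (elim \<omega>)
      then obtain A D where AD: "mono_on {0..T} A" "mono_on {0..T} D" "\<forall>t\<in>{0..T}. X t \<omega> = B t \<omega> + A t - D t"
        by auto
      have sub: "{0..t} \<subseteq> {0..T}" using t by auto
      have 1: "(\<lambda>n. ?S X n \<omega> - ?S B n \<omega>) \<longlonglongrightarrow> 0"
      proof (rule sum_squares_diff_tendsto[OF t0])
        show "continuous_on {0..t} (\<lambda>t. X t \<omega>)" "continuous_on {0..t} (\<lambda>t. B t \<omega>)"
          using elim continuous_on_subset[OF _ sub] by auto
        show "mono_on {0..t} A" "mono_on {0..t} D" using AD mono_on_subset[OF _ sub] by auto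
        show "X s \<omega> = B s \<omega> + A s - D s" if "s \<in> {0..t}" for s using AD(3) sub that by auto
      qed
      have "(\<lambda>n. ?S B n \<omega> - t) \<longlonglongrightarrow> 0" using elim(2) by (simp add: sum_subtractf)
      from tendsto_add[OF 1 this] have "(\<lambda>n. ?S X n \<omega> - t) \<longlonglongrightarrow> 0" by simp
      then show ?case by (simp add: LIM_zero_iff)
    qed
    fix \<eta> \<epsilon> :: real assume "0 < \<eta>" "0 < \<epsilon>"
    moreover have "t \<in> {0..T}" using t by simp
    moreover note conjunct2[OF conjunct2[OF Q[unfolded is_quadratic_variation_def]]]
    ultimately have "\<exists>\<delta>>0. \<forall>n p. partition_of 0 t n p \<and> (\<forall>i<n. p (Suc i) - p i < \<delta>) \<longrightarrow>
        prob {\<omega>\<in>space M. \<bar>(\<Sum>i<n. (X (p (Suc i)) \<omega> - X (p i) \<omega>)\<^sup>2) - Q t \<omega>\<bar> > \<eta>} < \<epsilon>"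
      by blast
    then obtain \<delta> where \<delta>: "0 < \<delta>" "\<And>n p. partition_of 0 t n p \<and> (\<forall>i<n. p (Suc i) - p i < \<delta>) \<Longrightarrow>
        prob {\<omega>\<in>space M. \<bar>(\<Sum>i<n. (X (p (Suc i)) \<omega> - X (p i) \<omega>)\<^sup>2) - Q t \<omega>\<bar> > \<eta>} < \<epsilon>"
      by blast
    have "(\<lambda>n. t * (1 / 2) ^ n) \<longlonglongrightarrow> t * 0" by (intro tendsto_intros LIMSEQ_power_zero) auto
    then have "\<forall>\<^sub>F n in sequentially. t * (1 / 2) ^ n < \<delta>" using \<delta>(1) by (intro order_tendstoD) auto
    then obtain N where N: "\<And>n. N \<le> n \<Longrightarrow> t * (1 / 2) ^ n < \<delta>" by (auto simp: eventually_sequentially)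
    show "\<exists>N. \<forall>n\<ge>N. prob {\<omega>\<in>space M. \<eta> < \<bar>?S X n \<omega> - Q t \<omega>\<bar>} < \<epsilon>"
    proof (intro exI[of _ N] allI impI)
      fix n assume "N \<le> n"
      then show "prob {\<omega>\<in>space M. \<eta> < \<bar>?S X n \<omega> - Q t \<omega>\<bar>} < \<epsilon>"
        using N[of n] t0 by (intro \<delta>(2)) (auto simp: partition_of_def grid_0 grid_N grid_Suc power_divide intro!: grid_mono)
    qed
  qed
  \<comment> \<open>The identity holds at countably many times simultaneously and extends by
    continuity of \<open>Q\<close>. Time 0 is covered by \<open>Q 0 = 0\<close>, as
    \<open>fixed\<close> concerns positive times.\<close>
  have "AE \<omega> in M. \<forall>n. \<forall>i\<in>{0<..2^n}. Q (grid T (2^n) i) \<omega> = grid T (2^n) i"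
    unfolding AE_all_countable
  proof (intro allI AE_finite_allI)
    fix n i :: nat assume i: "i \<in> {0<..2 ^ n}"
    then show "AE \<omega> in M. Q (grid T (2^n) i) \<omega> = grid T (2^n) i"
      using grid_range[of T "2 ^ n" i] T by (intro fixed) (auto simp: grid_def)
  qed auto
  moreover have "AE \<omega> in M. continuous_on {0..T} (\<lambda>t. Q t \<omega>) \<and> Q 0 \<omega> = 0"
    using Q by (auto simp: is_quadratic_variation_def continuous_adapted_def)
  ultimately show ?thesis
  proof eventually_elim
    case (elim \<omega>)
    show ?case
    proof
      fix t assume t: "t \<in> {0..T}"
      define k where "k n = nat \<lceil>2 ^ n * t / T\<rceil>" for n
      have k: "2 ^ n * t / T \<le> real (k n)" "real (k n) < 2 ^ n * t / T + 1" "k n \<le> 2 ^ n" for n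
      proof -
        have "0 \<le> 2 ^ n * t / T" using t T by simp
        then show "2 ^ n * t / T \<le> real (k n)" "real (k n) < 2 ^ n * t / T + 1" unfolding k_def by linarith+
        have "2 ^ n * t / T \<le> 2 ^ n" using t T by (simp add: pos_divide_le_eq)
        then have "\<lceil>2 ^ n * t / T\<rceil> \<le> 2 ^ n" by (simp add: ceiling_le_iff)
        then show "k n \<le> 2 ^ n" unfolding k_def by (simp add: nat_le_iff)
      qed
      let ?a = "\<lambda>n. grid T (2 ^ n) (k n)"
      have Qa: "Q (?a n) \<omega> = ?a n" for n
        using elim k(3)[of n] by (cases "k n = 0") (auto simp: grid_0)
      have aT: "?a n \<in> {0..T}" for n using grid_range[of T "2 ^ n" "k n"] k(3)[of n] T by auto
      have "(\<lambda>n. t + T * (1 / 2) ^ n) \<longlonglongrightarrow> t + T * 0" by (intro tendsto_intros LIMSEQ_power_zero) auto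
      then have up: "(\<lambda>n. t + T * (1 / 2) ^ n) \<longlonglongrightarrow> t" by simp
      have bd: "t \<le> ?a n" "?a n \<le> t + T * (1 / 2) ^ n" for n
      proof -
        have "2 ^ n * t \<le> real (k n) * T" "real (k n) * T \<le> 2 ^ n * t + T"
          using k(1,2)[of n] T by (auto simp: field_simps)
        then have "t \<le> real (k n) * T / 2 ^ n" "real (k n) * T / 2 ^ n \<le> (2 ^ n * t + T) / 2 ^ n"
          by (auto simp: pos_le_divide_eq mult.commute intro!: divide_right_mono)
        then show "t \<le> ?a n" "?a n \<le> t + T * (1 / 2) ^ n"
          by (auto simp: grid_def add_divide_distrib power_divide mult.commute)
      qed
      have a: "?a \<longlonglongrightarrow> t"
      proof (rule tendsto_sandwich[OF _ _ tendsto_const up])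
        show "\<forall>\<^sub>F n in sequentially. t \<le> ?a n" "\<forall>\<^sub>F n in sequentially. ?a n \<le> t + T * (1 / 2) ^ n"
          by (rule always_eventually, rule allI, rule bd)+
      qed
      have "(\<lambda>n. Q (?a n) \<omega>) \<longlonglongrightarrow> Q t \<omega>"
        using elim aT t a by (intro continuous_on_tendsto_compose[where f = "\<lambda>t. Q t \<omega>" and s = "{0..T}"]) auto
      then have "?a \<longlonglongrightarrow> Q t \<omega>" by (simp add: Qa)
      from LIMSEQ_unique[OF this a] show "Q t \<omega> = t" .
    qed
  qed
qed

end

section \<open>Nonexistence of solutions\<close>

context brownian_space
begin

lemma AE_reflected_path:
  assumes T: "0 < T" and \<nu>: "\<nu> < 1"
    and b: "continuous_on {0..T} b" "mono_on {0..T} b" "b 0 = 0"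
    and W: "continuous_adapted M F T W"
    and loc: "is_local_time M F T (\<lambda>t \<omega>. W t \<omega> - b t) 0 L"
    and eq: "AE \<omega> in M. \<forall>t\<in>{0..T}. W t \<omega> = B t \<omega> + \<nu> * running_max (\<lambda>s. W s \<omega>) t + 1 / 2 * L t \<omega> \<and> W t \<omega> - b t \<ge> 0"
  shows "AE \<omega> in M. reflected_path (\<lambda>t. W t \<omega>) (\<lambda>t. B t \<omega>) (\<lambda>t. L t \<omega>) b \<nu> T"
proof -
  let ?X = "\<lambda>t \<omega>. W t \<omega> - b t"
  obtain Q where Q: "is_quadratic_variation M F T ?X Q"
    and lim: "AE \<omega> in M. \<forall>t\<in>{0..T}.
      ((\<lambda>\<epsilon>. 1 / \<epsilon> * (LINT s:{0..t}|stieltjes_measure (\<lambda>s. Q (min s T) \<omega>). indicator {0..<0 + \<epsilon>} (?X s \<omega>))) \<longlongrightarrow> L t \<omega>) (at_right 0)"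
    using loc by (auto simp: is_local_time_def)
  have contW: "AE \<omega> in M. continuous_on {0..T} (\<lambda>t. W t \<omega>)"
    and Wm: "\<And>t. t \<in> {0..T} \<Longrightarrow> W t \<in> borel_measurable (F t)"
    using W by (auto simp: continuous_adapted_def)
  have contB: "AE \<omega> in M. continuous_on {0..} (\<lambda>t. B t \<omega>)" and B0: "AE \<omega> in M. B 0 \<omega> = 0"
    using brownian by (auto simp: brownian_motion_def)
  have contQ: "AE \<omega> in M. continuous_on {0..T} (\<lambda>t. Q t \<omega>)" and monoQ: "AE \<omega> in M. Q 0 \<omega> = 0 \<and> mono_on {0..T} (\<lambda>t. Q t \<omega>)"
    using Q unfolding is_quadratic_variation_def continuous_adapted_def by blast+
  have "AE \<omega> in M. \<forall>t\<in>{0..T}. Q t \<omega> = t"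
  proof (rule AE_quadratic_variation_eq[OF T Q])
    show "?X t \<in> borel_measurable (F t)" if "t \<in> {0..T}" for t using Wm[OF that] by simp
    show "AE \<omega> in M. continuous_on {0..T} (\<lambda>t. ?X t \<omega>) \<and> continuous_on {0..T} (\<lambda>t. B t \<omega>) \<and>
      (\<exists>A D. mono_on {0..T} A \<and> mono_on {0..T} D \<and> (\<forall>t\<in>{0..T}. ?X t \<omega> = B t \<omega> + A t - D t))"
      using contW contB contQ monoQ lim eq
    proof eventually_elim
      case (elim \<omega>)
      let ?M = "running_max (\<lambda>s. W s \<omega>)"
      have cX: "continuous_on {0..T} (\<lambda>t. ?X t \<omega>)" using elim(1) b(1) by (intro continuous_intros)
      have mM: "mono_on {0..T} ?M" by (rule mono_on_running_max[OF elim(1)])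
      have mL: "mono_on {0..T} (\<lambda>t. L t \<omega>)"
      proof (rule local_time_limit_mono[OF T cX elim(3)])
        show "mono_on {0..T} (\<lambda>t. Q t \<omega>)" using elim(4) by simp
        show "((\<lambda>\<epsilon>. 1 / \<epsilon> * (LINT s:{0..t}|stieltjes_measure (\<lambda>s. Q (min s T) \<omega>). indicator {0..<0 + \<epsilon>} (?X s \<omega>))) \<longlongrightarrow> L t \<omega>) (at_right 0)"
          if "t \<in> {0..T}" for t using elim(5) that by (rule bspec)
      qed
      \<comment> \<open>Splitting \<nu> into its positive and negative part writes the drift as a
        difference of two monotone functions, whatever the sign of \<nu>.\<close>
      have "mono_on {0..T} (\<lambda>t. max \<nu> 0 * ?M t + L t \<omega> / 2)" "mono_on {0..T} (\<lambda>t. max (- \<nu>) 0 * ?M t + b t)"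
        using mM mL b(2) by (auto simp: mono_on_def intro!: add_mono mult_left_mono)
      moreover have "?X t \<omega> = B t \<omega> + (max \<nu> 0 * ?M t + L t \<omega> / 2) - (max (- \<nu>) 0 * ?M t + b t)" if "t \<in> {0..T}" for t
        using elim(6) that by (cases "0 \<le> \<nu>") (auto simp: max_def)
      moreover have "continuous_on {0..T} (\<lambda>t. B t \<omega>)" using elim(2) by (rule continuous_on_subset) auto
      ultimately show ?case using cX by blast
    qed
  qed
  with contW contB B0 lim eq show ?thesis
  proof eventually_elim
    case (elim \<omega>)
    show ?case
    proof
      show "continuous_on {0..T} (\<lambda>t. W t \<omega>)" by (rule elim(1))
      show "continuous_on {0..T} (\<lambda>t. B t \<omega>)" using elim(2) by (rule continuous_on_subset) auto
      fix t assume t: "t \<in> {0..T}"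
      have cX: "continuous_on {0..T} (\<lambda>t. ?X t \<omega>)" using elim(1) b(1) by (intro continuous_intros)
      have E: "(LINT s:{0..t}|stieltjes_measure (\<lambda>s. Q (min s T) \<omega>). indicator {0..<0 + \<epsilon>} (?X s \<omega>))
        = measure lborel {s\<in>{0..t}. ?X s \<omega> \<in> {0..<\<epsilon>}}" for \<epsilon>
        using occupation_integral_clock[OF T _ t cX, of "\<lambda>s. Q s \<omega>" 0 "0 + \<epsilon>"] elim(6) by simp
      show "((\<lambda>\<epsilon>. 1 / \<epsilon> * measure lborel {s\<in>{0..t}. ?X s \<omega> \<in> {0..<\<epsilon>}}) \<longlongrightarrow> L t \<omega>) (at_right 0)"
        using bspec[OF elim(4) t] unfolding E .
      show "W t \<omega> = B t \<omega> + \<nu> * running_max (\<lambda>t. W t \<omega>) t + 1 / 2 * L t \<omega>"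
        using bspec[OF elim(5) t] by (rule conjunct1)
      show "b t \<le> W t \<omega>" using conjunct2[OF bspec[OF elim(5) t]] by simp
    qed (use T \<nu> b elim(3) in auto)
  qed
qed

lemma no_solution:
  assumes T: "0 < T" and \<nu>: "\<nu> < 1"
    and b: "continuous_on {0..} b" "mono_on {0..} b" "b 0 = 0"
    and p: "2 < p" and K: "0 < K"
    and sums: "\<And>d. 0 < d \<Longrightarrow> \<exists>\<tau> c. 0 < \<tau> \<and> \<tau> < d \<and> 0 < c \<and> (\<forall>n t. (\<forall>i<n. t i \<le> t (Suc i)) \<and> t 0 = 0 \<and> t n = \<tau> \<longrightarrow>
       c \<le> (\<Sum>i | i < n \<and> (\<exists>s\<in>{t i..t (Suc i)}. steep K p b s). b (t (Suc i)) - b (t i)))"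
  shows "\<not> is_solution M F B b \<nu> T W"
proof
  assume sol: "is_solution M F B b \<nu> T W"
  then have W: "continuous_adapted M F T W"
    by (auto simp: is_solution_def continuous_semimartingale_def)
  obtain L where L: "is_local_time M F T (\<lambda>t \<omega>. W t \<omega> - b t) 0 L"
    "AE \<omega> in M. \<forall>t\<in>{0..T}. W t \<omega> = B t \<omega> + \<nu> * running_max (\<lambda>s. W s \<omega>) t + 1 / 2 * L t \<omega> \<and> W t \<omega> - b t \<ge> 0"
    using sol by (auto simp: is_solution_def)
  have path: "AE \<omega> in M. reflected_path (\<lambda>t. W t \<omega>) (\<lambda>t. B t \<omega>) (\<lambda>t. L t \<omega>) b \<nu> T"
    using b by (intro AE_reflected_path[OF T \<nu> _ _ _ W L]) (auto intro: continuous_on_subset mono_on_subset)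
  \<comment> \<open>The midpoint between 1 / p and 1 / 2: Brownian paths are still Hoelder with this
    exponent, and \<open>\<beta> * p > 1\<close> as \<open>contact_at_steep\<close> demands.\<close>
  define \<beta> where "\<beta> = (1 / p + 1 / 2) / 2"
  have \<beta>: "0 < \<beta>" "\<beta> < 1 / 2" "1 < \<beta> * p" using p by (auto simp: \<beta>_def field_simps)
  \<comment> \<open>The almost sure statements below must hold for all horizons at once, before the
    path and its Hoelder constant are known; hence a deterministic sequence tending to 0.\<close>
  have "\<forall>m. \<exists>\<tau> c. 0 < \<tau> \<and> \<tau> < min T (1 / real (Suc m)) \<and> 0 < c \<and> (\<forall>n t. (\<forall>i<n. t i \<le> t (Suc i)) \<and> t 0 = 0 \<and> t n = \<tau> \<longrightarrow>
       c \<le> (\<Sum>i | i < n \<and> (\<exists>s\<in>{t i..t (Suc i)}. steep K p b s). b (t (Suc i)) - b (t i)))"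
    using T by (intro allI sums) auto
  from choice[OF this] obtain \<tau> where "\<forall>m. \<exists>c. 0 < \<tau> m \<and> \<tau> m < min T (1 / real (Suc m)) \<and> 0 < c \<and>
      (\<forall>n t. (\<forall>i<n. t i \<le> t (Suc i)) \<and> t 0 = 0 \<and> t n = \<tau> m \<longrightarrow>
       c \<le> (\<Sum>i | i < n \<and> (\<exists>s\<in>{t i..t (Suc i)}. steep K p b s). b (t (Suc i)) - b (t i)))" ..
  from choice[OF this] obtain c where \<tau>c: "\<forall>m. 0 < \<tau> m \<and> \<tau> m < min T (1 / real (Suc m)) \<and> 0 < c m \<and>
      (\<forall>n t. (\<forall>i<n. t i \<le> t (Suc i)) \<and> t 0 = 0 \<and> t n = \<tau> m \<longrightarrow>
       c m \<le> (\<Sum>i | i < n \<and> (\<exists>s\<in>{t i..t (Suc i)}. steep K p b s). b (t (Suc i)) - b (t i)))" ..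
  have \<tau>: "0 < \<tau> m" "\<tau> m < min T (1 / real (Suc m))" and c: "0 < c m" for m
    using \<tau>c[rule_format, of m] by blast+
  have sm: "c m \<le> (\<Sum>i | i < n \<and> (\<exists>s\<in>{t i..t (Suc i)}. steep K p b s). b (t (Suc i)) - b (t i))"
    if "(\<forall>i<n. t i \<le> t (Suc i)) \<and> t 0 = 0 \<and> t n = \<tau> m" for m n t
    using \<tau>c[rule_format, of m] that by blast
  \<comment> \<open>Likewise a countable family of levels, for the sake of the null sets in
    \<open>bracket\<close>.\<close>
  define eps where "eps k = 1 / (real k + 1)" for k
  have eps: "filterlim eps (at_right 0) sequentially" unfolding eps_def by real_asymp
  have eps0: "eps \<longlonglongrightarrow> 0" unfolding eps_def by real_asymp
  let ?g = "\<lambda>m n. grid (\<tau> m) (2 ^ n)"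
  have adapted: "W (?g m n i) \<in> borel_measurable (F (?g m n i))" if "i < 2 ^ n" for m n i
  proof -
    have "?g m n i \<in> {0..\<tau> m}" using \<tau>(1)[of m] that by (intro grid_range) auto
    then show ?thesis using W \<tau>(2)[of m] by (auto simp: continuous_adapted_def)
  qed
  have hat_meas: "(\<lambda>x. hat e x) \<in> borel_measurable borel" for e
    unfolding hat_def by measurable
  have noise: "AE \<omega> in M. \<forall>m. \<forall>\<eta>>0. \<not> (\<forall>\<^sub>F k in sequentially. \<forall>\<^sub>F n in sequentially.
    \<eta> \<le> (\<Sum>i<2^n. hat (eps k) (W (?g m n i) \<omega> - b (?g m n i)) *
      (B (?g m n (Suc i)) \<omega> - B (?g m n i) \<omega>)))"
    unfolding AE_all_countable
  proof
    fix m
    show "AE \<omega> in M. \<forall>\<eta>>0. \<not> (\<forall>\<^sub>F k in sequentially. \<forall>\<^sub>F n in sequentially.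
      \<eta> \<le> (\<Sum>i<2^n. hat (eps k) (W (?g m n i) \<omega> - b (?g m n i)) *
        (B (?g m n (Suc i)) \<omega> - B (?g m n i) \<omega>)))"
    proof (rule AE_noise_not_bounded_below[OF \<tau>(1)])
      show "(\<lambda>\<omega>. hat (eps k) (W (?g m n i) \<omega> - b (?g m n i))) \<in> borel_measurable (F (?g m n i))"
        if "i < 2 ^ n" for k n i
        using adapted[OF that] by (intro measurable_compose[OF _ hat_meas]) auto
      show "\<bar>hat (eps k) (W (?g m n i) \<omega> - b (?g m n i))\<bar> \<le> 1" for k n i \<omega>
        by (simp add: hat_range)
      show "AE \<omega> in M. \<forall>\<delta>>0. \<forall>\<^sub>F k in sequentially. \<forall>\<^sub>F n in sequentially.
        (\<Sum>i<2^n. (hat (eps k) (W (?g m n i) \<omega> - b (?g m n i)))\<^sup>2 * (\<tau> m / real (2^n))) \<le> \<delta>"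
        using path
      proof eventually_elim
        case (elim \<omega>)
        then interpret reflected_path "\<lambda>t. W t \<omega>" "\<lambda>t. B t \<omega>" "\<lambda>t. L t \<omega>" b \<nu> T .
        have "\<tau> m \<le> T" using \<tau>(2)[of m] by simp
        note occ = eventually_compose_filterlim[OF occupation_upper[OF \<tau>(1) this] eps]
        show ?case
        proof (intro allI impI)
          fix \<delta> :: real assume "0 < \<delta>"
          have "(\<lambda>k. 2 * eps k * (L (\<tau> m) \<omega> + 1)) \<longlonglongrightarrow> 2 * 0 * (L (\<tau> m) \<omega> + 1)" by (intro tendsto_intros eps0)
          then have "\<forall>\<^sub>F k in sequentially. 2 * eps k * (L (\<tau> m) \<omega> + 1) < \<delta>"
            using \<open>0 < \<delta>\<close> by (intro order_tendstoD) auto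
          with occ show "\<forall>\<^sub>F k in sequentially. \<forall>\<^sub>F n in sequentially.
            (\<Sum>i<2^n. (hat (eps k) (W (?g m n i) \<omega> - b (?g m n i)))\<^sup>2 * (\<tau> m / real (2^n))) \<le> \<delta>"
            by eventually_elim (auto elim!: eventually_mono)
        qed
      qed
    qed
  qed
  have bracket: "AE \<omega> in M. \<forall>m k. (\<lambda>n. \<Sum>i<2^n. indicator {..<eps k - (eps k)\<^sup>2 / 2} (W (?g m n i) \<omega> - b (?g m n i)) *
      ((B (?g m n (Suc i)) \<omega> - B (?g m n i) \<omega>)\<^sup>2 - \<tau> m / real (2^n))) \<longlonglongrightarrow> 0"
    unfolding AE_all_countable
  proof (intro allI)
    fix m k
    have ind_meas: "(indicator {..<e} :: real \<Rightarrow> real) \<in> borel_measurable borel" for e by measurable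
    show "AE \<omega> in M. (\<lambda>n. \<Sum>i<2^n. indicator {..<eps k - (eps k)\<^sup>2 / 2} (W (?g m n i) \<omega> - b (?g m n i)) *
      ((B (?g m n (Suc i)) \<omega> - B (?g m n i) \<omega>)\<^sup>2 - \<tau> m / real (2^n))) \<longlonglongrightarrow> 0"
    proof (rule AE_bracket_error[OF \<tau>(1)])
      show "(\<lambda>\<omega>. indicator {..<eps k - (eps k)\<^sup>2 / 2} (W (?g m n i) \<omega> - b (?g m n i)) :: real)
        \<in> borel_measurable (F (?g m n i))" if "i < 2 ^ n" for n i
        by (rule measurable_compose[OF _ ind_meas]) (use adapted[OF that] in simp)
    qed (simp add: indicator_def)
  qed
  have "AE \<omega> in M. continuous_on {0..} (\<lambda>t. B t \<omega>)" using brownian by (auto simp: brownian_motion_def)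
  with path noise bracket AE_dyadic_increments[OF \<beta>(1,2)] have "AE \<omega> in M. False"
  proof eventually_elim
    case (elim \<omega>)
    interpret reflected_path "\<lambda>t. W t \<omega>" "\<lambda>t. B t \<omega>" "\<lambda>t. L t \<omega>" b \<nu> T by (rule elim(1))
    obtain N where N: "\<And>n i. N \<le> n \<Longrightarrow> i < 2 ^ n \<Longrightarrow> \<bar>B (grid 1 (2^n) (Suc i)) \<omega> - B (grid 1 (2^n) i) \<omega>\<bar> \<le> (2 powr - \<beta>) ^ n"
      using elim(4) by auto
    have "continuous_on {0..1} (\<lambda>t. B t \<omega>)" using elim(5) by (rule continuous_on_subset) auto
    then obtain C where C: "0 < C"
      "\<And>s u. s \<in> {0..1 / 2 ^ Suc N} \<Longrightarrow> u \<in> {0..1 / 2 ^ Suc N} \<Longrightarrow> \<bar>B s \<omega> - B u \<omega>\<bar> \<le> C * \<bar>s - u\<bar> powr \<beta>"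
      using holder_of_dyadic_increments[OF _ \<beta>(1) N] by blast
    define K' where "K' = K * (C / (1 - max 0 \<nu>)) powr p"
    have \<tau>0: "\<tau> \<longlonglongrightarrow> 0"
    proof (rule tendsto_sandwich[OF _ _ tendsto_const])
      show "(\<lambda>m. 1 / real (Suc m)) \<longlonglongrightarrow> 0" by real_asymp
      show "\<forall>\<^sub>F m in sequentially. 0 \<le> \<tau> m" using \<tau>(1) by (intro always_eventually allI less_imp_le)
      show "\<forall>\<^sub>F m in sequentially. \<tau> m \<le> 1 / real (Suc m)"
        using \<tau>(2) by (intro always_eventually allI less_imp_le) (metis min_less_iff_conj)
    qed
    have "(\<lambda>m. K' * \<tau> m powr (\<beta> * p - 1)) \<longlonglongrightarrow> K' * 0 powr (\<beta> * p - 1)"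
      using \<beta> \<tau>(1) by (intro tendsto_intros tendsto_powr' \<tau>0) (auto intro!: always_eventually less_imp_le)
    then have "\<forall>\<^sub>F m in sequentially. K' * \<tau> m powr (\<beta> * p - 1) < 1" by (intro order_tendstoD) auto
    moreover have "\<forall>\<^sub>F m in sequentially. \<tau> m < 1 / 2 ^ Suc N" by (intro order_tendstoD(2)[OF \<tau>0]) simp
    ultimately have "\<forall>\<^sub>F m in sequentially. K' * \<tau> m powr (\<beta> * p - 1) < 1 \<and> \<tau> m < 1 / 2 ^ Suc N"
      by (rule eventually_conj)
    \<comment> \<open>Only now does the horizon depend on the path: it must be short for its
      constants \<open>C\<close> and \<open>N\<close>.\<close>
    then obtain m where m: "K' * \<tau> m powr (\<beta> * p - 1) < 1" "\<tau> m < 1 / 2 ^ Suc N"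
      unfolding eventually_sequentially by blast
    have \<tau>T: "\<tau> m \<le> T" using \<tau>(2)[of m] by simp
    have contact: "W t \<omega> - b t = 0" if "t \<in> {0..\<tau> m}" "steep K p b t" for t
    proof (rule contact_at_steep[OF _ \<tau>T that K _ C(1) \<beta>(3)])
      fix s u assume "s \<in> {0..\<tau> m}" "u \<in> {0..\<tau> m}"
      then show "\<bar>B s \<omega> - B u \<omega>\<bar> \<le> C * \<bar>s - u\<bar> powr \<beta>"
        using m(2) unfolding atLeastAtMost_iff by (intro C(2)) (unfold atLeastAtMost_iff, linarith+)
    qed (use p m(1) in \<open>auto simp: K'_def\<close>)
    have "\<forall>\<^sub>F k in sequentially. \<forall>\<^sub>F n in sequentially. (1 - max 0 \<nu>) * c m / 4 \<le> noise_sum (\<tau> m) (eps k) n"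
    proof (rule noise_sum_lower[OF \<tau>(1) \<tau>T c contact _ eps])
      fix n
      show "c m \<le> (\<Sum>i | i < 2^n \<and> (\<exists>s\<in>{?g m n i..?g m n (Suc i)}. steep K p b s).
        b (?g m n (Suc i)) - b (?g m n i))"
        using \<tau>(1)[of m] by (intro sm) (auto simp: grid_0 grid_N intro!: grid_mono)
      show "bracket_error (\<tau> m) (eps k) \<longlonglongrightarrow> 0" for k
        using elim(3) unfolding bracket_error_def by blast
    qed
    moreover have "0 < (1 - max 0 \<nu>) * c m / 4" using c[of m] \<nu> by simp
    ultimately show False using elim(2) unfolding noise_sum_def by blast
  qed
  then show False by simp
qed

end

theorem theorem1p2:
  fixes \<alpha> :: real
  assumes "0 < \<alpha>" and "\<alpha> < 1 / 2"
  shows "\<exists>b :: real \<Rightarrow> real.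
     continuous_on {0..} b \<and> mono_on {0..} b \<and> b ` {0..} \<subseteq> {0..1} \<and>
     b 0 = 0 \<and> total_variation_on b {0..} = 1 \<and>
     holder_continuous_on \<alpha> {0..} b \<and>
     mutually_singular lborel (stieltjes_measure b) \<and>
     (\<forall>(M :: 'a measure) F B.
        filtered_prob_space_usual M F \<and> brownian_motion M F B \<longrightarrow>
        (\<forall>\<nu> T. \<nu> < 1 \<and> 0 < T \<longrightarrow> \<not> (\<exists>W. is_solution M F B b \<nu> T W)))"
proof -
  obtain b p K where b: "continuous_on {0..} b" "mono_on {0..} b" "b ` {0..} \<subseteq> {0..1}" "b 0 = 0" "total_variation_on b {0..} = 1"
    "holder_continuous_on \<alpha> {0..} b" "mutually_singular lborel (stieltjes_measure b)" and pK: "2 < p" "0 < K"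
    and sums: "\<And>d. 0 < d \<Longrightarrow> \<exists>\<tau> c. 0 < \<tau> \<and> \<tau> < d \<and> 0 < c \<and> (\<forall>n t. (\<forall>i<n. t i \<le> t (Suc i)) \<and> t 0 = 0 \<and> t n = \<tau> \<longrightarrow>
       c \<le> (\<Sum>i | i < n \<and> (\<exists>s\<in>{t i..t (Suc i)}. steep K p b s). b (t (Suc i)) - b (t i)))"
    by (rule boundary_exists[OF assms]) (rule that; assumption)
  have "\<not> is_solution M F B b \<nu> T W"
    if "filtered_prob_space_usual M F" "brownian_motion M F B" "\<nu> < 1" "0 < T"
    for M :: "'a measure" and F B \<nu> T W
  proof -
    interpret brownian_space M F B
      using that(1,2) by (intro brownian_space.intro brownian_space_axioms.intro)
    show ?thesis by (rule no_solution[OF that(4,3) b(1,2,4) pK sums])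
  qed
  with b show ?thesis by blast
qed

end
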